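(* Assume that $K$ is a kernel with an integral representation $K(x,x')=\int_\Omega \psi(x,\omega)\psi(x',\omega)\,d\pi(\omega)$ for all $x,x'\in X$, where $\psi$ is continuous and $|\psi(x,\omega)|\le\kappa$ almost surely, with $\kappa\in[1,\infty)$. Assume $|y|\le b$ almost surely, with $b>0$, and assume that a minimizer $f_{\mathcal H}\in\mathcal H$ of $\mathcal E$ over $\mathcal H$ exists. Then there are constants $c_0,c_1>0$ not depending on $n,\lambda,\delta$, and a quantity $n_0$ not depending on $n,\lambda,f_{\mathcal H},\rho$ (it may depend on $\delta$), such that the following holds for every $\delta\in(0,1]$. If $n\ge n_0$ and $\lambda_n=n^{-1/2}$, then a number of random features $$M_n=c_0\,\sqrt n\,\log\frac{108\,\kappa^2\sqrt n}{\delta}$$ (rounded up to an integer) is enough to guarantee, with probability at least $1-\delta$, that $$\mathcal E(\widehat f_{\lambda_n,M_n})-\mathcal E(f_{\mathcal H})\le\frac{c_1\log^2\frac{18}{\delta}}{\sqrt n}.$$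
   Context: $X$ is a separable metric space (e.g. $\mathbb R^D$) and $\rho$ is a Borel probability measure on $X\times\mathbb R$ with marginal $\rho_X$ on $X$. $(\Omega,\pi)$ is a topological space with a Borel probability measure, and $\psi:X\times\Omega\to\mathbb R$. The data $(x_1,y_1),\dots,(x_n,y_n)$ are i.i.d. from $\rho$; the random features parameters $\omega_1,\dots,\omega_M$ are i.i.d. from $\pi$, independent of the data. Probability is over data and features jointly. Expected risk: $\mathcal E(f)=\int (f(x)-y)^2\,d\rho(x,y)$. $\mathcal H$ is the reproducing kernel Hilbert space of $K$, and $f_{\mathcal H}$ is a solution of $\min_{f\in\mathcal H}\mathcal E(f)$. Estimator (ridge regression with random features): $\phi_M(x)=M^{-1/2}(\psi(x,\omega_1),\dots,\psi(x,\omega_M))\in\mathbb R^M$; $\widehat S_M$ is the $n\times M$ matrix with $\widehat S_M^\top=n^{-1/2}(\phi_M(x_1),\dots,\phi_M(x_n))$; $\widehat y=n^{-1/2}(y_1,\dots,y_n)$; for $\lambda>0$, $$\widehat f_{\lambda,M}(x)=\phi_M(x)^\top\widehat w_{\lambda,M},\qquad \widehat w_{\lambda,M}=(\widehat S_M^\top\widehat S_M+\lambda I)^{-1}\widehat S_M^\top\widehat y .$$ *)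

theory Defs
  imports "HOL-Probability.Probability" "Jordan_Normal_Form.Gauss_Jordan_Elimination"
begin

no_notation vec_index (infixl "$" 100)
no_notation scalar_prod (infix "\<bullet>" 70)

text \<open>
  Hilbert spaces whose elements are real functions on a set: a carrier \<open>H\<close> of functions with the
  pointwise operations and an inner product \<open>ip\<close>, which is constrained on \<open>H\<close> only.
\<close>

locale function_hilbert_space =
  fixes H :: "('x \<Rightarrow> real) set"
    and ip :: "('x \<Rightarrow> real) \<Rightarrow> ('x \<Rightarrow> real) \<Rightarrow> real"
  assumes zero_mem: "(\<lambda>_. 0) \<in> H"
    and add_mem: "f \<in> H \<Longrightarrow> g \<in> H \<Longrightarrow> (\<lambda>x. f x + g x) \<in> H"
    and scale_mem: "f \<in> H \<Longrightarrow> (\<lambda>x. a * f x) \<in> H"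
    and ip_commute: "f \<in> H \<Longrightarrow> g \<in> H \<Longrightarrow> ip f g = ip g f"
    and ip_add: "f \<in> H \<Longrightarrow> g \<in> H \<Longrightarrow> h \<in> H \<Longrightarrow> ip (\<lambda>x. f x + g x) h = ip f h + ip g h"
    and ip_scale: "f \<in> H \<Longrightarrow> g \<in> H \<Longrightarrow> ip (\<lambda>x. a * f x) g = a * ip f g"
    and ip_nonneg: "f \<in> H \<Longrightarrow> 0 \<le> ip f f"
    and ip_eq_zero: "f \<in> H \<Longrightarrow> ip f f = 0 \<Longrightarrow> f = (\<lambda>_. 0)"
    and complete:
      "(\<And>k. u k \<in> H) \<Longrightarrow>
       (\<And>e. 0 < e \<Longrightarrow> \<exists>N. \<forall>k\<ge>N. \<forall>l\<ge>N.
          sqrt (ip (\<lambda>x. u k x - u l x) (\<lambda>x. u k x - u l x)) < e) \<Longrightarrow>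
       \<exists>f\<in>H. (\<lambda>k. sqrt (ip (\<lambda>x. u k x - f x) (\<lambda>x. u k x - f x))) \<longlonglongrightarrow> 0"

text \<open>
  \<open>rkhs K H ip\<close>: the functions \<open>H\<close> with inner product \<open>ip\<close> form the reproducing kernel Hilbert
  space of \<open>K\<close>. By the Moore--Aronszajn theorem these conditions determine \<open>H\<close>, and \<open>ip\<close> on \<open>H\<close>.
\<close>

locale rkhs = function_hilbert_space H ip
  for K :: "'x \<Rightarrow> 'x \<Rightarrow> real"
    and H :: "('x \<Rightarrow> real) set"
    and ip :: "('x \<Rightarrow> real) \<Rightarrow> ('x \<Rightarrow> real) \<Rightarrow> real" +
  assumes kernel_mem: "K x \<in> H"
    and reproducing: "f \<in> H \<Longrightarrow> f x = ip f (K x)"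

text \<open>
  The Bochner integral is 0 for a non-integrable integrand. Here it is used for bounded outputs and
  for measurable functions that are bounded almost everywhere, where the integrand is integrable.
\<close>

definition expected_risk :: "('x \<times> real) measure \<Rightarrow> ('x \<Rightarrow> real) \<Rightarrow> real"
  where "expected_risk \<rho> f = (\<integral>(x, y). (f x - y)\<^sup>2 \<partial>\<rho>)"

text \<open>
  The feature parameters are \<open>\<omega> 0, \<dots>, \<omega> (M - 1)\<close> and the data are \<open>z 0, \<dots>, z (n - 1)\<close>, each \<open>z i\<close>
  being a pair of an input and an output. Dimensions depend on \<open>n\<close> and \<open>M\<close>, so vectors and
  matrices are those of \<open>Jordan_Normal_Form\<close>.
\<close>

definition feature_vec :: "('x \<Rightarrow> 'w \<Rightarrow> real) \<Rightarrow> nat \<Rightarrow> (nat \<Rightarrow> 'w) \<Rightarrow> 'x \<Rightarrow> real Matrix.vec"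
  where "feature_vec \<psi> M \<omega> x = Matrix.vec M (\<lambda>j. \<psi> x (\<omega> j) / sqrt (real M))"

definition S_hat ::
    "('x \<Rightarrow> 'w \<Rightarrow> real) \<Rightarrow> nat \<Rightarrow> nat \<Rightarrow> (nat \<Rightarrow> 'x \<times> real) \<Rightarrow> (nat \<Rightarrow> 'w) \<Rightarrow> real mat"
  where "S_hat \<psi> n M z \<omega> =
    Matrix.mat n M (\<lambda>(i, j). vec_index (feature_vec \<psi> M \<omega> (fst (z i))) j / sqrt (real n))"

definition y_hat :: "nat \<Rightarrow> (nat \<Rightarrow> 'x \<times> real) \<Rightarrow> real Matrix.vec"
  where "y_hat n z = Matrix.vec n (\<lambda>i. snd (z i) / sqrt (real n))"

text \<open>
  For \<open>l > 0\<close> the matrix inverted here is positive definite, so \<open>mat_inverse\<close> is not \<open>None\<close>.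
\<close>

definition w_hat ::
    "('x \<Rightarrow> 'w \<Rightarrow> real) \<Rightarrow> nat \<Rightarrow> nat \<Rightarrow> real \<Rightarrow> (nat \<Rightarrow> 'x \<times> real) \<Rightarrow> (nat \<Rightarrow> 'w) \<Rightarrow> real Matrix.vec"
  where "w_hat \<psi> n M l z \<omega> =
    (let S = S_hat \<psi> n M z \<omega>
     in the (mat_inverse (transpose_mat S * S + l \<cdot>\<^sub>m 1\<^sub>m M)) *\<^sub>v (transpose_mat S *\<^sub>v y_hat n z))"

definition f_hat ::
    "('x \<Rightarrow> 'w \<Rightarrow> real) \<Rightarrow> nat \<Rightarrow> nat \<Rightarrow> real \<Rightarrow> (nat \<Rightarrow> 'x \<times> real) \<Rightarrow> (nat \<Rightarrow> 'w) \<Rightarrow> 'x \<Rightarrow> real"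
  where "f_hat \<psi> n M l z \<omega> x = scalar_prod (feature_vec \<psi> M \<omega> x) (w_hat \<psi> n M l z \<omega>)"

definition sample_space ::
    "('x \<times> real) measure \<Rightarrow> 'w measure \<Rightarrow> nat \<Rightarrow> nat \<Rightarrow> ((nat \<Rightarrow> 'x \<times> real) \<times> (nat \<Rightarrow> 'w)) measure"
  where "sample_space \<rho> \<pi> n M = (\<Pi>\<^sub>M i\<in>{..<n}. \<rho>) \<Otimes>\<^sub>M (\<Pi>\<^sub>M j\<in>{..<M}. \<pi>)"

end

theory Submission
  imports Defs "Jordan_Normal_Form.Determinant"
begin

text \<open>
  Write \<open>l = n\<^bsup>-1/2\<^esup>\<close>. The Tikhonov regularization of \<open>f\<^sub>H\<close> in \<open>H\<close> has the form
  \<open>f = \<integral> g(\<omega>) \<psi>(\<sqdot>, \<omega>) d\<pi>\<close> with \<open>g = O(l\<^bsup>-1/2\<^esup>)\<close> pointwise, \<open>\<parallel>g\<parallel> \<le> \<parallel>f\<^sub>H\<parallel>\<close> in \<open>L\<^sup>2(\<pi>)\<close> and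
  \<open>\<parallel>f - f\<^sub>H\<parallel>\<^sup>2 \<le> l \<parallel>f\<^sub>H\<parallel>\<^sup>2\<close> in \<open>L\<^sup>2(\<rho>)\<close>. Hence the weights \<open>g(\<omega>\<^sub>j)/\<surd>M\<close> have bounded norm and approximate \<open>f\<^sub>H\<close> to squared
  accuracy \<open>O(l)\<close>, up to an event whose probability is \<open>O(1/(l M))\<close> by Chebyshev's inequality. Since
  \<open>l M\<close> grows like \<open>log n\<close>, this is below \<open>\<delta>\<close> once \<open>n\<close> exceeds a threshold depending on \<open>\<delta>\<close> only.

  For fixed features let \<open>v\<close> be the population ridge weights and \<open>w\<close> the empirical ones. Then
  \<open>(C' + l) (w - v) = \<xi>\<close>, where \<open>C'\<close> is the empirical covariance and \<open>\<xi>\<close> is a centred empirical mean of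
  bounded vectors. A dimension-free Hoeffding bound (Pinelis) gives \<open>\<parallel>\<xi>\<parallel> = O(n\<^bsup>-1/2\<^esup>)\<close>, so \<open>\<parallel>w - v\<parallel> = O(1)\<close>,
  and replacing \<open>C'\<close> by the population covariance in \<open>\<langle>w - v, C' (w - v)\<rangle> \<le> \<parallel>w - v\<parallel> \<parallel>\<xi>\<parallel>\<close> costs only
  \<open>\<parallel>C - C'\<parallel> \<parallel>w - v\<parallel>\<^sup>2 = O(n\<^bsup>-1/2\<^esup>)\<close> in Hilbert-Schmidt norm. Finally, \<open>f\<^sub>H(x) - y\<close> is orthogonal to almost
  every feature, so the excess risk of a combination of features is its squared distance to \<open>f\<^sub>H\<close>.
\<close>

section \<open>Sigma-algebras and the estimator as a measurable map\<close>

text \<open>The threshold for n may depend on neither \<rho> nor \<open>f\<^sub>H\<close>, whereas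
  Chebyshev's inequality produces second moments proportional to powers of R, the squared norm of
  \<open>f\<^sub>H\<close> plus one. Every deviation threshold for the features is therefore taken
  proportional to the same power of R, which cancels and leaves a failure probability of 2
  \<kappa>^2 / (l M). Adding one keeps the thresholds positive when \<open>f\<^sub>H\<close> is
  zero. The norm of \<open>f\<^sub>H\<close> survives only in c1.

  The pointwise bound on g serves the norm of the weights: concentration of the mean of
  g(\<omega>)^2 needs a fourth moment, and this is bounded by the supremum of g^2 times its mean.

  The features need not lie in H, so the first variation of the risk over H says nothing about them
  directly; this is why orthogonality has to be recovered by an integration over \<pi> and holds
  almost everywhere only.

  The features may fail with probability \<delta>/3 and the data with probability 4 exp (-p) =
  2\<delta>/9, where p = ln (18/\<delta>). Since p \<ge> 1, the powers p and p^(3/2) that occur are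
  absorbed into p^2.\<close>

lemma measurable_continuous_pair:
  fixes f :: "'a::second_countable_topology \<Rightarrow> 'b::topological_space \<Rightarrow> 'c::topological_space"
  assumes "continuous_on UNIV (\<lambda>(x, y). f x y)"
  shows "(\<lambda>(x, y). f x y) \<in> borel \<Otimes>\<^sub>M borel \<rightarrow>\<^sub>M borel"
proof (rule borel_measurableI)
  fix S :: "'c set" assume "open S"
  define U where "U = (\<lambda>(x, y). f x y) -` S"
  have U: "open U"
    using assms \<open>open S\<close> unfolding U_def by (simp add: open_vimage)
  obtain B :: "'a set set" where B: "countable B" "topological_basis B"
    using ex_countable_basis by blast
  \<comment> \<open>\<open>V b\<close> is the largest open set whose product with \<open>b\<close>
    stays inside \<open>U\<close>. A countable base of the first factor alone turns \<open>U\<close>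
    into a countable union of rectangles, so the space of feature parameters may be an arbitrary
    topological space.\<close>
  define V where "V b = \<Union>{W. open W \<and> b \<times> W \<subseteq> U}" for b
  have "U = (\<Union>b\<in>B. b \<times> V b)"
  proof (intro equalityI subsetI)
    fix p assume "p \<in> U"
    then obtain S1 S2 where S: "open S1" "open S2" "p \<in> S1 \<times> S2" "S1 \<times> S2 \<subseteq> U"
      using U by (elim open_prod_elim) auto
    obtain b where b: "b \<in> B" "fst p \<in> b" "b \<subseteq> S1"
      using topological_basisE[OF B(2) S(1)] S(3) by (metis mem_Times_iff)
    with S have "snd p \<in> V b" unfolding V_def by (auto simp: mem_Times_iff)
    with b show "p \<in> (\<Union>b\<in>B. b \<times> V b)" by (auto simp: mem_Times_iff)
  qed (auto simp: V_def)
  moreover have "(\<Union>b\<in>B. b \<times> V b) \<in> sets (borel \<Otimes>\<^sub>M borel)"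
  proof (intro sets.countable_UN'' B(1) pair_measureI)
    show "b \<in> sets borel" if "b \<in> B" for b
      using that B(2) by (simp add: topological_basis_open)
    show "V b \<in> sets borel" for b
      unfolding V_def by (intro borel_open open_Union) auto
  qed
  ultimately show "(\<lambda>(x, y). f x y) -` S \<inter> space (borel \<Otimes>\<^sub>M borel) \<in> sets (borel \<Otimes>\<^sub>M borel)"
    by (simp add: U_def space_pair_measure)
qed

section \<open>Determinants, adjugates and the regularized Gram matrix\<close>

lemma borel_measurable_det:
  fixes A :: "'a \<Rightarrow> real mat"
  assumes "\<And>p. A p \<in> carrier_mat n n"
    and "\<And>i j. i < n \<Longrightarrow> j < n \<Longrightarrow> (\<lambda>p. A p $$ (i, j)) \<in> borel_measurable N"
  shows "(\<lambda>p. Determinant.det (A p)) \<in> borel_measurable N"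
  unfolding det_def'[OF assms(1)]
  by (intro borel_measurable_sum borel_measurable_times borel_measurable_prod borel_measurable_const
       assms(2)) (auto simp: permutes_in_image)

lemma borel_measurable_adj_mat:
  fixes A :: "'a \<Rightarrow> real mat"
  assumes A: "\<And>p. A p \<in> carrier_mat n n"
    and meas: "\<And>i j. i < n \<Longrightarrow> j < n \<Longrightarrow> (\<lambda>p. A p $$ (i, j)) \<in> borel_measurable N"
    and "i < n" "j < n"
  shows "(\<lambda>p. adj_mat (A p) $$ (i, j)) \<in> borel_measurable N"
proof -
  have dim: "dim_row (A p) = n" "dim_col (A p) = n" for p
    using A[of p] by auto
  have del: "mat_delete (A p) j i \<in> carrier_mat (n - 1) (n - 1)" for p
    by (metis A mat_delete_carrier)
  have "(\<lambda>p. Determinant.det (mat_delete (A p) j i)) \<in> borel_measurable N"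
  proof (rule borel_measurable_det[OF del])
    fix r s assume "r < n - 1" "s < n - 1"
    then show "(\<lambda>p. mat_delete (A p) j i $$ (r, s)) \<in> borel_measurable N"
      unfolding mat_delete_def dim by (simp add: meas)
  qed
  then show ?thesis
    using assms(3,4) unfolding adj_mat_def dim cofactor_def by simp
qed

lemma det_nonzero_if_coercive:
  fixes A :: "real mat"
  assumes A: "A \<in> carrier_mat n n" and "0 < l"
    and co: "\<And>v. v \<in> carrier_vec n \<Longrightarrow> l * scalar_prod v v \<le> scalar_prod v (A *\<^sub>v v)"
  shows "Determinant.det A \<noteq> 0"
proof
  assume "Determinant.det A = 0"
  then obtain v where v: "v \<in> carrier_vec n" "v \<noteq> 0\<^sub>v n" "A *\<^sub>v v = 0\<^sub>v n"
    using det_0_iff_vec_prod_zero[OF A] by auto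
  with co[of v] \<open>0 < l\<close> have "scalar_prod v v \<le> 0"
    by (simp add: mult_le_0_iff)
  moreover have "0 < scalar_prod v v"
    using v(1,2) conjugate_square_greater_0_vec[of v n] by (simp add: conjugate_vec_def vec_eq_iff scalar_prod_def)
  ultimately show False by simp
qed

text \<open>The matrix inverted in \<open>w_hat\<close>, as a function of the design matrix alone,
  so that its entries and its definiteness can be studied apart from the sample.\<close>

definition gram :: "real \<Rightarrow> real mat \<Rightarrow> real mat"
  where "gram l S = transpose_mat S * S + l \<cdot>\<^sub>m 1\<^sub>m (dim_col S)"

lemma gram_carrier: "S \<in> carrier_mat n M \<Longrightarrow> gram l S \<in> carrier_mat M M"
  by (auto simp: gram_def)

lemma gram_index:
  assumes "S \<in> carrier_mat n M" "j < M" "k < M"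
  shows "gram l S $$ (j, k) = (\<Sum>i<n. S $$ (i, j) * S $$ (i, k)) + (if j = k then l else 0)"
  using assms by (auto simp: gram_def scalar_prod_def atLeast0LessThan)

lemma gram_mult_vec_index:
  assumes S: "S \<in> carrier_mat n M" and v: "v \<in> carrier_vec M" and "j < M"
  shows "vec_index (gram l S *\<^sub>v v) j =
    (\<Sum>k<M. (\<Sum>i<n. S $$ (i, j) * S $$ (i, k)) * vec_index v k) + l * vec_index v j"
proof -
  have "vec_index (gram l S *\<^sub>v v) j = (\<Sum>k<M. gram l S $$ (j, k) * vec_index v k)"
    using gram_carrier[OF S, of l] v \<open>j < M\<close> by (auto simp: scalar_prod_def atLeast0LessThan)
  also have "\<dots> = (\<Sum>k<M. (\<Sum>i<n. S $$ (i, j) * S $$ (i, k)) * vec_index v k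
      + (if j = k then l * vec_index v k else 0))"
    by (intro sum.cong refl) (simp add: gram_index[OF S] \<open>j < M\<close> algebra_simps)
  also have "\<dots> = (\<Sum>k<M. (\<Sum>i<n. S $$ (i, j) * S $$ (i, k)) * vec_index v k) + l * vec_index v j"
    using \<open>j < M\<close> by (simp add: sum.distrib)
  finally show ?thesis .
qed

lemma gram_coercive:
  assumes S: "S \<in> carrier_mat n M" and v: "v \<in> carrier_vec M"
  shows "l * scalar_prod v v \<le> scalar_prod v (gram l S *\<^sub>v v)"
proof -
  have "scalar_prod v (gram l S *\<^sub>v v) = (\<Sum>j<M. vec_index v j *
      ((\<Sum>k<M. (\<Sum>i<n. S $$ (i, j) * S $$ (i, k)) * vec_index v k) + l * vec_index v j))"
    using gram_carrier[OF S, of l]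
    by (subst scalar_prod_def, intro sum.cong) (auto simp: gram_mult_vec_index[OF S v] simp del: index_mult_mat_vec)
  also have "\<dots> = (\<Sum>j<M. \<Sum>k<M. \<Sum>i<n. (S $$ (i, j) * vec_index v j) * (S $$ (i, k) * vec_index v k))
      + l * (\<Sum>j<M. vec_index v j * vec_index v j)"
    by (simp add: distrib_left sum.distrib sum_distrib_left sum_distrib_right mult_ac)
  also have "(\<Sum>j<M. \<Sum>k<M. \<Sum>i<n. (S $$ (i, j) * vec_index v j) * (S $$ (i, k) * vec_index v k))
      = (\<Sum>i<n. (\<Sum>j<M. S $$ (i, j) * vec_index v j) * (\<Sum>k<M. S $$ (i, k) * vec_index v k))"
    unfolding sum_product
    by (rule trans[OF sum.cong[OF refl sum.swap] sum.swap])
  also have "(\<Sum>j<M. vec_index v j * vec_index v j) = scalar_prod v v"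
    using v by (auto simp: scalar_prod_def atLeast0LessThan)
  finally show ?thesis
    by (simp add: sum_nonneg)
qed

lemma det_gram_nonzero:
  assumes "S \<in> carrier_mat n M" and "0 < l"
  shows "Determinant.det (gram l S) \<noteq> 0"
  by (rule det_nonzero_if_coercive[OF gram_carrier assms(2) gram_coercive]) (use assms in auto)

section \<open>Normal equations and measurability of the ridge weights\<close>

lemma S_hat_carrier: "S_hat \<psi> n M z \<omega> \<in> carrier_mat n M"
  by (simp add: S_hat_def)

lemma S_hat_index:
  "i < n \<Longrightarrow> j < M \<Longrightarrow>
    S_hat \<psi> n M z \<omega> $$ (i, j) = \<psi> (fst (z i)) (\<omega> j) / sqrt (real M) / sqrt (real n)"
  by (simp add: S_hat_def feature_vec_def)

lemma transpose_mult_y_hat_index: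
  assumes "j < M"
  shows "vec_index (transpose_mat (S_hat \<psi> n M z \<omega>) *\<^sub>v y_hat n z) j =
    (\<Sum>i<n. \<psi> (fst (z i)) (\<omega> j) / sqrt (real M) * snd (z i)) / n"
proof -
  have "vec_index (transpose_mat (S_hat \<psi> n M z \<omega>) *\<^sub>v y_hat n z) j =
      (\<Sum>i<n. (\<psi> (fst (z i)) (\<omega> j) / sqrt (real M) / sqrt (real n)) * (snd (z i) / sqrt (real n)))"
    using assms S_hat_carrier[of \<psi> n M z \<omega>]
    by (auto simp: scalar_prod_def atLeast0LessThan y_hat_def S_hat_index intro!: sum.cong)
  also have "\<dots> = (\<Sum>i<n. \<psi> (fst (z i)) (\<omega> j) / sqrt (real M) * snd (z i)) / n"
    by (simp add: sum_divide_distrib mult.assoc)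
  finally show ?thesis .
qed

text \<open>Replaces \<open>the (mat_inverse _)\<close> by a genuine two-sided inverse. The right
  inverse yields the normal equations, the left inverse the adjugate formula behind
  measurability.\<close>

lemma w_hat_inverse:
  assumes "0 < l"
  obtains B where "B \<in> carrier_mat M M" "gram l (S_hat \<psi> n M z \<omega>) * B = 1\<^sub>m M"
    "B * gram l (S_hat \<psi> n M z \<omega>) = 1\<^sub>m M"
    "w_hat \<psi> n M l z \<omega> = B *\<^sub>v (transpose_mat (S_hat \<psi> n M z \<omega>) *\<^sub>v y_hat n z)"
proof -
  let ?G = "gram l (S_hat \<psi> n M z \<omega>)"
  have G: "?G \<in> carrier_mat M M" by (rule gram_carrier[OF S_hat_carrier])
  have "?G \<in> Units (ring_mat TYPE(real) M ())"
    by (rule det_non_zero_imp_unit[OF G det_gram_nonzero[OF S_hat_carrier assms]])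
  then obtain B where B: "mat_inverse ?G = Some B"
    using mat_inverse(1)[OF G, of "()"] by (cases "mat_inverse ?G") auto
  show thesis
  proof (rule that)
    show "B \<in> carrier_mat M M" "?G * B = 1\<^sub>m M" "B * ?G = 1\<^sub>m M"
      using mat_inverse(2)[OF G B] by auto
    have "dim_col (S_hat \<psi> n M z \<omega>) = M" by (simp add: S_hat_def)
    then show "w_hat \<psi> n M l z \<omega> = B *\<^sub>v (transpose_mat (S_hat \<psi> n M z \<omega>) *\<^sub>v y_hat n z)"
      using B by (simp add: w_hat_def gram_def)
  qed
qed

lemma w_hat_carrier: "0 < l \<Longrightarrow> w_hat \<psi> n M l z \<omega> \<in> carrier_vec M"
  by (rule w_hat_inverse[of l M \<psi> n z \<omega>]) (auto intro!: mult_mat_vec_carrier simp: S_hat_def y_hat_def)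

text \<open>The factors 1 / sqrt n hidden in \<open>S_hat\<close> and \<open>y_hat\<close> multiply
  to 1 / n, so the equations involve empirical means only and can be compared term by term with
  their population counterparts.\<close>

lemma w_hat_normal_equations:
  fixes z :: "nat \<Rightarrow> 'x \<times> real" and \<psi> :: "'x \<Rightarrow> 'w \<Rightarrow> real" and \<omega> :: "nat \<Rightarrow> 'w" and n M :: nat
  assumes "0 < l" and "j < M"
  defines "\<phi> \<equiv> \<lambda>i j. \<psi> (fst (z i)) (\<omega> j) / sqrt (real M)"
    and "w \<equiv> vec_index (w_hat \<psi> n M l z \<omega>)"
  shows "(\<Sum>k<M. (\<Sum>i<n. \<phi> i j * \<phi> i k) / n * w k) + l * w j = (\<Sum>i<n. \<phi> i j * snd (z i)) / n"
proof -
  let ?S = "S_hat \<psi> n M z \<omega>" and ?c = "transpose_mat (S_hat \<psi> n M z \<omega>) *\<^sub>v y_hat n z"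
  obtain B where B: "B \<in> carrier_mat M M" "gram l ?S * B = 1\<^sub>m M" "w_hat \<psi> n M l z \<omega> = B *\<^sub>v ?c"
    using w_hat_inverse[OF \<open>0 < l\<close>] by metis
  have c: "?c \<in> carrier_vec M"
    by (auto intro!: mult_mat_vec_carrier simp: S_hat_def y_hat_def)
  have "gram l ?S *\<^sub>v w_hat \<psi> n M l z \<omega> = (gram l ?S * B) *\<^sub>v ?c"
    unfolding B(3) using assoc_mult_mat_vec[OF gram_carrier[OF S_hat_carrier] B(1) c, symmetric] .
  also have "\<dots> = ?c" using B(2) c by simp
  finally have "vec_index (gram l ?S *\<^sub>v w_hat \<psi> n M l z \<omega>) j = vec_index ?c j" by simp
  moreover have "(\<Sum>i<n. ?S $$ (i, j) * ?S $$ (i, k)) = (\<Sum>i<n. \<phi> i j * \<phi> i k) / n" if "k < M" for k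
  proof -
    have "a / sqrt (real n) * (b / sqrt (real n)) = a * b / n" for a b :: real
      by (simp add: mult_ac)
    then show ?thesis
      using that \<open>j < M\<close> unfolding \<phi>_def sum_divide_distrib
      by (intro sum.cong refl) (simp only: S_hat_index lessThan_iff)
  qed
  then have "vec_index (gram l ?S *\<^sub>v w_hat \<psi> n M l z \<omega>) j =
      (\<Sum>k<M. (\<Sum>i<n. \<phi> i j * \<phi> i k) / n * w k) + l * w j"
    unfolding gram_mult_vec_index[OF S_hat_carrier w_hat_carrier[OF \<open>0 < l\<close>] \<open>j < M\<close>] w_def
    by (intro arg_cong2[of _ _ _ _ "(+)"] sum.cong refl) (simp only: lessThan_iff)
  ultimately show ?thesis
    unfolding transpose_mult_y_hat_index[OF \<open>j < M\<close>] \<phi>_def by simp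
qed

lemma f_hat_eq_sum:
  assumes "0 < l"
  shows "f_hat \<psi> n M l z \<omega> x =
    (\<Sum>j<M. \<psi> x (\<omega> j) / sqrt (real M) * vec_index (w_hat \<psi> n M l z \<omega>) j)"
  using w_hat_carrier[OF assms, of \<psi> n M z \<omega>]
  by (auto simp: f_hat_def scalar_prod_def feature_vec_def atLeast0LessThan intro!: sum.cong)

text \<open>Elimination branches on its pivots, so measurability is not read off the algorithm.
  Cramer's rule writes each weight as a quotient of polynomials in the entries, with the determinant
  nowhere zero.\<close>

lemma borel_measurable_w_hat:
  fixes zs :: "'p \<Rightarrow> nat \<Rightarrow> 'x \<times> real" and ws :: "'p \<Rightarrow> nat \<Rightarrow> 'w"
  assumes "0 < l"
    and psi: "\<And>i j. i < n \<Longrightarrow> j < M \<Longrightarrow> (\<lambda>p. \<psi> (fst (zs p i)) (ws p j)) \<in> borel_measurable N"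
    and y: "\<And>i. i < n \<Longrightarrow> (\<lambda>p. snd (zs p i)) \<in> borel_measurable N"
    and "j < M"
  shows "(\<lambda>p. vec_index (w_hat \<psi> n M l (zs p) (ws p)) j) \<in> borel_measurable N"
proof -
  define S where "S p = S_hat \<psi> n M (zs p) (ws p)" for p
  define G where "G p = gram l (S p)" for p
  define c where "c p = transpose_mat (S p) *\<^sub>v y_hat n (zs p)" for p
  have S: "S p \<in> carrier_mat n M" for p unfolding S_def by (rule S_hat_carrier)
  have G: "G p \<in> carrier_mat M M" for p unfolding G_def by (rule gram_carrier[OF S])
  have Gm: "(\<lambda>p. G p $$ (i, k)) \<in> borel_measurable N" if "i < M" "k < M" for i k
    unfolding G_def gram_index[OF S that] using that psi
    by (auto intro!: borel_measurable_add borel_measurable_sum borel_measurable_times simp: S_def S_hat_index)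
  have cm: "(\<lambda>p. vec_index (c p) k) \<in> borel_measurable N" if "k < M" for k
    unfolding c_def S_def transpose_mult_y_hat_index[OF that] using that psi y
    by (intro borel_measurable_divide borel_measurable_sum borel_measurable_times) auto
  have eq: "vec_index (w_hat \<psi> n M l (zs p) (ws p)) j =
      (\<Sum>k<M. adj_mat (G p) $$ (j, k) * vec_index (c p) k) / Determinant.det (G p)" for p
  proof -
    let ?d = "Determinant.det (G p)"
    obtain B where B: "B \<in> carrier_mat M M" "B * G p = 1\<^sub>m M" "w_hat \<psi> n M l (zs p) (ws p) = B *\<^sub>v c p"
      using w_hat_inverse[OF \<open>0 < l\<close>] unfolding G_def S_def c_def by metis
    have cc: "c p \<in> carrier_vec M"
      using S[of p] unfolding c_def by (auto intro!: mult_mat_vec_carrier simp: y_hat_def)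
    have adj: "adj_mat (G p) \<in> carrier_mat M M" "G p * adj_mat (G p) = ?d \<cdot>\<^sub>m 1\<^sub>m M"
      using adj_mat[OF G] by auto
    have "adj_mat (G p) = (B * G p) * adj_mat (G p)" using B(2) adj(1) by simp
    also have "\<dots> = B * (?d \<cdot>\<^sub>m 1\<^sub>m M)" using assoc_mult_mat[OF B(1) G adj(1)] adj(2) by simp
    also have "\<dots> = ?d \<cdot>\<^sub>m B" using B(1) mult_smult_distrib[OF B(1) one_carrier_mat, of ?d] by simp
    finally have adjB: "adj_mat (G p) = ?d \<cdot>\<^sub>m B" .
    have "?d \<noteq> 0" unfolding G_def by (rule det_gram_nonzero[OF S \<open>0 < l\<close>])
    then show ?thesis
      using B(1) cc \<open>j < M\<close> unfolding B(3) adjB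
      by (auto simp: scalar_prod_def atLeast0LessThan sum_divide_distrib intro!: sum.cong)
  qed
  show ?thesis
    unfolding eq using \<open>j < M\<close>
    by (intro borel_measurable_divide borel_measurable_sum borel_measurable_times
        borel_measurable_adj_mat[OF G Gm] borel_measurable_det[OF G Gm] cm) auto
qed

section \<open>Concentration of sums of independent bounded vectors\<close>

text \<open>A supermartingale argument with potential \<Phi>, where \<open>k\<close> counts the
  coordinates already integrated out. It is used with a quadratic potential for variances and with a
  hyperbolic cosine for exponential tails. Nonnegative integrals spare any integrability condition
  on the potential.\<close>

lemma nn_integral_PiM_sum_le:
  fixes X :: "'j \<Rightarrow> 'z \<Rightarrow> real" and \<Phi> :: "nat \<Rightarrow> ('j \<Rightarrow> real) \<Rightarrow> ennreal"
  assumes "prob_space \<rho>"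
    and X: "\<And>j. j \<in> J \<Longrightarrow> X j \<in> borel_measurable \<rho>"
    and \<Phi>: "\<And>k N V. (\<And>j. j \<in> J \<Longrightarrow> V j \<in> borel_measurable N) \<Longrightarrow>
        (\<lambda>p :: nat \<Rightarrow> 'z. \<Phi> k (\<lambda>j. V j p)) \<in> borel_measurable N"
    and step: "\<And>k x. (\<integral>\<^sup>+z. \<Phi> k (\<lambda>j. x j + X j z) \<partial>\<rho>) \<le> \<Phi> (Suc k) x"
  shows "(\<integral>\<^sup>+z. \<Phi> k (\<lambda>j. x j + (\<Sum>i<n. X j (z i))) \<partial>PiM {..<n} (\<lambda>_. \<rho>)) \<le> \<Phi> (k + n) x"
proof (induction n arbitrary: k)
  case 0
  then show ?case using prob_space.emeasure_space_1[OF prob_space_PiM[of "{..<0::nat}" "\<lambda>_. \<rho>"]] assms(1) by simp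
next
  case (Suc n)
  interpret prob_space \<rho> by fact
  interpret P: product_sigma_finite "\<lambda>_::nat. \<rho>"
    by (simp add: product_sigma_finite_def prob_space_imp_sigma_finite assms(1))
  have meas: "(\<lambda>z. \<Phi> k (\<lambda>j. x j + (\<Sum>i<Suc n. X j (z i)))) \<in> borel_measurable (PiM {..<Suc n} (\<lambda>_. \<rho>))"
  proof (rule \<Phi>)
    fix j assume "j \<in> J"
    note [measurable] = X[OF this]
    show "(\<lambda>z. x j + (\<Sum>i<Suc n. X j (z i))) \<in> borel_measurable (PiM {..<Suc n} (\<lambda>_. \<rho>))"
      by measurable
  qed
  have "(\<integral>\<^sup>+z. \<Phi> k (\<lambda>j. x j + (\<Sum>i<Suc n. X j (z i))) \<partial>PiM {..<Suc n} (\<lambda>_. \<rho>))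
      = (\<integral>\<^sup>+z. \<integral>\<^sup>+y. \<Phi> k (\<lambda>j. x j + (\<Sum>i<Suc n. X j ((z(n := y)) i))) \<partial>\<rho> \<partial>PiM {..<n} (\<lambda>_. \<rho>))"
    using meas unfolding lessThan_Suc by (subst P.product_nn_integral_insert) auto
  \<comment> \<open>The newest coordinate is integrated first; the sum of the others becomes part of
    the starting point, which is why \<open>step\<close> is assumed for every
    \<open>x\<close>.\<close>
  also have "\<dots> = (\<integral>\<^sup>+z. \<integral>\<^sup>+y. \<Phi> k (\<lambda>j. (x j + (\<Sum>i<n. X j (z i))) + X j y) \<partial>\<rho> \<partial>PiM {..<n} (\<lambda>_. \<rho>))"
    by (simp add: add.assoc)
  also have "\<dots> \<le> (\<integral>\<^sup>+z. \<Phi> (Suc k) (\<lambda>j. x j + (\<Sum>i<n. X j (z i))) \<partial>PiM {..<n} (\<lambda>_. \<rho>))"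
    by (intro nn_integral_mono step)
  also have "\<dots> \<le> \<Phi> (Suc k + n) x" by (rule Suc.IH)
  finally show ?case by simp
qed

text \<open>Independent centred terms add their variances, and a variance is at most the second
  moment. In the proof, averaging one term changes \<open>x^2\<close> into \<open>x^2 - m^2\<close>
  plus the second moment of \<open>u\<close>.\<close>

lemma nn_integral_PiM_square_sum_le:
  fixes u :: "'z \<Rightarrow> real" and n :: nat
  assumes "prob_space \<rho>" and u: "integrable \<rho> u" and u2: "integrable \<rho> (\<lambda>z. (u z)\<^sup>2)"
    and m: "(\<integral>z. u z \<partial>\<rho>) = m"
  shows "(\<integral>\<^sup>+z. ennreal ((\<Sum>i<n. u (z i) - m)\<^sup>2) \<partial>PiM {..<n} (\<lambda>_. \<rho>))
    \<le> ennreal (n * (\<integral>z. (u z)\<^sup>2 \<partial>\<rho>))"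
proof -
  interpret prob_space \<rho> by fact
  define \<sigma> where "\<sigma> = (\<integral>z. (u z)\<^sup>2 \<partial>\<rho>)"
  have \<sigma>: "0 \<le> \<sigma>" unfolding \<sigma>_def by simp
  \<comment> \<open>A one-point index set specializes the vector-valued induction to
    scalars.\<close>
  define \<Phi> :: "nat \<Rightarrow> (unit \<Rightarrow> real) \<Rightarrow> ennreal" where "\<Phi> k x = ennreal ((x ())\<^sup>2 + k * \<sigma>)" for k x
  have "(\<integral>\<^sup>+z. \<Phi> 0 (\<lambda>j. 0 + (\<Sum>i<n. (\<lambda>j z. u z - m) j (z i))) \<partial>PiM {..<n} (\<lambda>_. \<rho>)) \<le> \<Phi> (0 + n) (\<lambda>_. 0 :: real)"
  proof (rule nn_integral_PiM_sum_le[where J = UNIV, OF assms(1)])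
    fix k x
    have "(\<integral>\<^sup>+z. \<Phi> k (\<lambda>j. x j + (u z - m)) \<partial>\<rho>)
        = ennreal (\<integral>z. (x () + (u z - m))\<^sup>2 + k * \<sigma> \<partial>\<rho>)"
      unfolding \<Phi>_def
    proof (intro nn_integral_eq_integral)
      have "(\<lambda>z. (x () + (u z - m))\<^sup>2) = (\<lambda>z. (x () - m)\<^sup>2 + (2 * (x () - m) * u z + (u z)\<^sup>2))"
        by (simp add: fun_eq_iff power2_eq_square algebra_simps)
      then show "integrable \<rho> (\<lambda>z. (x () + (u z - m))\<^sup>2 + k * \<sigma>)" using u u2 by simp
    qed (use \<sigma> in auto)
    also have "(\<integral>z. (x () + (u z - m))\<^sup>2 + k * \<sigma> \<partial>\<rho>)
        = (\<integral>z. ((x () - m)\<^sup>2 + k * \<sigma>) + (2 * (x () - m) * u z + (u z)\<^sup>2) \<partial>\<rho>)"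
      by (intro Bochner_Integration.integral_cong) (auto simp: power2_eq_square algebra_simps)
    also have "\<dots> = ((x () - m)\<^sup>2 + k * \<sigma>) + (2 * (x () - m) * m + \<sigma>)"
      using u u2 m by (simp add: \<sigma>_def prob_space)
    also have "\<dots> \<le> (x ())\<^sup>2 + Suc k * \<sigma>"
      by (simp add: power2_eq_square algebra_simps)
    finally show "(\<integral>\<^sup>+z. \<Phi> k (\<lambda>j. x j + (u z - m)) \<partial>\<rho>) \<le> \<Phi> (Suc k) x"
      unfolding \<Phi>_def by (simp add: ennreal_leI)
  qed (use u in \<open>auto simp: \<Phi>_def intro!: measurable_compose[OF _ measurable_ennreal] borel_measurable_add borel_measurable_power\<close>)
  then show ?thesis by (simp add: \<Phi>_def \<sigma>_def)
qed

section \<open>Hyperbolic cosine inequalities and the tail of a vector sum\<close>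

lemma sinh_le_times_cosh:
  fixes x :: real
  assumes "0 \<le> x"
  shows "sinh x \<le> x * cosh x"
proof -
  have "(\<lambda>x. x * cosh x - sinh x) 0 \<le> (\<lambda>x. x * cosh x - sinh x) x"
  proof (rule DERIV_nonneg_imp_nondecreasing[OF assms])
    fix t :: real assume "0 \<le> t"
    then show "\<exists>y. ((\<lambda>x. x * cosh x - sinh x) has_real_derivative y) (at t) \<and> 0 \<le> y"
      by (intro exI[of _ "t * sinh t"]) (auto intro!: derivative_eq_intros)
  qed
  then show ?thesis by simp
qed

lemma cosh_le_exp_square_half:
  fixes x :: real
  assumes "0 \<le> x"
  shows "cosh x \<le> exp (x\<^sup>2 / 2)"
proof -
  have "(\<lambda>x. exp (- x\<^sup>2 / 2) * cosh x) x \<le> (\<lambda>x. exp (- x\<^sup>2 / 2) * cosh x) 0"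
  proof (rule DERIV_nonpos_imp_nonincreasing[OF assms])
    fix t :: real assume "0 \<le> t"
    then show "\<exists>y. ((\<lambda>x. exp (- x\<^sup>2 / 2) * cosh x) has_real_derivative y) (at t) \<and> y \<le> 0"
      using sinh_le_times_cosh[of t]
      by (intro exI[of _ "exp (- t\<^sup>2 / 2) * (sinh t - t * cosh t)"] conjI)
        (auto intro!: derivative_eq_intros simp: algebra_simps mult_le_0_iff)
  qed
  then show ?thesis by (simp add: exp_minus field_simps)
qed

text \<open>Substituting sqrt s into the even power series of cosh leaves the sum of s^k / (2k)!,
  whose terms are all convex for s \<ge> 0.\<close>

lemma convex_on_cosh_sqrt: "convex_on {0..} (\<lambda>s. cosh (sqrt s))"
proof (rule convex_onI)
  fix t x y :: real
  assume t: "0 < t" "t < 1" and xy: "x \<in> {0..}" "y \<in> {0..}"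
  define a where "a s n = (if even n then sqrt s ^ n /\<^sub>R fact n else 0)" for s :: real and n :: nat
  have a: "a s sums cosh (sqrt s)" for s
    unfolding a_def by (rule cosh_converges)
  have "cosh (sqrt ((1 - t) *\<^sub>R x + t *\<^sub>R y)) \<le> (1 - t) * cosh (sqrt x) + t * cosh (sqrt y)"
  proof (rule sums_le[OF _ a sums_add[OF sums_mult[OF a] sums_mult[OF a]]])
    fix n
    show "a ((1 - t) *\<^sub>R x + t *\<^sub>R y) n \<le> (1 - t) * a x n + t * a y n"
    proof (cases "even n")
      case True
      then obtain k where k: "n = 2 * k" by blast
      have p: "sqrt s ^ n = s ^ k" if "0 \<le> s" for s
        using that by (simp add: k power_mult)
      have nn: "0 \<le> (1 - t) *\<^sub>R x + t *\<^sub>R y" using t xy by simp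
      have "convex_on {0..} (\<lambda>x::real. x ^ k)"
        by (cases "even k") (auto intro: convex_power_odd convex_on_subset[OF convex_power_even])
      then have "((1 - t) *\<^sub>R x + t *\<^sub>R y) ^ k \<le> (1 - t) * x ^ k + t * y ^ k"
        using convex_onD[of "{0..}" "\<lambda>x::real. x ^ k" t x y] t xy by simp
      then have "((1 - t) *\<^sub>R x + t *\<^sub>R y) ^ k / fact n \<le> ((1 - t) * x ^ k + t * y ^ k) / fact n"
        by (intro divide_right_mono) auto
      then show ?thesis
        using True xy by (simp only: a_def p nn if_True atLeast_iff)
          (simp add: divide_inverse algebra_simps)
    qed (simp add: a_def)
  qed
  then show "cosh (sqrt ((1 - t) *\<^sub>R x + t *\<^sub>R y)) \<le> (1 - t) * cosh (sqrt x) + t * cosh (sqrt y)" .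
qed simp

text \<open>The argument of the root is the convex combination of (r - L)^2 and (r + L)^2 with
  weights (1 - \<theta>) / 2 and (1 + \<theta>) / 2. Convexity and the addition formulas make the
  bound affine in \<theta>, the cosine of the angle.\<close>

lemma cosh_sqrt_law_of_cosines:
  fixes r L \<theta> :: real
  assumes "0 \<le> r" "0 \<le> L" "\<bar>\<theta>\<bar> \<le> 1"
  shows "cosh (sqrt (r\<^sup>2 + L\<^sup>2 + 2 * r * L * \<theta>)) \<le> cosh r * cosh L + \<theta> * (sinh r * sinh L)"
proof -
  define t where "t = (1 + \<theta>) / 2"
  have t: "t \<in> {0..1}" using assms by (auto simp: t_def)
  have "r\<^sup>2 + L\<^sup>2 + 2 * r * L * \<theta> = (1 - t) *\<^sub>R (r - L)\<^sup>2 + t *\<^sub>R (r + L)\<^sup>2"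
    by (simp add: t_def power2_eq_square field_simps)
  then have "cosh (sqrt (r\<^sup>2 + L\<^sup>2 + 2 * r * L * \<theta>))
      \<le> (1 - t) * cosh (sqrt ((r - L)\<^sup>2)) + t * cosh (sqrt ((r + L)\<^sup>2))"
    using convex_onD[OF convex_on_cosh_sqrt, of t "(r - L)\<^sup>2" "(r + L)\<^sup>2"] t by simp
  also have "\<dots> = (1 - t) * cosh (r - L) + t * cosh (r + L)"
    by (simp add: cosh_real_abs)
  also have "\<dots> = cosh r * cosh L + \<theta> * (sinh r * sinh L)"
    by (simp add: t_def cosh_add cosh_diff field_simps)
  finally show ?thesis .
qed

text \<open>By convexity of \<open>cosh \<circ> sqrt\<close> the bound is affine in the inner product of \<open>x\<close> and \<open>h\<close>, so that
  term disappears when \<open>h\<close> is random and centred.\<close>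

lemma cosh_L2_set_add_le:
  assumes "0 < L" and h: "L2_set h J \<le> L"
  shows "cosh (L2_set (\<lambda>j. x j + h j) J) \<le> cosh (L2_set x J) * cosh L
    + (\<Sum>j\<in>J. x j * h j) * (sinh (L2_set x J) * sinh L / (L2_set x J * L))"
proof -
  define r where "r = L2_set x J"
  define c where "c = (\<Sum>j\<in>J. x j * h j)"
  have r: "0 \<le> r" "r\<^sup>2 = (\<Sum>j\<in>J. (x j)\<^sup>2)"
    unfolding r_def L2_set_def by (simp_all add: sum_nonneg)
  have hL: "(\<Sum>j\<in>J. (h j)\<^sup>2) \<le> L\<^sup>2"
    using power_mono[OF h L2_set_nonneg, of 2] by (simp add: L2_set_def sum_nonneg)
  have "\<bar>c\<bar> \<le> (\<Sum>j\<in>J. \<bar>x j\<bar> * \<bar>h j\<bar>)" unfolding c_def by (rule order.trans[OF sum_abs]) (simp add: abs_mult)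
  also have "\<dots> \<le> L2_set x J * L2_set h J" by (rule L2_set_mult_ineq)
  also have "\<dots> \<le> r * L" unfolding r_def using h by (intro mult_left_mono) auto
  finally have c: "\<bar>c\<bar> \<le> r * L" .
  have "(\<Sum>j\<in>J. (x j + h j)\<^sup>2) \<le> r\<^sup>2 + L\<^sup>2 + 2 * c"
    using hL unfolding r(2) c_def by (simp add: power2_sum sum.distrib sum_distrib_left mult.assoc)
  moreover have "0 \<le> (\<Sum>j\<in>J. (x j + h j)\<^sup>2)" by (simp add: sum_nonneg)
  ultimately have "cosh (L2_set (\<lambda>j. x j + h j) J) \<le> cosh (sqrt (r\<^sup>2 + L\<^sup>2 + 2 * c))"
    unfolding L2_set_def by (subst cosh_real_nonneg_le_iff) auto
  also have "\<dots> \<le> cosh r * cosh L + c * (sinh r * sinh L / (r * L))"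
  proof (cases "r = 0")
    \<comment> \<open>The quotient is 0 here by the convention for division by zero, and
      \<open>c\<close> vanishes because its absolute value is at most \<open>r * L\<close>.\<close>
    case True
    with c \<open>0 < L\<close> show ?thesis by simp
  next
    case False
    \<comment> \<open>Not the exact cosine: the length of \<open>h\<close> is replaced by its bound
      \<open>L\<close>, which only decreases the absolute value of \<theta>.\<close>
    define \<theta> where "\<theta> = c / (r * L)"
    have rL: "0 < r * L" using False r(1) \<open>0 < L\<close> by simp
    have "\<bar>\<theta>\<bar> \<le> 1" unfolding \<theta>_def using c rL by (simp add: abs_divide)
    moreover have c_eq: "c = r * L * \<theta>" using rL by (auto simp: \<theta>_def)
    ultimately show ?thesis
      using cosh_sqrt_law_of_cosines[of r L \<theta>] r(1) rL \<open>0 < L\<close>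
      by (simp only: c_eq) (auto simp: mult_ac)
  qed
  finally show ?thesis by (simp add: r_def c_def)
qed

lemma nn_integral_cosh_L2_set_add_le:
  fixes X :: "'j \<Rightarrow> 'z \<Rightarrow> real"
  assumes "prob_space \<rho>" and "finite J" and "0 < L"
    and X: "\<And>j. j \<in> J \<Longrightarrow> X j \<in> borel_measurable \<rho>"
    and bd: "AE z in \<rho>. L2_set (\<lambda>j. X j z) J \<le> L"
    and mean: "\<And>j. j \<in> J \<Longrightarrow> (\<integral>z. X j z \<partial>\<rho>) = 0"
  shows "(\<integral>\<^sup>+z. ennreal (cosh (L2_set (\<lambda>j. x j + X j z) J)) \<partial>\<rho>) \<le> ennreal (cosh L * cosh (L2_set x J))"
proof -
  interpret prob_space \<rho> by fact
  have int: "integrable \<rho> (X j)" if "j \<in> J" for j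
  proof (rule integrable_const_bound[OF _ X[OF that]])
    show "AE z in \<rho>. norm (X j z) \<le> L"
      using bd
    proof eventually_elim
      case (elim z)
      then show ?case using member_le_L2_set[OF \<open>finite J\<close> that, of "\<lambda>j. \<bar>X j z\<bar>"]
        by (simp add: L2_set_def)
    qed
  qed
  define K where "K = sinh (L2_set x J) * sinh L / (L2_set x J * L)"
  define U where "U z = cosh (L2_set x J) * cosh L + (\<Sum>j\<in>J. x j * X j z) * K" for z
  have U: "integrable \<rho> U" unfolding U_def using int by auto
  have le: "AE z in \<rho>. cosh (L2_set (\<lambda>j. x j + X j z) J) \<le> U z"
    using bd by eventually_elim (unfold U_def K_def, rule cosh_L2_set_add_le[OF \<open>0 < L\<close>])
  have "(\<integral>\<^sup>+z. ennreal (cosh (L2_set (\<lambda>j. x j + X j z) J)) \<partial>\<rho>) \<le> (\<integral>\<^sup>+z. ennreal (U z) \<partial>\<rho>)"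
    using le by (intro nn_integral_mono_AE) (auto simp: ennreal_leI)
  also have "\<dots> = ennreal (\<integral>z. U z \<partial>\<rho>)"
  proof (rule nn_integral_eq_integral[OF U])
    show "AE z in \<rho>. 0 \<le> U z"
      using le by eventually_elim (meson cosh_real_nonneg order.trans)
  qed
  also have "(\<integral>z. U z \<partial>\<rho>) = cosh L * cosh (L2_set x J)"
    unfolding U_def using int mean by (simp add: prob_space mult.commute)
  finally show ?thesis .
qed

lemma borel_measurable_L2_set:
  fixes f :: "'j \<Rightarrow> 'z \<Rightarrow> real"
  assumes [measurable]: "\<And>j. j \<in> J \<Longrightarrow> f j \<in> borel_measurable N"
  shows "(\<lambda>z. L2_set (\<lambda>j. f j z) J) \<in> borel_measurable N"
  unfolding L2_set_def by measurable

text \<open>The exponential moment method applied to cosh of the norm. Each independent term costs a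
  factor cosh (t L), whatever the size of \<open>J\<close>; this permits M coordinates for the noise
  and M^2 for the covariance without loss.\<close>

lemma emeasure_PiM_L2_set_sum_ge:
  fixes X :: "'j \<Rightarrow> 'z \<Rightarrow> real" and n :: nat and L u :: real
  assumes "prob_space \<rho>" and "finite J" and "0 < L" and "0 < n" and "0 < u"
    and X: "\<And>j. j \<in> J \<Longrightarrow> X j \<in> borel_measurable \<rho>"
    and bd: "AE z in \<rho>. L2_set (\<lambda>j. X j z) J \<le> L"
    and mean: "\<And>j. j \<in> J \<Longrightarrow> (\<integral>z. X j z \<partial>\<rho>) = 0"
  defines "P \<equiv> PiM {..<n} (\<lambda>_. \<rho>)"
  shows "emeasure P {z \<in> space P. u \<le> L2_set (\<lambda>j. \<Sum>i<n. X j (z i)) J}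
    \<le> ennreal (2 * exp (- u\<^sup>2 / (2 * n * L\<^sup>2)))"
proof -
  \<comment> \<open>The minimizer of the exponent \<open>- t * u + n * (t * L)^2 / 2\<close> over
    \<open>t\<close>.\<close>
  define t where "t = u / (n * L\<^sup>2)"
  have t: "0 < t" unfolding t_def using assms by simp
  define S where "S z = L2_set (\<lambda>j. \<Sum>i<n. X j (z i)) J" for z
  define \<Phi> where "\<Phi> k x = ennreal (cosh (t * L) ^ k * cosh (L2_set x J))" for k and x :: "'j \<Rightarrow> real"
  have L2t: "L2_set (\<lambda>j. t * f j) J = t * L2_set f J" for f
    using t by (simp add: L2_set_right_distrib)
  have mS: "S \<in> borel_measurable P"
  proof -
    have "(\<lambda>z. \<Sum>i<n. X j (z i)) \<in> borel_measurable P" if "j \<in> J" for j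
    proof -
      note [measurable] = X[OF that]
      show ?thesis unfolding P_def by measurable
    qed
    then show ?thesis unfolding S_def by (rule borel_measurable_L2_set)
  qed
  have "(\<integral>\<^sup>+z. \<Phi> 0 (\<lambda>j. 0 + (\<Sum>i<n. (\<lambda>j z. t * X j z) j (z i))) \<partial>P) \<le> \<Phi> (0 + n) (\<lambda>_. 0)"
    unfolding P_def
  proof (rule nn_integral_PiM_sum_le[where J = J, OF assms(1)])
    fix k x
    have "(\<integral>\<^sup>+z. \<Phi> k (\<lambda>j. x j + t * X j z) \<partial>\<rho>)
        = ennreal (cosh (t * L) ^ k) * (\<integral>\<^sup>+z. ennreal (cosh (L2_set (\<lambda>j. x j + t * X j z) J)) \<partial>\<rho>)"
    proof -
      have "(\<lambda>z. ennreal (cosh (L2_set (\<lambda>j. x j + t * X j z) J))) \<in> borel_measurable \<rho>"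
        using X by (simp add: L2_set_def cosh_def)
      then show ?thesis
        unfolding \<Phi>_def by (simp add: ennreal_mult nn_integral_cmult)
    qed
    also have "\<dots> \<le> ennreal (cosh (t * L) ^ k) * ennreal (cosh (t * L) * cosh (L2_set x J))"
      using bd mean t assms(1-3) X
      by (intro mult_left_mono nn_integral_cosh_L2_set_add_le) (auto simp: L2t)
    also have "\<dots> = \<Phi> (Suc k) x"
      unfolding \<Phi>_def by (simp add: ennreal_mult[symmetric] mult_ac)
    finally show "(\<integral>\<^sup>+z. \<Phi> k (\<lambda>j. x j + t * X j z) \<partial>\<rho>) \<le> \<Phi> (Suc k) x" .
  qed (use X in \<open>auto simp: \<Phi>_def L2_set_def cosh_def\<close>)
  then have "(\<integral>\<^sup>+z. ennreal (cosh (t * S z)) \<partial>P) \<le> ennreal (cosh (t * L) ^ n)"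
    by (simp add: \<Phi>_def S_def sum_distrib_left[symmetric] L2t L2_set_def[of "\<lambda>_. 0"])
  also have "cosh (t * L) ^ n \<le> exp (n * (t * L)\<^sup>2 / 2)"
  proof -
    have "cosh (t * L) ^ n \<le> exp ((t * L)\<^sup>2 / 2) ^ n"
      using t \<open>0 < L\<close> by (intro power_mono cosh_le_exp_square_half) auto
    then show ?thesis by (simp add: exp_of_nat_mult[symmetric])
  qed
  finally have mgf: "(\<integral>\<^sup>+z. ennreal (cosh (t * S z)) \<partial>P) \<le> ennreal (exp (n * (t * L)\<^sup>2 / 2))"
    by (simp add: ennreal_leI)
  \<comment> \<open>The factor 2 in the tail bound comes from estimating exp by twice cosh.\<close>
  have ge: "1 \<le> ennreal (2 * exp (- (t * u))) * ennreal (cosh (t * S z))" if "u \<le> S z" for z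
  proof -
    have "exp (t * u) \<le> exp (t * S z)" using that t by simp
    also have "\<dots> \<le> 2 * cosh (t * S z)" by (simp add: cosh_def)
    finally have "1 \<le> 2 * exp (- (t * u)) * cosh (t * S z)"
      by (simp add: exp_minus field_simps)
    then show ?thesis by (simp add: ennreal_mult[symmetric])
  qed
  have "emeasure P {z \<in> space P. u \<le> S z}
      \<le> ennreal (2 * exp (- (t * u))) * (\<integral>\<^sup>+z. ennreal (cosh (t * S z)) \<partial>P)"
  proof -
    have "{z \<in> space P. u \<le> S z} \<subseteq> {z \<in> space P. 1 \<le> ennreal (2 * exp (- (t * u))) * ennreal (cosh (t * S z))}"
      using ge by auto
    moreover have [measurable]: "(\<lambda>z. ennreal (cosh (t * S z))) \<in> borel_measurable P"
      using mS by (simp add: cosh_def)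
    ultimately show ?thesis
      using nn_integral_Markov_inequality[of "\<lambda>z. ennreal (cosh (t * S z))" "space P" P "ennreal (2 * exp (- (t * u)))"]
      by (auto intro: order.trans[OF emeasure_mono] simp: space_def[symmetric])
  qed
  also have "\<dots> \<le> ennreal (2 * exp (- (t * u))) * ennreal (exp (n * (t * L)\<^sup>2 / 2))"
    by (intro mult_left_mono mgf) simp
  also have "\<dots> = ennreal (2 * exp (- u\<^sup>2 / (2 * n * L\<^sup>2)))"
  proof -
    have "- (t * u) + n * (t * L)\<^sup>2 / 2 = - u\<^sup>2 / (2 * n * L\<^sup>2)"
      unfolding t_def using \<open>0 < L\<close> \<open>0 < n\<close> by (simp add: power2_eq_square field_simps)
    then show ?thesis by (simp add: ennreal_mult[symmetric] exp_add[symmetric] mult.assoc)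
  qed
  finally show ?thesis by (simp add: S_def)
qed

section \<open>Variational problems in Hilbert spaces of functions\<close>

text \<open>With e > 0 this turns approximate minimality into approximate stationarity; with e = 0
  it says that the derivative vanishes at a minimum; with a squared norm for e it is the
  Cauchy-Schwarz inequality.\<close>

lemma quadratic_nonneg_imp_discrim:
  fixes Q d e :: real
  assumes "0 \<le> Q" and nn: "\<And>t. 0 \<le> e + 2 * t * d + t\<^sup>2 * Q"
  shows "d\<^sup>2 \<le> e * Q"
proof (cases "Q = 0")
  case True
  have "d = 0"
  proof (rule ccontr)
    assume "d \<noteq> 0"
    \<comment> \<open>This \<open>t\<close> gives the affine function the value -1.\<close>
    then show False using nn[of "- (e + 1) / (2 * d)"] True by (simp add: field_simps)
  qed
  with True show ?thesis by simp
next
  case False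
  with assms(1) have "0 < Q" by simp
  then show ?thesis
    \<comment> \<open>The minimum of the parabola.\<close>
    using nn[of "- d / Q"] by (simp add: power2_eq_square field_simps)
qed

text \<open>Definiteness and completeness are left out so that the locale also covers the
  \<L>2(\<rho>) form on \<open>H\<close>, which can vanish on nonzero functions, and the subspace of
  measurable members of \<open>H\<close>.\<close>

locale semi_inner_product =
  fixes V :: "('x \<Rightarrow> real) set" and q :: "('x \<Rightarrow> real) \<Rightarrow> ('x \<Rightarrow> real) \<Rightarrow> real"
  assumes zero: "(\<lambda>_. 0) \<in> V"
    and add: "f \<in> V \<Longrightarrow> g \<in> V \<Longrightarrow> (\<lambda>x. f x + g x) \<in> V"
    and scale: "f \<in> V \<Longrightarrow> (\<lambda>x. a * f x) \<in> V"
    and commute: "f \<in> V \<Longrightarrow> g \<in> V \<Longrightarrow> q f g = q g f"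
    and add_left: "f \<in> V \<Longrightarrow> g \<in> V \<Longrightarrow> h \<in> V \<Longrightarrow> q (\<lambda>x. f x + g x) h = q f h + q g h"
    and scale_left: "f \<in> V \<Longrightarrow> g \<in> V \<Longrightarrow> q (\<lambda>x. a * f x) g = a * q f g"
    and nonneg: "f \<in> V \<Longrightarrow> 0 \<le> q f f"
begin

lemma diff: "f \<in> V \<Longrightarrow> g \<in> V \<Longrightarrow> (\<lambda>x. f x - g x) \<in> V"
  using add[of f "\<lambda>x. (- 1) * g x"] scale[of g "- 1"] by simp

lemma add_right:
  assumes "f \<in> V" "g \<in> V" "h \<in> V" shows "q h (\<lambda>x. f x + g x) = q h f + q h g"
  unfolding commute[OF assms(3) add[OF assms(1,2)]] commute[OF assms(3,1)] commute[OF assms(3,2)]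
  by (rule add_left[OF assms])

lemma scale_right:
  assumes "f \<in> V" "g \<in> V" shows "q g (\<lambda>x. a * f x) = a * q g f"
  unfolding commute[OF assms(2) scale[OF assms(1)]] commute[OF assms(2,1)]
  by (rule scale_left[OF assms])

lemma diff_left:
  assumes "f \<in> V" "g \<in> V" "h \<in> V" shows "q (\<lambda>x. f x - g x) h = q f h - q g h"
  using add_left[OF assms(1) scale[OF assms(2), of "- 1"] assms(3)]
    scale_left[OF assms(2,3), of "- 1"] by simp

lemma diff_right:
  assumes "f \<in> V" "g \<in> V" "h \<in> V" shows "q h (\<lambda>x. f x - g x) = q h f - q h g"
  using add_right[OF assms(1) scale[OF assms(2), of "- 1"] assms(3)]
    scale_right[OF assms(2,3), of "- 1"] by simp

lemma diff_expand:
  assumes "f \<in> V" "g \<in> V"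
  shows "q (\<lambda>x. f x - g x) (\<lambda>x. f x - g x) = q f f - 2 * q f g + q g g"
  unfolding diff_left[OF assms diff[OF assms]] diff_right[OF assms assms(1)] diff_right[OF assms assms(2)]
    commute[OF assms(2,1)]
  by simp

lemma add_scale_expand:
  assumes "f \<in> V" "g \<in> V"
  shows "q (\<lambda>x. f x + t * g x) (\<lambda>x. f x + t * g x) = q f f + 2 * t * q f g + t\<^sup>2 * q g g"
proof -
  have tg: "(\<lambda>x. t * g x) \<in> V" by (rule scale[OF assms(2)])
  show ?thesis
    unfolding add_left[OF assms(1) tg add[OF assms(1) tg]] add_right[OF assms(1) tg assms(1)]
      add_right[OF assms(1) tg tg] scale_left[OF assms(2,1)] scale_left[OF assms(2) tg]
      scale_right[OF assms(2,1)] scale_right[OF assms(2,2)] commute[OF assms(2,1)]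
    by (simp add: power2_eq_square)
qed

lemma Cauchy_Schwarz:
  assumes "f \<in> V" "g \<in> V"
  shows "(q f g)\<^sup>2 \<le> q f f * q g g"
proof (rule quadratic_nonneg_imp_discrim[OF nonneg[OF assms(2)]])
  fix t
  show "0 \<le> q f f + 2 * t * q f g + t\<^sup>2 * q g g"
    using nonneg[OF add[OF assms(1) scale[OF assms(2), of t]]] assms by (simp add: add_scale_expand)
qed

text \<open>Replaces the Riesz representation theorem where no limit is at hand: near-minimizers of
  the quadratic functional are close to each other by the parallelogram law, and almost stationary
  because a perturbation cannot gain more than the gap to the infimum.\<close>

lemma minimizing_sequence:
  assumes ell_add: "\<And>f g. f \<in> V \<Longrightarrow> g \<in> V \<Longrightarrow> ell (\<lambda>x. f x + g x) = ell f + ell g"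
    and ell_scale: "\<And>a f. f \<in> V \<Longrightarrow> ell (\<lambda>x. a * f x) = a * ell f"
    and bounded: "\<And>v. v \<in> V \<Longrightarrow> c \<le> q v v - 2 * ell v"
  obtains u where "\<And>k::nat. u k \<in> V"
    and "\<And>k l. q (\<lambda>x. u k x - u l x) (\<lambda>x. u k x - u l x) \<le> 2 / (real k + 1) + 2 / (real l + 1)"
    and "\<And>k h. h \<in> V \<Longrightarrow> (q (u k) h - ell h)\<^sup>2 \<le> 1 / (real k + 1) * q h h"
proof -
  define J where "J v = q v v - 2 * ell v" for v
  define m where "m = Inf (J ` V)"
  have bdd: "bdd_below (J ` V)" using bounded by (intro bdd_belowI[of _ c]) (auto simp: J_def)
  have m: "m \<le> J v" if "v \<in> V" for v
    unfolding m_def using that bdd by (intro cInf_lower) auto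
  have "\<exists>v\<in>V. J v < m + 1 / (real k + 1)" for k :: nat
  proof -
    have "Inf (J ` V) < m + 1 / (real k + 1)" by (simp add: m_def)
    then show ?thesis using zero cInf_lessD[of "J ` V"] by blast
  qed
  then obtain u where u: "u k \<in> V" "J (u k) < m + 1 / (real k + 1)" for k :: nat
    by metis
  show thesis
  proof (rule that[OF u(1)])
    fix k l :: nat
    \<comment> \<open>The factor 1 gives the sum the shape of
      \<open>add_scale_expand\<close>.\<close>
    let ?mid = "\<lambda>x. (1/2) * (u k x + 1 * u l x)"
    have mid: "?mid \<in> V"
      using scale[OF add[OF u(1)[of k] u(1)[of l]], of "1/2"] by simp
    have s: "(\<lambda>x. u k x + 1 * u l x) \<in> V" using add[OF u(1) u(1)] by simp
    have "q ?mid ?mid = (q (u k) (u k) + 2 * q (u k) (u l) + q (u l) (u l)) / 4"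
      using scale_left[OF s mid, of "1/2"] scale_right[OF s s, of "1/2"]
        add_scale_expand[OF u(1)[of k] u(1)[of l], of 1] by simp
    moreover have "ell ?mid = (ell (u k) + ell (u l)) / 2"
      using ell_scale[OF s, of "1/2"] ell_add[OF u(1)[of k] u(1)[of l]] by simp
    \<comment> \<open>The parallelogram identity for \<open>J\<close>: the linear part of
      \<open>J\<close> cancels, and \<open>J\<close> at the midpoint is at least
      \<open>m\<close>.\<close>
    ultimately have "q (\<lambda>x. u k x - u l x) (\<lambda>x. u k x - u l x) = 2 * J (u k) + 2 * J (u l) - 4 * J ?mid"
      using diff_expand[OF u(1)[of k] u(1)[of l]] by (simp add: J_def)
    also have "\<dots> \<le> 2 / (real k + 1) + 2 / (real l + 1)"
      using u(2)[of k] u(2)[of l] m[OF mid] by simp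
    finally show "q (\<lambda>x. u k x - u l x) (\<lambda>x. u k x - u l x) \<le> 2 / (real k + 1) + 2 / (real l + 1)" .
  next
    fix k :: nat and h assume h: "h \<in> V"
    show "(q (u k) h - ell h)\<^sup>2 \<le> 1 / (real k + 1) * q h h"
    proof (rule quadratic_nonneg_imp_discrim[OF nonneg[OF h]])
      fix t
      have "m \<le> J (\<lambda>x. u k x + t * h x)"
        by (intro m add u(1) scale h)
      also have "\<dots> = J (u k) + 2 * t * (q (u k) h - ell h) + t\<^sup>2 * q h h"
        using h u(1)[of k]
        by (simp add: J_def add_scale_expand ell_add ell_scale scale algebra_simps)
      finally show "0 \<le> 1 / (real k + 1) + 2 * t * (q (u k) h - ell h) + t\<^sup>2 * q h h"
        using u(2)[of k] by simp
    qed
  qed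
qed

end

lemma tendsto_zero_if_square_le:
  fixes a :: "nat \<Rightarrow> real"
  assumes "\<And>k. (a k)\<^sup>2 \<le> b k" and "b \<longlonglongrightarrow> 0"
  shows "a \<longlonglongrightarrow> 0"
proof -
  have "(\<lambda>k. (a k)\<^sup>2) \<longlonglongrightarrow> 0"
    by (rule tendsto_sandwich[OF _ _ tendsto_const assms(2)]) (use assms(1) in auto)
  then have "(\<lambda>k. sqrt ((a k)\<^sup>2)) \<longlonglongrightarrow> sqrt 0" by (rule tendsto_real_sqrt)
  then show ?thesis by (simp add: tendsto_rabs_zero_iff)
qed

lemma LIMSEQ_const_div_Suc: "(\<lambda>k. c / (real k + 1)) \<longlonglongrightarrow> (0::real)"
  using tendsto_mult_right_zero[OF LIMSEQ_inverse_real_of_nat, of c]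
  by (simp add: divide_inverse add.commute)

context function_hilbert_space
begin

sublocale semi_inner_product H ip
  by unfold_locales
    (rule zero_mem add_mem scale_mem ip_commute ip_add ip_scale ip_nonneg; assumption)+

lemma convergent_if_Cauchy_rate:
  assumes u: "\<And>k. u k \<in> H"
    and rate: "\<And>k l. ip (\<lambda>x. u k x - u l x) (\<lambda>x. u k x - u l x) \<le> C / (real k + 1) + C / (real l + 1)"
  obtains f where "f \<in> H" "(\<lambda>k. ip (\<lambda>x. u k x - f x) (\<lambda>x. u k x - f x)) \<longlonglongrightarrow> 0"
proof -
  have "\<exists>f\<in>H. (\<lambda>k. sqrt (ip (\<lambda>x. u k x - f x) (\<lambda>x. u k x - f x))) \<longlonglongrightarrow> 0"
  proof (rule complete[OF u])
    fix e :: real assume e: "0 < e"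
    have "\<forall>\<^sub>F k in sequentially. C / (real k + 1) < e\<^sup>2 / 2"
      using order_tendstoD(2)[OF LIMSEQ_const_div_Suc[of C], of "e\<^sup>2 / 2"] e by simp
    then obtain N where N: "\<And>k. k \<ge> N \<Longrightarrow> C / (real k + 1) < e\<^sup>2 / 2"
      unfolding eventually_sequentially by blast
    have "sqrt (ip (\<lambda>x. u k x - u l x) (\<lambda>x. u k x - u l x)) < e" if "k \<ge> N" "l \<ge> N" for k l
    proof -
      have "ip (\<lambda>x. u k x - u l x) (\<lambda>x. u k x - u l x) < e\<^sup>2"
        using rate[of k l] N[OF that(1)] N[OF that(2)] by linarith
      then show ?thesis using e by (simp add: real_less_lsqrt)
    qed
    then show "\<exists>N. \<forall>k\<ge>N. \<forall>l\<ge>N. sqrt (ip (\<lambda>x. u k x - u l x) (\<lambda>x. u k x - u l x)) < e"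
      by blast
  qed
  then obtain f where f: "f \<in> H" "(\<lambda>k. sqrt (ip (\<lambda>x. u k x - f x) (\<lambda>x. u k x - f x))) \<longlonglongrightarrow> 0"
    by blast
  have "(\<lambda>k. (sqrt (ip (\<lambda>x. u k x - f x) (\<lambda>x. u k x - f x)))\<^sup>2) \<longlonglongrightarrow> 0"
    using tendsto_power[OF f(2), of 2] by simp
  then have "(\<lambda>k. ip (\<lambda>x. u k x - f x) (\<lambda>x. u k x - f x)) \<longlonglongrightarrow> 0"
    using u f(1) by (simp add: nonneg diff)
  with f(1) show thesis by (rule that)
qed

text \<open>The solution represents the functional \<open>s f0\<close> with respect to q = l ip + s.
  Since q dominates l ip, a minimizing sequence for q is Cauchy for \<open>ip\<close>, where
  completeness is available; since q is at most (l + C) ip, the limit can be taken inside q.\<close>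

lemma tikhonov_solution:
  assumes s: "semi_inner_product H s" and bd: "\<And>f. f \<in> H \<Longrightarrow> s f f \<le> C * ip f f"
    and "0 < l" and f0: "f0 \<in> H"
  obtains f where "f \<in> H" "\<And>h. h \<in> H \<Longrightarrow> l * ip f h + s f h = s f0 h"
proof -
  interpret s: semi_inner_product H s by fact
  define q where "q f g = l * ip f g + s f g" for f g
  interpret q: semi_inner_product H q
  proof unfold_locales
    show "q f g = q g f" if "f \<in> H" "g \<in> H" for f g
      unfolding q_def by (simp only: commute[OF that] s.commute[OF that])
  qed (use \<open>0 < l\<close> in \<open>auto simp: q_def zero add scale add_left s.add_left scale_left s.scale_left
        nonneg s.nonneg algebra_simps\<close>)
  \<comment> \<open>Nonnegativity of \<open>s\<close> at \<open>f0 - v\<close>; the penalty term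
    only helps.\<close>
  have lb: "- s f0 f0 \<le> q v v - 2 * s f0 v" if "v \<in> H" for v
  proof -
    have "0 \<le> s f0 f0 - 2 * s f0 v + s v v"
      using s.nonneg[OF diff[OF f0 that]] s.diff_expand[OF f0 that] by simp
    then show ?thesis using mult_nonneg_nonneg[of l, OF less_imp_le[OF \<open>0 < l\<close>] nonneg[OF that]]
      by (simp add: q_def)
  qed
  obtain u where u: "\<And>k::nat. u k \<in> H"
      "\<And>k l. q (\<lambda>x. u k x - u l x) (\<lambda>x. u k x - u l x) \<le> 2 / (real k + 1) + 2 / (real l + 1)"
      "\<And>k h. h \<in> H \<Longrightarrow> (q (u k) h - s f0 h)\<^sup>2 \<le> 1 / (real k + 1) * q h h"
    by (rule q.minimizing_sequence[OF s.add_right[OF _ _ f0] s.scale_right[OF _ f0] lb]) (assumption+, rule that)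
  have rate: "ip (\<lambda>x. u k x - u j x) (\<lambda>x. u k x - u j x) \<le> (2 / l) / (real k + 1) + (2 / l) / (real j + 1)" for k j
  proof -
    have "l * ip (\<lambda>x. u k x - u j x) (\<lambda>x. u k x - u j x) \<le> 2 / (real k + 1) + 2 / (real j + 1)"
      using u(2)[of k j] s.nonneg[OF diff[OF u(1) u(1)], of k j] by (simp add: q_def)
    then have "ip (\<lambda>x. u k x - u j x) (\<lambda>x. u k x - u j x) \<le> (2 / (real k + 1) + 2 / (real j + 1)) / l"
      using \<open>0 < l\<close> by (simp add: pos_le_divide_eq mult.commute)
    then show ?thesis by (simp add: add_divide_distrib mult.commute)
  qed
  obtain f where f: "f \<in> H" "(\<lambda>k. ip (\<lambda>x. u k x - f x) (\<lambda>x. u k x - f x)) \<longlonglongrightarrow> 0"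
    using convergent_if_Cauchy_rate[of u, OF u(1) rate] by blast
  show thesis
  proof (rule that[OF f(1)])
    fix h assume h: "h \<in> H"
    have "(\<lambda>k. q (u k) h - s f0 h) \<longlonglongrightarrow> 0"
      using tendsto_zero_if_square_le[OF u(3)[OF h]] LIMSEQ_const_div_Suc[of "q h h"] by simp
    moreover have "(\<lambda>k. q (\<lambda>x. u k x - f x) h) \<longlonglongrightarrow> 0"
    proof (rule tendsto_zero_if_square_le)
      fix k
      have "(q (\<lambda>x. u k x - f x) h)\<^sup>2 \<le> q (\<lambda>x. u k x - f x) (\<lambda>x. u k x - f x) * q h h"
        by (intro q.Cauchy_Schwarz diff u f h)
      also have "\<dots> \<le> ((l + C) * ip (\<lambda>x. u k x - f x) (\<lambda>x. u k x - f x)) * q h h"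
        using bd[OF diff[OF u(1) f(1)], of k]
        by (intro mult_right_mono q.nonneg h) (simp add: q_def algebra_simps)
      finally show "(q (\<lambda>x. u k x - f x) h)\<^sup>2 \<le> ip (\<lambda>x. u k x - f x) (\<lambda>x. u k x - f x) * ((l + C) * q h h)"
        by (simp add: mult_ac)
    qed (rule tendsto_mult_left_zero[OF f(2)])
    ultimately have "(\<lambda>k. (q (u k) h - s f0 h) - q (\<lambda>x. u k x - f x) h) \<longlonglongrightarrow> 0 - 0"
      by (rule tendsto_diff)
    then have "(\<lambda>k. q f h - s f0 h) \<longlonglongrightarrow> 0"
      using u(1) f(1) h by (simp add: q.diff_left)
    then show "l * ip f h + s f h = s f0 h"
      unfolding LIMSEQ_const_iff by (simp add: q_def)
  qed
qed

end

section \<open>Point evaluations and measurability in a reproducing kernel Hilbert space\<close>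

context rkhs
begin

lemma eval_square_le:
  assumes "f \<in> H"
  shows "(f x)\<^sup>2 \<le> ip f f * K x x"
proof -
  have 1: "ip f (K x) = f x" by (rule reproducing[OF assms, symmetric])
  have 2: "ip (K x) (K x) = K x x" by (rule reproducing[OF kernel_mem, symmetric])
  show ?thesis using Cauchy_Schwarz[OF assms kernel_mem[of x]] unfolding 1 2 .
qed

text \<open>The measurable elements form a subspace containing every kernel section; the projection of
  \<open>f\<close> to its closure is a pointwise limit of measurable functions and agrees with \<open>f\<close>.\<close>

lemma measurable_mem:
  assumes K: "\<And>x. K x \<in> borel_measurable N" and f0: "f0 \<in> H"
  shows "f0 \<in> borel_measurable N"
proof -
  define V where "V = H \<inter> borel_measurable N"
  have V_sub: "f \<in> H" if "f \<in> V" for f using that by (simp add: V_def)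
  interpret V: semi_inner_product V ip
  proof (unfold_locales; (intro commute add_left scale_left nonneg V_sub; assumption)?)
    fix f g :: "'x \<Rightarrow> real" and a :: real assume V: "f \<in> V" "g \<in> V"
    have [measurable]: "f \<in> borel_measurable N" "g \<in> borel_measurable N"
      using V by (simp_all add: V_def)
    show "(\<lambda>x. f x + g x) \<in> V"
      using V unfolding V_def by (intro IntI add) (simp_all, measurable)
  next
    fix f :: "'x \<Rightarrow> real" and a :: real assume V: "f \<in> V"
    have [measurable]: "f \<in> borel_measurable N"
      using V by (simp_all add: V_def)
    show "(\<lambda>x. a * f x) \<in> V"
      using V unfolding V_def by (intro IntI scale) (simp_all, measurable)
  next
    show "(\<lambda>_. 0) \<in> V" by (simp add: V_def zero)
  qed
  have lin: "ip f0 (\<lambda>x. f x + g x) = ip f0 f + ip f0 g" "ip f0 (\<lambda>x. a * f x) = a * ip f0 f"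
    if "f \<in> V" "g \<in> V" for f g a
    using that f0 by (simp_all add: V_def add_right scale_right)
  have lb: "- ip f0 f0 \<le> ip v v - 2 * ip f0 v" if "v \<in> V" for v
    using nonneg[OF diff[OF f0, of v]] diff_expand[OF f0, of v] that by (simp add: V_def)
  obtain u where u: "\<And>k::nat. u k \<in> V"
      "\<And>k l. ip (\<lambda>x. u k x - u l x) (\<lambda>x. u k x - u l x) \<le> 2 / (real k + 1) + 2 / (real l + 1)"
      "\<And>k h. h \<in> V \<Longrightarrow> (ip (u k) h - ip f0 h)\<^sup>2 \<le> 1 / (real k + 1) * ip h h"
    by (rule V.minimizing_sequence[OF lin(1) lin(2)[OF _ V.zero] lb]) (assumption+, rule that)
  show ?thesis
  proof (rule borel_measurable_LIMSEQ_real)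
    show "u k \<in> borel_measurable N" for k using u(1)[of k] by (simp add: V_def)
    fix x
    show "(\<lambda>k. u k x) \<longlonglongrightarrow> f0 x"
    proof -
      \<comment> \<open>Near-stationarity is tested with a kernel section, which yields pointwise
        convergence to \<open>f0\<close> without constructing the projection itself.\<close>
      have KV: "K x \<in> V" by (simp add: V_def K kernel_mem)
      have "(\<lambda>k. ip (u k) (K x) - ip f0 (K x)) \<longlonglongrightarrow> 0"
        using tendsto_zero_if_square_le[OF u(3)[OF KV]] LIMSEQ_const_div_Suc[of "ip (K x) (K x)"] by simp
      moreover have "ip (u k) (K x) = u k x" for k
        by (rule reproducing[OF V_sub[OF u(1)], symmetric])
      moreover have "ip f0 (K x) = f0 x" by (rule reproducing[OF f0, symmetric])
      ultimately show ?thesis by (simp add: LIM_zero_iff)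
    qed
  qed
qed

end

section \<open>Ridge regression on finitely many bounded features\<close>

text \<open>Measurable essentially bounded functions form an algebra contained in \<L>1 of a
  probability space, so integrability of all products and squares below follows from closure
  rules.\<close>

definition ae_bounded :: "'a measure \<Rightarrow> ('a \<Rightarrow> real) \<Rightarrow> bool"
  where "ae_bounded M f \<longleftrightarrow> f \<in> borel_measurable M \<and> (\<exists>C. AE x in M. \<bar>f x\<bar> \<le> C)"

lemma ae_boundedI:
  "f \<in> borel_measurable M \<Longrightarrow> AE x in M. \<bar>f x\<bar> \<le> C \<Longrightarrow> ae_bounded M f"
  by (auto simp: ae_bounded_def)

lemma ae_boundedE:
  assumes "ae_bounded M f"
  obtains C where "0 \<le> C" "AE x in M. \<bar>f x\<bar> \<le> C"
proof -
  obtain C where C: "AE x in M. \<bar>f x\<bar> \<le> C" using assms by (auto simp: ae_bounded_def)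
  show thesis
  proof (rule that[of "max 0 C"])
    show "AE x in M. \<bar>f x\<bar> \<le> max 0 C" using C by eventually_elim auto
  qed simp
qed

lemma ae_bounded_measurable: "ae_bounded M f \<Longrightarrow> f \<in> borel_measurable M"
  by (simp add: ae_bounded_def)

lemma ae_bounded_const: "ae_bounded M (\<lambda>_. c)"
  by (rule ae_boundedI[of _ _ "\<bar>c\<bar>"]) auto

lemma ae_bounded_add:
  assumes f: "ae_bounded M f" and g: "ae_bounded M g"
  shows "ae_bounded M (\<lambda>x. f x + g x)"
proof -
  obtain C where C: "AE x in M. \<bar>f x\<bar> \<le> C" by (rule ae_boundedE[OF f])
  obtain D where D: "AE x in M. \<bar>g x\<bar> \<le> D" by (rule ae_boundedE[OF g])
  show ?thesis
  proof (rule ae_boundedI)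
    show "AE x in M. \<bar>f x + g x\<bar> \<le> C + D"
      using C D by eventually_elim auto
  qed (intro borel_measurable_add borel_measurable_times ae_bounded_measurable assms)
qed

lemma ae_bounded_mult:
  assumes f: "ae_bounded M f" and g: "ae_bounded M g"
  shows "ae_bounded M (\<lambda>x. f x * g x)"
proof -
  obtain C where C: "0 \<le> C" "AE x in M. \<bar>f x\<bar> \<le> C" by (rule ae_boundedE[OF f])
  obtain D where D: "AE x in M. \<bar>g x\<bar> \<le> D" by (rule ae_boundedE[OF g])
  show ?thesis
  proof (rule ae_boundedI)
    show "AE x in M. \<bar>f x * g x\<bar> \<le> C * D"
      using C(2) D by eventually_elim (use C(1) in \<open>auto simp: abs_mult intro: mult_mono\<close>)
  qed (intro borel_measurable_add borel_measurable_times ae_bounded_measurable assms)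
qed

lemma ae_bounded_diff:
  assumes "ae_bounded M f" "ae_bounded M g"
  shows "ae_bounded M (\<lambda>x. f x - g x)"
  using ae_bounded_add[OF assms(1) ae_bounded_mult[OF ae_bounded_const[of M "- 1"] assms(2)]] by simp

lemma ae_bounded_power:
  assumes "ae_bounded M f"
  shows "ae_bounded M (\<lambda>x. (f x)\<^sup>2)"
  using ae_bounded_mult[OF assms assms] by (simp add: power2_eq_square)

lemma ae_bounded_sum:
  assumes "\<And>i. i \<in> I \<Longrightarrow> ae_bounded M (f i)"
  shows "ae_bounded M (\<lambda>x. \<Sum>i\<in>I. f i x)"
  using assms
  by (induction I rule: infinite_finite_induct) (auto intro: ae_bounded_const ae_bounded_add)

lemmas ae_bounded_intros =
  ae_bounded_const ae_bounded_add ae_bounded_mult ae_bounded_diff ae_bounded_power ae_bounded_sum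

context prob_space
begin

lemma integrable_ae_bounded:
  assumes "ae_bounded M f"
  shows "integrable M f"
proof -
  obtain C where "AE x in M. \<bar>f x\<bar> \<le> C" by (rule ae_boundedE[OF assms])
  then show ?thesis
    by (intro integrable_const_bound[of _ C]) (auto simp: ae_bounded_measurable[OF assms])
qed

lemma integral_le_ae_bound:
  assumes "ae_bounded M f" and "AE x in M. f x \<le> C"
  shows "(\<integral>x. f x \<partial>M) \<le> C"
  using integral_mono_AE[OF integrable_ae_bounded[OF assms(1)] integrable_ae_bounded[OF ae_bounded_const[of M C]] assms(2)]
  by (simp add: prob_space)

lemma integral_Cauchy_Schwarz:
  assumes "ae_bounded M f" "ae_bounded M g"
  shows "(\<integral>x. f x * g x \<partial>M)\<^sup>2 \<le> (\<integral>x. (f x)\<^sup>2 \<partial>M) * (\<integral>x. (g x)\<^sup>2 \<partial>M)"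
proof (rule quadratic_nonneg_imp_discrim)
  fix t
  have "0 \<le> (\<integral>x. (f x + t * g x)\<^sup>2 \<partial>M)" by simp
  also have "\<dots> = (\<integral>x. (f x)\<^sup>2 + (2 * t * (f x * g x) + t\<^sup>2 * (g x)\<^sup>2) \<partial>M)"
    by (simp add: power2_eq_square algebra_simps)
  also have "\<dots> = (\<integral>x. (f x)\<^sup>2 \<partial>M) + 2 * t * (\<integral>x. f x * g x \<partial>M) + t\<^sup>2 * (\<integral>x. (g x)\<^sup>2 \<partial>M)"
  proof -
    have "integrable M (\<lambda>x. (f x)\<^sup>2)" "integrable M (\<lambda>x. f x * g x)" "integrable M (\<lambda>x. (g x)\<^sup>2)"
      by (intro integrable_ae_bounded ae_bounded_intros assms)+
    then show ?thesis by simp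
  qed
  finally show "0 \<le> (\<integral>x. (f x)\<^sup>2 \<partial>M) + 2 * t * (\<integral>x. f x * g x \<partial>M) + t\<^sup>2 * (\<integral>x. (g x)\<^sup>2 \<partial>M)" .
qed simp

end

section \<open>Population ridge regression\<close>

lemma coercive_system_solvable:
  fixes C :: "nat \<Rightarrow> nat \<Rightarrow> real"
  assumes "0 < l" and psd: "\<And>v. 0 \<le> (\<Sum>j<M. \<Sum>k<M. v j * C j k * v k)"
  obtains w where "\<And>j. j < M \<Longrightarrow> (\<Sum>k<M. C j k * w k) + l * w j = p j"
proof -
  define A where "A = Matrix.mat M M (\<lambda>(j, k). C j k + (if j = k then l else 0))"
  have A: "A \<in> carrier_mat M M" by (simp add: A_def)
  have Av: "vec_index (A *\<^sub>v v) j = (\<Sum>k<M. C j k * vec_index v k) + l * vec_index v j"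
    if "v \<in> carrier_vec M" "j < M" for v j
  proof -
    have "vec_index (A *\<^sub>v v) j = (\<Sum>k<M. (C j k + (if j = k then l else 0)) * vec_index v k)"
      using that by (auto simp: A_def scalar_prod_def atLeast0LessThan)
    also have "\<dots> = (\<Sum>k<M. C j k * vec_index v k + (if j = k then l * vec_index v k else 0))"
      by (intro sum.cong refl) (simp add: distrib_right)
    finally show ?thesis using that by (simp add: sum.distrib)
  qed
  have "Determinant.det A \<noteq> 0"
  proof (rule det_nonzero_if_coercive[OF A \<open>0 < l\<close>])
    fix v :: "real Matrix.vec" assume v: "v \<in> carrier_vec M"
    have "scalar_prod v (A *\<^sub>v v) = (\<Sum>j<M. vec_index v j * vec_index (A *\<^sub>v v) j)"
      using A by (simp add: scalar_prod_def atLeast0LessThan)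
    also have "\<dots> = (\<Sum>j<M. vec_index v j * ((\<Sum>k<M. C j k * vec_index v k) + l * vec_index v j))"
      by (intro sum.cong refl arg_cong2[of _ _ _ _ "(*)"] Av v) simp
    also have "\<dots> = (\<Sum>j<M. \<Sum>k<M. vec_index v j * C j k * vec_index v k) + l * scalar_prod v v"
      using v by (simp add: scalar_prod_def atLeast0LessThan distrib_left sum.distrib sum_distrib_left mult_ac)
    finally show "l * scalar_prod v v \<le> scalar_prod v (A *\<^sub>v v)"
      using psd[of "vec_index v"] by simp
  qed
  then have "A \<in> Units (ring_mat TYPE(real) M ())" by (rule det_non_zero_imp_unit[OF A])
  then obtain B where "B \<in> carrier_mat M M" "A * B = 1\<^sub>m M"
    unfolding Units_def ring_mat_def by auto
  note B = this
  define v where "v = B *\<^sub>v Matrix.vec M p"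
  have v: "v \<in> carrier_vec M" unfolding v_def using B(1) by (intro mult_mat_vec_carrier) auto
  have "A *\<^sub>v v = Matrix.vec M p"
    unfolding v_def using assoc_mult_mat_vec[OF A B(1), of "Matrix.vec M p", symmetric] B(2) by simp
  then have "vec_index (A *\<^sub>v v) j = p j" if "j < M" for j
    using that by simp
  with Av[OF v] show thesis
    by (intro that[of "vec_index v"]) simp
qed

definition lin_comb :: "nat \<Rightarrow> (nat \<Rightarrow> 'z \<Rightarrow> real) \<Rightarrow> (nat \<Rightarrow> real) \<Rightarrow> 'z \<Rightarrow> real"
  where "lin_comb M \<phi> w z = (\<Sum>j<M. \<phi> j z * w j)"

lemma ae_bounded_lin_comb:
  "(\<And>j. j < M \<Longrightarrow> ae_bounded \<rho> (\<phi> j)) \<Longrightarrow> ae_bounded \<rho> (lin_comb M \<phi> w)"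
  unfolding lin_comb_def by (intro ae_bounded_intros) auto

lemma lin_comb_diff: "lin_comb M \<phi> (\<lambda>j. v j - w j) z = lin_comb M \<phi> v z - lin_comb M \<phi> w z"
  by (simp add: lin_comb_def right_diff_distrib sum_subtractf)

lemma abs_lin_comb_le: "\<bar>lin_comb M \<phi> w z\<bar> \<le> L2_set (\<lambda>j. \<phi> j z) {..<M} * L2_set w {..<M}"
proof -
  have "\<bar>lin_comb M \<phi> w z\<bar> \<le> (\<Sum>j<M. \<bar>\<phi> j z\<bar> * \<bar>w j\<bar>)"
    unfolding lin_comb_def by (rule order.trans[OF sum_abs]) (simp add: abs_mult)
  also have "\<dots> \<le> L2_set (\<lambda>j. \<phi> j z) {..<M} * L2_set w {..<M}" by (rule L2_set_mult_ineq)
  finally show ?thesis .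
qed

context prob_space
begin

lemma integral_lin_comb_mult:
  assumes "\<And>j. j < m \<Longrightarrow> ae_bounded M (\<phi> j)" and "ae_bounded M f"
  shows "(\<integral>z. lin_comb m \<phi> w z * f z \<partial>M) = (\<Sum>j<m. w j * (\<integral>z. \<phi> j z * f z \<partial>M))"
proof -
  have "(\<integral>z. lin_comb m \<phi> w z * f z \<partial>M) = (\<integral>z. (\<Sum>j<m. w j * (\<phi> j z * f z)) \<partial>M)"
    unfolding lin_comb_def sum_distrib_right
    by (intro Bochner_Integration.integral_cong sum.cong refl) (simp add: mult_ac)
  also have "\<dots> = (\<Sum>j<m. w j * (\<integral>z. \<phi> j z * f z \<partial>M))"
    by (subst Bochner_Integration.integral_sum)
      (auto intro!: integrable_mult_right integrable_ae_bounded ae_bounded_mult assms)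
  finally show ?thesis .
qed

lemma integral_mult_lin_comb:
  assumes "\<And>j. j < m \<Longrightarrow> ae_bounded M (\<phi> j)" and "ae_bounded M f"
  shows "(\<integral>z. f z * lin_comb m \<phi> w z \<partial>M) = (\<Sum>j<m. (\<integral>z. f z * \<phi> j z \<partial>M) * w j)"
  using integral_lin_comb_mult[of m \<phi> f w, OF assms] by (simp add: mult.commute)

lemma integral_lin_comb_square:
  assumes "\<And>j. j < m \<Longrightarrow> ae_bounded M (\<phi> j)"
  shows "(\<integral>z. (lin_comb m \<phi> w z)\<^sup>2 \<partial>M) = (\<Sum>j<m. \<Sum>k<m. w j * (\<integral>z. \<phi> j z * \<phi> k z \<partial>M) * w k)"
proof -
  have "(\<integral>z. (lin_comb m \<phi> w z)\<^sup>2 \<partial>M) = (\<Sum>j<m. w j * (\<integral>z. \<phi> j z * lin_comb m \<phi> w z \<partial>M))"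
    unfolding power2_eq_square by (rule integral_lin_comb_mult[OF assms ae_bounded_lin_comb[OF assms]])
  also have "\<dots> = (\<Sum>j<m. w j * (\<Sum>k<m. (\<integral>z. \<phi> j z * \<phi> k z \<partial>M) * w k))"
    by (intro sum.cong refl arg_cong2[of _ _ _ _ "(*)"] integral_mult_lin_comb[OF assms]) (auto intro: assms)
  finally show ?thesis by (simp add: sum_distrib_left mult.assoc)
qed

text \<open>The weights solve the stationarity equations. Around them the linear terms of the fit
  and of the penalty cancel, leaving two nonnegative squares, so stationarity already gives global
  minimality.\<close>

lemma population_ridge:
  assumes \<phi>: "\<And>j. j < m \<Longrightarrow> ae_bounded M (\<phi> j)" and q: "ae_bounded M q" and "0 < l"
  obtains w where
    "\<And>j. j < m \<Longrightarrow> (\<integral>z. \<phi> j z * (q z - lin_comb m \<phi> w z) \<partial>M) = l * w j"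
    "\<And>v. (\<integral>z. (lin_comb m \<phi> w z - q z)\<^sup>2 \<partial>M) + l * (\<Sum>j<m. (w j)\<^sup>2)
      \<le> (\<integral>z. (lin_comb m \<phi> v z - q z)\<^sup>2 \<partial>M) + l * (\<Sum>j<m. (v j)\<^sup>2)"
proof -
  define C where "C j k = (\<integral>z. \<phi> j z * \<phi> k z \<partial>M)" for j k
  have psd: "0 \<le> (\<Sum>j<m. \<Sum>k<m. v j * C j k * v k)" for v
  proof -
    have "0 \<le> (\<integral>z. (lin_comb m \<phi> v z)\<^sup>2 \<partial>M)" by simp
    then show ?thesis by (simp only: integral_lin_comb_square[OF \<phi>] C_def)
  qed
  obtain w where w: "\<And>j. j < m \<Longrightarrow> (\<Sum>k<m. C j k * w k) + l * w j = (\<integral>z. \<phi> j z * q z \<partial>M)"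
    by (rule coercive_system_solvable[OF \<open>0 < l\<close> psd]) (rule that)
  have lc: "ae_bounded M (lin_comb m \<phi> v)" for v by (rule ae_bounded_lin_comb[OF \<phi>])
  have eq: "(\<integral>z. \<phi> j z * (q z - lin_comb m \<phi> w z) \<partial>M) = l * w j" if j: "j < m" for j
  proof -
    have "(\<integral>z. \<phi> j z * (q z - lin_comb m \<phi> w z) \<partial>M)
        = (\<integral>z. \<phi> j z * q z \<partial>M) - (\<integral>z. \<phi> j z * lin_comb m \<phi> w z \<partial>M)"
      unfolding right_diff_distrib
      by (intro Bochner_Integration.integral_diff integrable_ae_bounded ae_bounded_mult \<phi> j q lc)
    also have "(\<integral>z. \<phi> j z * lin_comb m \<phi> w z \<partial>M) = (\<Sum>k<m. C j k * w k)"
      unfolding C_def by (rule integral_mult_lin_comb[OF \<phi> \<phi>[OF j]])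
    finally show ?thesis using w[OF j] by simp
  qed
  show thesis
  proof (rule that[OF eq])
    fix v
    define d where "d j = v j - w j" for j
    let ?f = "lin_comb m \<phi> w" and ?d = "lin_comb m \<phi> d"
    have d: "lin_comb m \<phi> v z = ?f z + ?d z" for z
      unfolding d_def lin_comb_diff by simp
    have int: "integrable M (\<lambda>z. (?f z - q z)\<^sup>2)" "integrable M (\<lambda>z. ?d z * (q z - ?f z))" "integrable M (\<lambda>z. (?d z)\<^sup>2)"
      by (intro integrable_ae_bounded ae_bounded_intros lc q)+
    have "(\<integral>z. ?d z * (q z - ?f z) \<partial>M) = (\<Sum>j<m. d j * (l * w j))"
      using integral_lin_comb_mult[where w = d, OF \<phi> ae_bounded_diff[OF q lc[of w]]] eq by simp
    then have "(\<integral>z. (lin_comb m \<phi> v z - q z)\<^sup>2 \<partial>M)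
        = (\<integral>z. (?f z - q z)\<^sup>2 \<partial>M) - 2 * (\<Sum>j<m. d j * (l * w j)) + (\<integral>z. (?d z)\<^sup>2 \<partial>M)"
    proof -
      have "(\<integral>z. (lin_comb m \<phi> v z - q z)\<^sup>2 \<partial>M)
          = (\<integral>z. (?f z - q z)\<^sup>2 - 2 * (?d z * (q z - ?f z)) + (?d z)\<^sup>2 \<partial>M)"
        unfolding d by (intro Bochner_Integration.integral_cong refl) (simp add: power2_eq_square algebra_simps)
      with int \<open>(\<integral>z. ?d z * (q z - ?f z) \<partial>M) = _\<close> show ?thesis by simp
    qed
    moreover have "l * (\<Sum>j<m. (v j)\<^sup>2) = l * (\<Sum>j<m. (w j)\<^sup>2) + 2 * (\<Sum>j<m. d j * (l * w j)) + l * (\<Sum>j<m. (d j)\<^sup>2)"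
      unfolding sum_distrib_left sum.distrib[symmetric]
      by (intro sum.cong refl) (simp add: d_def power2_eq_square algebra_simps)
    moreover have "0 \<le> l * (\<Sum>j<m. (d j)\<^sup>2)" "0 \<le> (\<integral>z. (?d z)\<^sup>2 \<partial>M)"
      using \<open>0 < l\<close> by (simp_all add: sum_nonneg)
    ultimately show "(\<integral>z. (?f z - q z)\<^sup>2 \<partial>M) + l * (\<Sum>j<m. (w j)\<^sup>2)
      \<le> (\<integral>z. (lin_comb m \<phi> v z - q z)\<^sup>2 \<partial>M) + l * (\<Sum>j<m. (v j)\<^sup>2)"
      by linarith
  qed
qed

end

section \<open>From population weights to empirical weights\<close>

lemma L2_set_product:
  "L2_set (\<lambda>(j, k). f j * g k) (A \<times> B) = L2_set f A * L2_set g B"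
proof -
  have "(\<Sum>(j, k)\<in>A \<times> B. (f j * g k)\<^sup>2) = (\<Sum>j\<in>A. (f j)\<^sup>2) * (\<Sum>k\<in>B. (g k)\<^sup>2)"
    by (simp add: sum.cartesian_product[symmetric] sum_product power_mult_distrib)
  then show ?thesis
    by (simp add: L2_set_def case_prod_unfold real_sqrt_mult)
qed

lemma L2_set_power2: "(L2_set f A)\<^sup>2 = (\<Sum>i\<in>A. (f i)\<^sup>2)"
  by (simp add: L2_set_def sum_nonneg)

lemma abs_sum_mult_le_L2_set: "\<bar>\<Sum>i\<in>A. f i * g i\<bar> \<le> L2_set f A * L2_set g A"
  by (rule order.trans[OF sum_abs]) (simp add: abs_mult L2_set_mult_ineq)

context prob_space
begin

text \<open>A deterministic estimate: the sample enters only through the bounds \<open>a\<close> on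
  the noise vector and \<open>e\<close> on the covariance error, the latter measured by
  \<open>L2_set\<close> over pairs, that is, in Hilbert-Schmidt norm.\<close>

lemma empirical_ridge_error:
  fixes zs :: "nat \<Rightarrow> 'a" and n m :: nat and l a e :: real
  assumes \<phi>: "\<And>j. j < m \<Longrightarrow> ae_bounded M (\<phi> j)" and "0 < n" and "0 < l"
    and normal_eq: "\<And>j. j < m \<Longrightarrow> (\<Sum>k<m. (\<Sum>i<n. \<phi> j (zs i) * \<phi> k (zs i)) / n * w k) + l * w j
      = (\<Sum>i<n. \<phi> j (zs i) * y (zs i)) / n"
    and noise: "L2_set (\<lambda>j. \<Sum>i<n. \<phi> j (zs i) * (y (zs i) - lin_comb m \<phi> v (zs i)) - l * v j) {..<m} \<le> n * a"
    and cov: "L2_set (\<lambda>(j, k). \<Sum>i<n. \<phi> j (zs i) * \<phi> k (zs i) - (\<integral>z. \<phi> j z * \<phi> k z \<partial>M)) ({..<m} \<times> {..<m}) \<le> n * e"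
  shows "(\<integral>z. (lin_comb m \<phi> (\<lambda>j. w j - v j) z)\<^sup>2 \<partial>M) \<le> a\<^sup>2 / l + e * (a / l)\<^sup>2"
proof -
  define d where "d j = w j - v j" for j
  define D where "D = L2_set d {..<m}"
  define Chat where "Chat j k = (\<Sum>i<n. \<phi> j (zs i) * \<phi> k (zs i)) / n" for j k
  define C where "C j k = (\<integral>z. \<phi> j z * \<phi> k z \<partial>M)" for j k
  define \<xi> where "\<xi> j = (\<Sum>i<n. \<phi> j (zs i) * (y (zs i) - lin_comb m \<phi> v (zs i)) - l * v j) / n" for j
  have n: "real n \<noteq> 0" "0 < real n" using \<open>0 < n\<close> by auto
  have D: "0 \<le> D" "D\<^sup>2 = (\<Sum>j<m. (d j)\<^sup>2)" by (simp_all add: D_def L2_set_power2)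
  have \<xi>_le: "L2_set \<xi> {..<m} \<le> a"
  proof -
    have "L2_set \<xi> {..<m} = L2_set (\<lambda>j. \<Sum>i<n. \<phi> j (zs i) * (y (zs i) - lin_comb m \<phi> v (zs i)) - l * v j) {..<m} / n"
      unfolding \<xi>_def by (simp add: divide_inverse L2_set_left_distrib)
    also have "\<dots> \<le> n * a / n" by (rule divide_right_mono[OF noise]) simp
    finally show ?thesis using n by simp
  qed
  have "0 \<le> a" using \<xi>_le L2_set_nonneg order.trans by blast
  have \<xi>_eq: "\<xi> j = (\<Sum>k<m. Chat j k * d k) + l * d j" if "j < m" for j
  proof -
    have "(\<Sum>i<n. \<phi> j (zs i) * lin_comb m \<phi> v (zs i)) = (\<Sum>k<m. (\<Sum>i<n. \<phi> j (zs i) * \<phi> k (zs i)) * v k)"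
      unfolding lin_comb_def sum_distrib_left sum_distrib_right
      by (subst sum.swap) (simp add: mult.assoc)
    then have "(\<Sum>i<n. \<phi> j (zs i) * lin_comb m \<phi> v (zs i)) / n = (\<Sum>k<m. Chat j k * v k)"
      by (simp add: Chat_def sum_divide_distrib[of _ "{..<m}"])
    moreover have "\<xi> j = (\<Sum>i<n. \<phi> j (zs i) * y (zs i)) / n
        - (\<Sum>i<n. \<phi> j (zs i) * lin_comb m \<phi> v (zs i)) / n - l * v j"
      unfolding \<xi>_def using n by (simp add: sum_subtractf right_diff_distrib diff_divide_distrib)
    ultimately show ?thesis
      using normal_eq[OF that, folded Chat_def]
      by (simp add: d_def right_diff_distrib sum_subtractf)
  qed
  define T where "T = (\<Sum>j<m. \<Sum>k<m. d j * Chat j k * d k)"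
  \<comment> \<open>Both terms on the right are nonnegative. Dropping \<open>T\<close> bounds
    \<open>D\<close> by \<open>a / l\<close>; dropping the other one bounds \<open>T\<close> by
    \<open>D * a\<close>.\<close>
  have S: "(\<Sum>j<m. d j * \<xi> j) = T + l * D\<^sup>2"
    unfolding D(2) by (simp add: \<xi>_eq T_def distrib_left sum.distrib sum_distrib_left power2_eq_square mult_ac)
  have S_le: "(\<Sum>j<m. d j * \<xi> j) \<le> D * a"
  proof -
    have "(\<Sum>j<m. d j * \<xi> j) \<le> D * L2_set \<xi> {..<m}"
      unfolding D_def using abs_sum_mult_le_L2_set[of d \<xi> "{..<m}"] by linarith
    also have "\<dots> \<le> D * a" by (intro mult_left_mono \<xi>_le D)
    finally show ?thesis .
  qed
  have "T = (\<Sum>i<n. (lin_comb m \<phi> d (zs i))\<^sup>2) / n"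
  proof -
    have "(\<Sum>i<n. (lin_comb m \<phi> d (zs i))\<^sup>2)
        = (\<Sum>i<n. \<Sum>j<m. \<Sum>k<m. d j * (\<phi> j (zs i) * \<phi> k (zs i)) * d k)"
      by (simp add: lin_comb_def power2_eq_square sum_product mult_ac)
    also have "\<dots> = (\<Sum>j<m. \<Sum>k<m. \<Sum>i<n. d j * (\<phi> j (zs i) * \<phi> k (zs i)) * d k)"
      by (rule trans[OF sum.swap sum.cong[OF refl sum.swap]])
    also have "\<dots> = (\<Sum>j<m. \<Sum>k<m. d j * (Chat j k * n) * d k)"
    proof (intro sum.cong refl)
      fix j k
      have "Chat j k * n = (\<Sum>i<n. \<phi> j (zs i) * \<phi> k (zs i))" using n by (simp add: Chat_def)
      then show "(\<Sum>i<n. d j * (\<phi> j (zs i) * \<phi> k (zs i)) * d k) = d j * (Chat j k * n) * d k"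
        by (simp add: sum_distrib_left sum_distrib_right)
    qed
    also have "\<dots> = T * n"
      unfolding T_def sum_distrib_right by (simp add: mult_ac)
    finally show ?thesis using n by simp
  qed
  then have "0 \<le> T" by (simp add: sum_nonneg)
  have "D \<le> a / l"
  proof (cases "D = 0")
    case False
    have "l * D\<^sup>2 \<le> D * a" using S S_le \<open>0 \<le> T\<close> by linarith
    then have "l * D \<le> a" using False D(1) by (simp add: power2_eq_square)
    then show ?thesis using \<open>0 < l\<close> by (simp add: pos_le_divide_eq mult.commute)
  qed (use \<open>0 \<le> a\<close> \<open>0 < l\<close> in simp)
  have "(\<integral>z. (lin_comb m \<phi> d z)\<^sup>2 \<partial>M) = T - (\<Sum>(j, k)\<in>{..<m} \<times> {..<m}. d j * d k * (Chat j k - C j k))"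
    unfolding integral_lin_comb_square[of m \<phi> d, OF \<phi>, simplified] sum.cartesian_product[symmetric] T_def C_def[symmetric]
    by (simp add: sum_subtractf[symmetric] right_diff_distrib mult_ac)
  also have "\<dots> \<le> D * a + D\<^sup>2 * e"
  proof -
    let ?J = "{..<m} \<times> {..<m}"
    have "L2_set (\<lambda>(j, k). Chat j k - C j k) ?J = L2_set (\<lambda>(j, k). \<Sum>i<n. \<phi> j (zs i) * \<phi> k (zs i) - C j k) ?J / n"
      unfolding divide_inverse L2_set_left_distrib[OF less_imp_le[OF positive_imp_inverse_positive[OF n(2)]]]
      by (intro arg_cong[of _ _ "\<lambda>f. L2_set f ?J"])
        (use n in \<open>simp add: fun_eq_iff Chat_def sum_subtractf field_simps\<close>)
    also have "\<dots> \<le> e" using cov n by (simp add: C_def field_simps)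
    finally have E: "L2_set (\<lambda>(j, k). Chat j k - C j k) ?J \<le> e" .
    have "\<bar>\<Sum>(j, k)\<in>?J. d j * d k * (Chat j k - C j k)\<bar>
        \<le> L2_set (\<lambda>(j, k). d j * d k) ?J * L2_set (\<lambda>(j, k). Chat j k - C j k) ?J"
      using abs_sum_mult_le_L2_set[of "\<lambda>(j, k). d j * d k" "\<lambda>(j, k). Chat j k - C j k" ?J]
      by (simp add: case_prod_unfold)
    also have "\<dots> \<le> D\<^sup>2 * e"
      unfolding L2_set_product D_def[symmetric] power2_eq_square[symmetric]
      by (intro mult_left_mono E) simp
    finally have "- (\<Sum>(j, k)\<in>?J. d j * d k * (Chat j k - C j k)) \<le> D\<^sup>2 * e" by linarith
    moreover have "T \<le> D * a"
      using S S_le mult_nonneg_nonneg[OF less_imp_le[OF \<open>0 < l\<close>] zero_le_power2[of D]] by linarith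
    ultimately show ?thesis by linarith
  qed
  also have "\<dots> \<le> a\<^sup>2 / l + e * (a / l)\<^sup>2"
  proof -
    have "0 \<le> n * e" by (rule order.trans[OF L2_set_nonneg cov])
    then have "0 \<le> e" using n by (simp add: zero_le_mult_iff)
    then have "D * a + D\<^sup>2 * e \<le> (a / l) * a + (a / l)\<^sup>2 * e"
      using \<open>D \<le> a / l\<close> \<open>0 \<le> a\<close> D(1) by (intro add_mono mult_right_mono power_mono) auto
    then show ?thesis by (simp add: power2_eq_square mult.commute)
  qed
  finally have "(\<integral>z. (lin_comb m \<phi> d z)\<^sup>2 \<partial>M) \<le> a\<^sup>2 / l + e * (a / l)\<^sup>2" .
  moreover have "d = (\<lambda>j. w j - v j)" by (simp add: d_def fun_eq_iff)
  ultimately show ?thesis by simp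
qed

lemma ae_bounded_coordinate:
  fixes m j :: nat
  assumes "j < m" and "\<phi> j \<in> borel_measurable M" and "AE z in M. (\<Sum>j<m. (\<phi> j z)\<^sup>2) \<le> \<kappa>\<^sup>2"
  shows "ae_bounded M (\<phi> j)"
proof (rule ae_boundedI[OF assms(2)])
  show "AE z in M. \<bar>\<phi> j z\<bar> \<le> \<bar>\<kappa>\<bar>"
    using assms(3)
  proof eventually_elim
    case (elim z)
    have "(\<phi> j z)\<^sup>2 \<le> (\<Sum>j<m. (\<phi> j z)\<^sup>2)"
      by (rule member_le_sum) (use \<open>j < m\<close> in auto)
    with elim have "(\<phi> j z)\<^sup>2 \<le> \<kappa>\<^sup>2" by linarith
    then show ?case by (simp add: abs_le_square_iff)
  qed
qed

text \<open>The Hilbert-Schmidt norm of a rank-one matrix is the squared norm of its vector, hence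
  at most \<kappa>^2. Its mean obeys the same bound by Jensen's inequality, and the triangle
  inequality doubles it.\<close>

lemma covariance_deviation_le:
  fixes m :: nat
  assumes \<phi>: "\<And>j. j < m \<Longrightarrow> \<phi> j \<in> borel_measurable M"
    and bd: "AE z in M. (\<Sum>j<m. (\<phi> j z)\<^sup>2) \<le> \<kappa>\<^sup>2"
  shows "AE z in M. L2_set (\<lambda>(j, k). \<phi> j z * \<phi> k z - (\<integral>z. \<phi> j z * \<phi> k z \<partial>M)) ({..<m} \<times> {..<m}) \<le> 2 * \<kappa>\<^sup>2"
proof -
  let ?J = "{..<m} \<times> {..<m}"
  have ae: "ae_bounded M (\<phi> j)" if "j < m" for j
    by (rule ae_bounded_coordinate[of j m \<phi>, OF that \<phi>[OF that] bd])
  define C where "C j k = (\<integral>z. \<phi> j z * \<phi> k z \<partial>M)" for j k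
  \<comment> \<open>Jensen's inequality for the square, as Cauchy-Schwarz against the constant
    1.\<close>
  have "(\<Sum>j<m. \<Sum>k<m. (C j k)\<^sup>2) \<le> (\<Sum>j<m. \<Sum>k<m. (\<integral>z. (\<phi> j z * \<phi> k z)\<^sup>2 \<partial>M))"
    using integral_Cauchy_Schwarz[OF ae_bounded_mult[OF ae ae] ae_bounded_const[of M 1]]
    by (intro sum_mono) (simp add: C_def prob_space)
  also have "\<dots> = (\<integral>z. (\<Sum>j<m. \<Sum>k<m. (\<phi> j z * \<phi> k z)\<^sup>2) \<partial>M)"
  proof -
    have "(\<integral>z. (\<Sum>j<m. \<Sum>k<m. (\<phi> j z * \<phi> k z)\<^sup>2) \<partial>M) = (\<Sum>j<m. (\<integral>z. (\<Sum>k<m. (\<phi> j z * \<phi> k z)\<^sup>2) \<partial>M))"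
      by (intro Bochner_Integration.integral_sum integrable_ae_bounded ae_bounded_sum ae_bounded_power
          ae_bounded_mult ae) auto
    also have "\<dots> = (\<Sum>j<m. \<Sum>k<m. (\<integral>z. (\<phi> j z * \<phi> k z)\<^sup>2 \<partial>M))"
      by (intro sum.cong refl Bochner_Integration.integral_sum integrable_ae_bounded ae_bounded_power
          ae_bounded_mult ae) auto
    finally show ?thesis by simp
  qed
  also have "\<dots> \<le> (\<kappa>\<^sup>2)\<^sup>2"
  proof (rule integral_le_ae_bound)
    show "ae_bounded M (\<lambda>z. \<Sum>j<m. \<Sum>k<m. (\<phi> j z * \<phi> k z)\<^sup>2)"
      by (intro ae_bounded_sum ae_bounded_power ae_bounded_mult ae) auto
    show "AE z in M. (\<Sum>j<m. \<Sum>k<m. (\<phi> j z * \<phi> k z)\<^sup>2) \<le> (\<kappa>\<^sup>2)\<^sup>2"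
      using bd
    proof eventually_elim
      case (elim z)
      have "(\<Sum>j<m. \<Sum>k<m. (\<phi> j z * \<phi> k z)\<^sup>2) = (\<Sum>j<m. (\<phi> j z)\<^sup>2)\<^sup>2"
        unfolding power_mult_distrib sum_product[symmetric] by (rule power2_eq_square[symmetric])
      also have "\<dots> \<le> (\<kappa>\<^sup>2)\<^sup>2" using elim by (intro power_mono) (simp_all add: sum_nonneg)
      finally show ?case .
    qed
  qed
  finally have "sqrt (\<Sum>j<m. \<Sum>k<m. (C j k)\<^sup>2) \<le> sqrt ((\<kappa>\<^sup>2)\<^sup>2)" by (rule real_sqrt_le_mono)
  also have "\<dots> = \<kappa>\<^sup>2" unfolding real_sqrt_abs by simp
  finally have "sqrt (\<Sum>j<m. \<Sum>k<m. (C j k)\<^sup>2) \<le> \<kappa>\<^sup>2" .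
  then have C: "L2_set (\<lambda>(j, k). - C j k) ?J \<le> \<kappa>\<^sup>2"
    by (simp add: L2_set_def sum.cartesian_product case_prod_unfold)
  show ?thesis
    using bd
  proof eventually_elim
    case (elim z)
    have "L2_set (\<lambda>j. \<phi> j z) {..<m} \<le> \<bar>\<kappa>\<bar>"
      using real_sqrt_le_mono[OF elim] by (simp add: L2_set_def)
    then have "L2_set (\<lambda>(j, k). \<phi> j z * \<phi> k z) ?J \<le> \<kappa>\<^sup>2"
      unfolding L2_set_product using mult_mono[of "L2_set (\<lambda>j. \<phi> j z) {..<m}" "\<bar>\<kappa>\<bar>"
          "L2_set (\<lambda>j. \<phi> j z) {..<m}" "\<bar>\<kappa>\<bar>"]
      by (simp add: power2_eq_square)
    moreover have "L2_set (\<lambda>(j, k). \<phi> j z * \<phi> k z - C j k) ?J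
        \<le> L2_set (\<lambda>(j, k). \<phi> j z * \<phi> k z) ?J + L2_set (\<lambda>(j, k). - C j k) ?J"
      using L2_set_triangle_ineq[of "\<lambda>(j, k). \<phi> j z * \<phi> k z" "\<lambda>(j, k). - C j k" ?J]
      by (simp add: case_prod_unfold)
    ultimately show ?case using C by (simp add: C_def)
  qed
qed

text \<open>Source of the constant \<open>L\<close> below: feature norm times prediction error, plus
  the shift \<open>l * v\<close>, which in the application is the mean of the first term by the
  population equations.\<close>

lemma noise_le:
  fixes m :: nat
  assumes bd: "AE z in M. (\<Sum>j<m. (\<phi> j z)\<^sup>2) \<le> \<kappa>\<^sup>2" and y: "AE z in M. \<bar>y z\<bar> \<le> b"
    and "0 \<le> \<kappa>" "0 \<le> l" "l \<le> 1" and v: "L2_set v {..<m} \<le> r"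
  shows "AE z in M. L2_set (\<lambda>j. \<phi> j z * (y z - lin_comb m \<phi> v z) - l * v j) {..<m} \<le> \<kappa> * (b + \<kappa> * r) + r"
  using bd y
proof eventually_elim
  case (elim z)
  have r: "0 \<le> r" by (rule order.trans[OF L2_set_nonneg v])
  have \<phi>: "L2_set (\<lambda>j. \<phi> j z) {..<m} \<le> \<kappa>"
    using real_sqrt_le_mono[OF elim(1)] \<open>0 \<le> \<kappa>\<close> by (simp add: L2_set_def)
  have "\<bar>lin_comb m \<phi> v z\<bar> \<le> \<kappa> * r"
    by (rule order.trans[OF abs_lin_comb_le[of m \<phi> v z] mult_mono[OF \<phi> v]]) (use \<open>0 \<le> \<kappa>\<close> in auto)
  then have c: "\<bar>y z - lin_comb m \<phi> v z\<bar> \<le> b + \<kappa> * r" using elim(2) by linarith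
  have "L2_set (\<lambda>j. \<phi> j z * (y z - lin_comb m \<phi> v z)) {..<m} = L2_set (\<lambda>j. \<phi> j z) {..<m} * \<bar>y z - lin_comb m \<phi> v z\<bar>"
    by (simp add: L2_set_def power_mult_distrib sum_distrib_right[symmetric] real_sqrt_mult)
  also have "\<dots> \<le> \<kappa> * (b + \<kappa> * r)"
    using \<open>0 \<le> \<kappa>\<close> by (intro mult_mono \<phi> c) auto
  finally have 1: "L2_set (\<lambda>j. \<phi> j z * (y z - lin_comb m \<phi> v z)) {..<m} \<le> \<kappa> * (b + \<kappa> * r)" .
  have "L2_set (\<lambda>j. - (l * v j)) {..<m} = l * L2_set v {..<m}"
    using \<open>0 \<le> l\<close> by (simp add: L2_set_def power_mult_distrib sum_distrib_left[symmetric] real_sqrt_mult)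
  also have "\<dots> \<le> 1 * r" using assms(4,5) v by (intro mult_mono) auto
  finally have 2: "L2_set (\<lambda>j. - (l * v j)) {..<m} \<le> r" by simp
  have "L2_set (\<lambda>j. \<phi> j z * (y z - lin_comb m \<phi> v z) - l * v j) {..<m}
      \<le> L2_set (\<lambda>j. \<phi> j z * (y z - lin_comb m \<phi> v z)) {..<m} + L2_set (\<lambda>j. - (l * v j)) {..<m}"
    using L2_set_triangle_ineq[of "\<lambda>j. \<phi> j z * (y z - lin_comb m \<phi> v z)" "\<lambda>j. - (l * v j)" "{..<m}"] by simp
  with 1 2 show ?case by linarith
qed

text \<open>The choice of \<open>l\<close> makes a / l free of n, while a^2 / l and \<open>e\<close>
  are both of order n^(-1/2). The exponents 1 and 3/2 of \<open>p\<close> are rounded up to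
  2.\<close>

lemma ridge_rate_algebra:
  fixes n :: nat and L p \<kappa> :: real
  assumes "0 < n" and "1 \<le> p"
  defines "l \<equiv> 1 / sqrt n" and "a \<equiv> L * sqrt (2 * p / n)" and "e \<equiv> 2 * \<kappa>\<^sup>2 * sqrt (2 * p / n)"
  shows "a\<^sup>2 / l + e * (a / l)\<^sup>2 \<le> (2 * L\<^sup>2 + 4 * sqrt 2 * \<kappa>\<^sup>2 * L\<^sup>2) * p\<^sup>2 / sqrt n"
proof -
  define s where "s = sqrt (real n)"
  have s: "0 < s" "real n = s\<^sup>2" using \<open>0 < n\<close> by (auto simp: s_def)
  have sq: "sqrt (2 * p / n) = sqrt 2 * sqrt p / s"
    by (simp add: real_sqrt_mult real_sqrt_divide s_def)
  have p: "0 < p" "(sqrt p)\<^sup>2 = p" using assms by auto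
  have a2: "a\<^sup>2 = 2 * L\<^sup>2 * p / s\<^sup>2" unfolding a_def sq by (simp add: power_mult_distrib power_divide p)
  have al: "(a / l)\<^sup>2 = 2 * L\<^sup>2 * p"
    using s unfolding power_divide a2 l_def s_def[symmetric] by (simp add: power_divide)
  have "a\<^sup>2 / l = 2 * L\<^sup>2 * p / s"
    using s unfolding a2 l_def s_def[symmetric] by (simp add: power2_eq_square)
  moreover have "e * (a / l)\<^sup>2 = 4 * sqrt 2 * \<kappa>\<^sup>2 * L\<^sup>2 * (sqrt p * p) / s"
    unfolding al e_def sq by (simp add: mult_ac)
  ultimately have "a\<^sup>2 / l + e * (a / l)\<^sup>2 = (2 * L\<^sup>2 * p + 4 * sqrt 2 * \<kappa>\<^sup>2 * L\<^sup>2 * (sqrt p * p)) / s"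
    by (simp add: add_divide_distrib)
  also have "\<dots> \<le> (2 * L\<^sup>2 * p\<^sup>2 + 4 * sqrt 2 * \<kappa>\<^sup>2 * L\<^sup>2 * p\<^sup>2) / s"
  proof (intro divide_right_mono add_mono mult_left_mono)
    show "p \<le> p\<^sup>2" using assms(2) by (simp add: power2_eq_square)
    have "sqrt p \<le> p" using assms(2) real_le_lsqrt[of p p] by (simp add: power2_eq_square)
    then show "sqrt p * p \<le> p\<^sup>2" using p by (simp add: power2_eq_square)
  qed (use s in auto)
  finally show ?thesis by (simp add: s_def distrib_right)
qed

text \<open>By \<open>qy\<close> the features cannot distinguish the target \<open>q\<close> from
  the outputs \<open>y\<close>, so the population weights for \<open>q\<close> also centre the noise
  formed with \<open>y\<close>. The comparison weights \<open>w0\<close> bound both the error and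
  the norm of the population weights through minimality.\<close>

lemma ridge_excess_risk:
  fixes n m :: nat and y q :: "'a \<Rightarrow> real"
  assumes \<phi>: "\<And>j. j < m \<Longrightarrow> \<phi> j \<in> borel_measurable M"
    and bd: "AE z in M. (\<Sum>j<m. (\<phi> j z)\<^sup>2) \<le> \<kappa>\<^sup>2" and "1 \<le> \<kappa>"
    and y: "y \<in> borel_measurable M" and yb: "AE z in M. \<bar>y z\<bar> \<le> b" and "0 < b"
    and q: "ae_bounded M q" and qy: "\<And>j. j < m \<Longrightarrow> (\<integral>z. \<phi> j z * q z \<partial>M) = (\<integral>z. \<phi> j z * y z \<partial>M)"
    and "0 < n" and l: "l = 1 / sqrt n" and "0 \<le> R" and "1 \<le> p"
    and w0: "(\<integral>z. (lin_comb m \<phi> w0 z - q z)\<^sup>2 \<partial>M) + l * (\<Sum>j<m. (w0 j)\<^sup>2) \<le> l * R"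
  defines "P \<equiv> PiM {..<n} (\<lambda>_. M)" and "L \<equiv> \<kappa> * (b + \<kappa> * sqrt R) + sqrt R"
  obtains N where "N \<in> sets P" "emeasure P N \<le> ennreal (4 * exp (- p))"
    "\<And>zs w. zs \<in> space P - N \<Longrightarrow>
      \<forall>j<m. (\<Sum>k<m. (\<Sum>i<n. \<phi> j (zs i) * \<phi> k (zs i)) / n * w k) + l * w j
        = (\<Sum>i<n. \<phi> j (zs i) * y (zs i)) / n \<Longrightarrow>
      (\<integral>z. (lin_comb m \<phi> w z - q z)\<^sup>2 \<partial>M) \<le> (4 * L\<^sup>2 + 8 * sqrt 2 * \<kappa>\<^sup>2 * L\<^sup>2 + 2 * R) * p\<^sup>2 / sqrt n"
proof -
  let ?J = "{..<m} \<times> {..<m}"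
  have l': "0 < l" "l \<le> 1" using \<open>0 < n\<close> by (simp_all add: l)
  have n: "0 < real n" using \<open>0 < n\<close> by simp
  have ae\<phi>: "ae_bounded M (\<phi> j)" if "j < m" for j
    by (rule ae_bounded_coordinate[of j m \<phi>, OF that \<phi>[OF that] bd])
  have aey: "ae_bounded M y" by (rule ae_boundedI[OF y yb])
  obtain v where v: "\<And>j. j < m \<Longrightarrow> (\<integral>z. \<phi> j z * (q z - lin_comb m \<phi> v z) \<partial>M) = l * v j"
    and vmin: "\<And>u. (\<integral>z. (lin_comb m \<phi> v z - q z)\<^sup>2 \<partial>M) + l * (\<Sum>j<m. (v j)\<^sup>2)
      \<le> (\<integral>z. (lin_comb m \<phi> u z - q z)\<^sup>2 \<partial>M) + l * (\<Sum>j<m. (u j)\<^sup>2)"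
    by (rule population_ridge[OF ae\<phi> q l'(1)]) (assumption, rule that)
  have aev: "ae_bounded M (lin_comb m \<phi> v)" by (rule ae_bounded_lin_comb[OF ae\<phi>])
  have v_le: "(\<integral>z. (lin_comb m \<phi> v z - q z)\<^sup>2 \<partial>M) + l * (\<Sum>j<m. (v j)\<^sup>2) \<le> l * R"
    by (rule order.trans[OF vmin w0])
  have vq: "(\<integral>z. (lin_comb m \<phi> v z - q z)\<^sup>2 \<partial>M) \<le> l * R"
    using v_le mult_nonneg_nonneg[OF less_imp_le[OF l'(1)], of "\<Sum>j<m. (v j)\<^sup>2"] by (simp add: sum_nonneg)
  have "l * (\<Sum>j<m. (v j)\<^sup>2) \<le> l * R"
  proof -
    have "0 \<le> (\<integral>z. (lin_comb m \<phi> v z - q z)\<^sup>2 \<partial>M)" by simp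
    with v_le show ?thesis by linarith
  qed
  then have v_norm: "L2_set v {..<m} \<le> sqrt R" using l'(1) by (simp add: L2_set_def)
  have "0 < L" unfolding L_def using \<open>1 \<le> \<kappa>\<close> \<open>0 < b\<close> \<open>0 \<le> R\<close> by (intro add_pos_nonneg mult_pos_pos) auto
  define X where "X j z = \<phi> j z * (y z - lin_comb m \<phi> v z) - l * v j" for j z
  define Y where "Y = (\<lambda>(j, k) z. \<phi> j z * \<phi> k z - (\<integral>z. \<phi> j z * \<phi> k z \<partial>M))"
  have aeX: "ae_bounded M (X j)" if "j < m" for j
    unfolding X_def by (intro ae_bounded_intros ae\<phi> that aey aev)
  have aeY: "ae_bounded M (Y p)" if "p \<in> ?J" for p
    using that unfolding Y_def by (auto intro!: ae_bounded_diff ae_bounded_mult ae_bounded_const ae\<phi>)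
  \<comment> \<open>This is the exchange of \<open>q\<close> for \<open>y\<close> in the
    stationarity equation.\<close>
  have X0: "(\<integral>z. X j z \<partial>M) = 0" if j: "j < m" for j
  proof -
    have int: "integrable M (\<lambda>z. \<phi> j z * y z)" "integrable M (\<lambda>z. \<phi> j z * q z)"
        "integrable M (\<lambda>z. \<phi> j z * lin_comb m \<phi> v z)"
      by (intro integrable_ae_bounded ae_bounded_mult ae\<phi> j aey aev q)+
    have "(\<integral>z. \<phi> j z * (q z - lin_comb m \<phi> v z) \<partial>M) = (\<integral>z. \<phi> j z * (y z - lin_comb m \<phi> v z) \<partial>M)"
      using int qy[OF j] by (simp add: right_diff_distrib)
    moreover have "integrable M (\<lambda>z. \<phi> j z * (y z - lin_comb m \<phi> v z))"
      by (intro integrable_ae_bounded ae_bounded_intros ae\<phi> j aey aev)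
    ultimately show ?thesis using v[OF j] by (simp add: X_def prob_space)
  qed
  have Y0: "(\<integral>z. Y p z \<partial>M) = 0" if "p \<in> ?J" for p
    using that by (auto simp: Y_def prob_space integrable_ae_bounded ae_bounded_mult ae\<phi>)
  \<comment> \<open>Scaled so that the thresholds \<open>L * u\<close> and
    \<open>2 * \<kappa>\<^sup>2 * u\<close>, each \<open>u\<close> times the almost sure bound of
    its terms, both give the exponent \<open>- p\<close>.\<close>
  define u where "u = sqrt (2 * n * p)"
  have u: "0 < u" "u\<^sup>2 = 2 * n * p" "n * sqrt (2 * p / n) = u"
  proof -
    show "0 < u" "u\<^sup>2 = 2 * n * p" using n \<open>1 \<le> p\<close> by (simp_all add: u_def)
    have "n * sqrt (2 * p / n) = sqrt (n\<^sup>2 * (2 * p / n))" unfolding real_sqrt_mult[of "n\<^sup>2"] by simp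
    also have "n\<^sup>2 * (2 * p / n) = 2 * n * p" using n by (simp add: power2_eq_square)
    finally show "n * sqrt (2 * p / n) = u" by (simp add: u_def)
  qed
  define N1 where "N1 = {zs \<in> space P. L * u \<le> L2_set (\<lambda>j. \<Sum>i<n. X j (zs i)) {..<m}}"
  define N2 where "N2 = {zs \<in> space P. 2 * \<kappa>\<^sup>2 * u \<le> L2_set (\<lambda>p. \<Sum>i<n. Y p (zs i)) ?J}"
  have meas_sum: "(\<lambda>zs. \<Sum>i<n. f (zs i)) \<in> borel_measurable P" if "f \<in> borel_measurable M" for f :: "'a \<Rightarrow> real"
  proof -
    note [measurable] = that
    show ?thesis unfolding P_def by measurable
  qed
  have [measurable]: "(\<lambda>zs. L2_set (\<lambda>j. \<Sum>i<n. X j (zs i)) {..<m}) \<in> borel_measurable P"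
      "(\<lambda>zs. L2_set (\<lambda>p. \<Sum>i<n. Y p (zs i)) ?J) \<in> borel_measurable P"
    by (intro borel_measurable_L2_set meas_sum ae_bounded_measurable aeX aeY; simp)+
  have N12: "N1 \<in> sets P" "N2 \<in> sets P" unfolding N1_def N2_def by measurable
  have "emeasure P N1 \<le> ennreal (2 * exp (- (L * u)\<^sup>2 / (2 * n * L\<^sup>2)))"
    unfolding N1_def P_def
  proof (rule emeasure_PiM_L2_set_sum_ge[OF prob_space_axioms _ \<open>0 < L\<close> \<open>0 < n\<close>])
    show "AE z in M. L2_set (\<lambda>j. X j z) {..<m} \<le> L"
      unfolding X_def L_def using \<open>1 \<le> \<kappa>\<close> l' by (intro noise_le bd yb v_norm) auto
  qed (use u \<open>0 < L\<close> X0 ae_bounded_measurable[OF aeX] in auto)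
  also have "- (L * u)\<^sup>2 / (2 * n * L\<^sup>2) = - p"
    using \<open>0 < L\<close> n by (simp add: power_mult_distrib u(2))
  finally have e1: "emeasure P N1 \<le> ennreal (2 * exp (- p))" .
  have k: "0 < 2 * \<kappa>\<^sup>2" using \<open>1 \<le> \<kappa>\<close> by simp
  have "emeasure P N2 \<le> ennreal (2 * exp (- (2 * \<kappa>\<^sup>2 * u)\<^sup>2 / (2 * n * (2 * \<kappa>\<^sup>2)\<^sup>2)))"
    unfolding N2_def P_def
  proof (rule emeasure_PiM_L2_set_sum_ge[OF prob_space_axioms _ k \<open>0 < n\<close>])
    show "AE z in M. L2_set (\<lambda>p. Y p z) ?J \<le> 2 * \<kappa>\<^sup>2"
      using covariance_deviation_le[OF \<phi> bd] unfolding Y_def by (simp add: case_prod_unfold)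
  qed (use u k Y0 ae_bounded_measurable[OF aeY] in auto)
  also have "- (2 * \<kappa>\<^sup>2 * u)\<^sup>2 / (2 * n * (2 * \<kappa>\<^sup>2)\<^sup>2) = - p"
    using k n by (simp add: power_mult_distrib u(2))
  finally have e2: "emeasure P N2 \<le> ennreal (2 * exp (- p))" .
  show thesis
  proof (rule that[of "N1 \<union> N2"])
    show "N1 \<union> N2 \<in> sets P" using N12 by blast
    have "emeasure P (N1 \<union> N2) \<le> emeasure P N1 + emeasure P N2"
      by (rule emeasure_subadditive[OF N12])
    also have "\<dots> \<le> ennreal (2 * exp (- p)) + ennreal (2 * exp (- p))" by (rule add_mono[OF e1 e2])
    also have "\<dots> = ennreal (4 * exp (- p))" by (simp add: ennreal_plus[symmetric] del: ennreal_plus)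
    finally show "emeasure P (N1 \<union> N2) \<le> ennreal (4 * exp (- p))" .
  next
    fix zs w assume zs: "zs \<in> space P - (N1 \<union> N2)"
      and w: "\<forall>j<m. (\<Sum>k<m. (\<Sum>i<n. \<phi> j (zs i) * \<phi> k (zs i)) / n * w k) + l * w j
        = (\<Sum>i<n. \<phi> j (zs i) * y (zs i)) / n"
    have "(\<integral>z. (lin_comb m \<phi> (\<lambda>j. w j - v j) z)\<^sup>2 \<partial>M)
        \<le> (L * sqrt (2 * p / n))\<^sup>2 / l + (2 * \<kappa>\<^sup>2 * sqrt (2 * p / n)) * (L * sqrt (2 * p / n) / l)\<^sup>2"
    proof (rule empirical_ridge_error[OF ae\<phi> \<open>0 < n\<close> l'(1) w[rule_format]])
      have E: "n * (L * sqrt (2 * p / n)) = L * u" "n * (2 * \<kappa>\<^sup>2 * sqrt (2 * p / n)) = 2 * \<kappa>\<^sup>2 * u"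
        unfolding u(3)[symmetric] by simp_all
      show "L2_set (\<lambda>j. \<Sum>i<n. \<phi> j (zs i) * (y (zs i) - lin_comb m \<phi> v (zs i)) - l * v j) {..<m}
          \<le> n * (L * sqrt (2 * p / n))"
        unfolding E using zs by (auto simp: N1_def X_def)
      show "L2_set (\<lambda>(j, k). \<Sum>i<n. \<phi> j (zs i) * \<phi> k (zs i) - (\<integral>z. \<phi> j z * \<phi> k z \<partial>M)) ?J
          \<le> n * (2 * \<kappa>\<^sup>2 * sqrt (2 * p / n))"
        unfolding E using zs by (auto simp: N2_def Y_def case_prod_unfold)
    qed
    also have "\<dots> \<le> (2 * L\<^sup>2 + 4 * sqrt 2 * \<kappa>\<^sup>2 * L\<^sup>2) * p\<^sup>2 / sqrt n"
      unfolding l by (rule ridge_rate_algebra[OF \<open>0 < n\<close> \<open>1 \<le> p\<close>])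
    finally have F: "(\<integral>z. (lin_comb m \<phi> (\<lambda>j. w j - v j) z)\<^sup>2 \<partial>M)
        \<le> (2 * L\<^sup>2 + 4 * sqrt 2 * \<kappa>\<^sup>2 * L\<^sup>2) * p\<^sup>2 / sqrt n" .
    have vq': "(\<integral>z. (lin_comb m \<phi> v z - q z)\<^sup>2 \<partial>M) \<le> R * p\<^sup>2 / sqrt n"
    proof -
      have "l * R \<le> R * p\<^sup>2 / sqrt n"
        unfolding l using \<open>0 \<le> R\<close> \<open>1 \<le> p\<close> mult_left_mono[of 1 "p\<^sup>2" R]
        by (simp add: divide_right_mono one_le_power)
      with vq show ?thesis by linarith
    qed
    have "(\<integral>z. (lin_comb m \<phi> w z - q z)\<^sup>2 \<partial>M)
        \<le> (\<integral>z. 2 * (lin_comb m \<phi> (\<lambda>j. w j - v j) z)\<^sup>2 + 2 * (lin_comb m \<phi> v z - q z)\<^sup>2 \<partial>M)"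
    proof (intro integral_mono integrable_ae_bounded ae_bounded_intros ae_bounded_lin_comb ae\<phi> q)
      fix z
      show "(lin_comb m \<phi> w z - q z)\<^sup>2 \<le> 2 * (lin_comb m \<phi> (\<lambda>j. w j - v j) z)\<^sup>2 + 2 * (lin_comb m \<phi> v z - q z)\<^sup>2"
        using zero_le_power2[of "lin_comb m \<phi> w z - lin_comb m \<phi> v z - (lin_comb m \<phi> v z - q z)"]
        unfolding lin_comb_diff by (simp add: power2_eq_square algebra_simps)
    qed auto
    also have "\<dots> = 2 * (\<integral>z. (lin_comb m \<phi> (\<lambda>j. w j - v j) z)\<^sup>2 \<partial>M) + 2 * (\<integral>z. (lin_comb m \<phi> v z - q z)\<^sup>2 \<partial>M)"
    proof -
      have "integrable M (\<lambda>z. (lin_comb m \<phi> (\<lambda>j. w j - v j) z)\<^sup>2)" "integrable M (\<lambda>z. (lin_comb m \<phi> v z - q z)\<^sup>2)"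
        by (intro integrable_ae_bounded ae_bounded_power ae_bounded_diff ae_bounded_lin_comb ae\<phi> q; assumption)+
      then show ?thesis by simp
    qed
    also have "\<dots> \<le> 2 * ((2 * L\<^sup>2 + 4 * sqrt 2 * \<kappa>\<^sup>2 * L\<^sup>2) * p\<^sup>2 / sqrt n) + 2 * (R * p\<^sup>2 / sqrt n)"
      using F vq' by linarith
    also have "\<dots> = (4 * L\<^sup>2 + 8 * sqrt 2 * \<kappa>\<^sup>2 * L\<^sup>2 + 2 * R) * p\<^sup>2 / sqrt n"
      by (simp add: add_divide_distrib[symmetric] distrib_right)
    finally show "(\<integral>z. (lin_comb m \<phi> w z - q z)\<^sup>2 \<partial>M)
        \<le> (4 * L\<^sup>2 + 8 * sqrt 2 * \<kappa>\<^sup>2 * L\<^sup>2 + 2 * R) * p\<^sup>2 / sqrt n" .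
  qed
qed

end

section \<open>Random features\<close>

locale random_features =
  fixes \<psi> :: "'x::{metric_space, second_countable_topology} \<Rightarrow> 'w::topological_space \<Rightarrow> real"
    and \<pi> :: "'w measure" and K :: "'x \<Rightarrow> 'x \<Rightarrow> real" and H :: "('x \<Rightarrow> real) set"
    and ip :: "('x \<Rightarrow> real) \<Rightarrow> ('x \<Rightarrow> real) \<Rightarrow> real" and \<kappa> b :: real
    and \<rho> :: "('x \<times> real) measure" and f\<^sub>H :: "'x \<Rightarrow> real"
  assumes prob_\<pi>: "prob_space \<pi>" and sets_\<pi>: "sets \<pi> = sets borel"
    and continuous: "continuous_on UNIV (\<lambda>(x, \<omega>). \<psi> x \<omega>)"
    and integrable_\<psi>: "\<And>x x'. integrable \<pi> (\<lambda>\<omega>. \<psi> x \<omega> * \<psi> x' \<omega>)"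
    and kernel: "\<And>x x'. K x x' = (\<integral>\<omega>. \<psi> x \<omega> * \<psi> x' \<omega> \<partial>\<pi>)"
    and rkhs: "rkhs K H ip"
    and \<kappa>: "1 \<le> \<kappa>" and b: "0 < b"
    and prob_\<rho>: "prob_space \<rho>" and sets_\<rho>: "sets \<rho> = sets borel"
    and \<psi>_bound: "AE (x, \<omega>) in distr \<rho> borel fst \<Otimes>\<^sub>M \<pi>. \<bar>\<psi> x \<omega>\<bar> \<le> \<kappa>"
    and y_bound: "AE (x, y) in \<rho>. \<bar>y\<bar> \<le> b"
    and minimizer: "is_arg_min (expected_risk \<rho>) (\<lambda>f. f \<in> H) f\<^sub>H"
begin

section \<open>Measurability and bounds of features and of members of H\<close>

sublocale pi: prob_space \<pi> by (rule prob_\<pi>)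
sublocale rho: prob_space \<rho> by (rule prob_\<rho>)
sublocale rkhs K H ip by (rule rkhs)
sublocale rp: pair_sigma_finite \<rho> \<pi> ..
sublocale pr: pair_sigma_finite \<pi> \<rho> ..

lemma measurable_fst_\<rho>[measurable]: "fst \<in> \<rho> \<rightarrow>\<^sub>M borel"
proof -
  have "fst \<in> (borel :: ('x \<times> real) measure) \<rightarrow>\<^sub>M borel"
    unfolding borel_prod[symmetric] by simp
  then show ?thesis by (simp only: measurable_cong_sets[OF sets_\<rho> refl])
qed

lemma measurable_snd_\<rho>[measurable]: "snd \<in> borel_measurable \<rho>"
proof -
  have "snd \<in> (borel :: ('x \<times> real) measure) \<rightarrow>\<^sub>M borel"
    unfolding borel_prod[symmetric] by simp
  then show ?thesis by (simp only: measurable_cong_sets[OF sets_\<rho> refl])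
qed

lemma measurable_\<psi>:
  assumes f: "f \<in> N \<rightarrow>\<^sub>M borel" and g: "g \<in> N \<rightarrow>\<^sub>M \<pi>"
  shows "(\<lambda>p. \<psi> (f p) (g p)) \<in> borel_measurable N"
proof -
  have "g \<in> N \<rightarrow>\<^sub>M borel" using g by (simp only: measurable_cong_sets[OF refl sets_\<pi>])
  then have "(\<lambda>p. (f p, g p)) \<in> N \<rightarrow>\<^sub>M borel \<Otimes>\<^sub>M borel" by (rule measurable_Pair[OF f])
  from measurable_compose[OF this measurable_continuous_pair[OF continuous]]
  show ?thesis by simp
qed

lemma measurable_\<psi>_fst[measurable]:
  "f \<in> N \<rightarrow>\<^sub>M \<rho> \<Longrightarrow> g \<in> N \<rightarrow>\<^sub>M \<pi> \<Longrightarrow> (\<lambda>p. \<psi> (fst (f p)) (g p)) \<in> borel_measurable N"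
  by (rule measurable_\<psi>[OF measurable_compose[OF _ measurable_fst_\<rho>]])

lemma measurable_\<psi>_const[measurable]: "\<psi> x \<in> borel_measurable \<pi>"
  using measurable_\<psi>[of "\<lambda>_. x" \<pi> "\<lambda>\<omega>. \<omega>"] by simp

text \<open>The bound is needed in both orders of the quantifiers: with the data point fixed for
  averaging over parameters, and in \<open>AE_\<pi>_\<rho>\<close> with the parameter fixed for
  integrating over data.\<close>

lemma AE_\<rho>_\<pi>: "AE z in \<rho>. AE \<omega> in \<pi>. \<bar>\<psi> (fst z) \<omega>\<bar> \<le> \<kappa>"
proof -
  interpret D: prob_space "distr \<rho> borel fst" by (rule rho.prob_space_distr) measurable
  interpret Dp: pair_sigma_finite "distr \<rho> borel fst" \<pi> ..
  have "AE x in distr \<rho> borel fst. AE \<omega> in \<pi>. case (x, \<omega>) of (x, \<omega>) \<Rightarrow> \<bar>\<psi> x \<omega>\<bar> \<le> \<kappa>"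
    by (rule Dp.AE_pair[OF \<psi>_bound])
  then show ?thesis
    using AE_distrD[OF measurable_fst_\<rho>, of "\<lambda>x. AE \<omega> in \<pi>. \<bar>\<psi> x \<omega>\<bar> \<le> \<kappa>"] by simp
qed

lemma AE_\<pi>_\<rho>: "AE \<omega> in \<pi>. AE z in \<rho>. \<bar>\<psi> (fst z) \<omega>\<bar> \<le> \<kappa>"
proof -
  have "{p \<in> space (\<rho> \<Otimes>\<^sub>M \<pi>). \<bar>\<psi> (fst (fst p)) (snd p)\<bar> \<le> \<kappa>} \<in> sets (\<rho> \<Otimes>\<^sub>M \<pi>)"
    by measurable
  from rp.AE_commute[OF this] show ?thesis using AE_\<rho>_\<pi> by simp
qed

lemma ae_bounded_snd: "ae_bounded \<rho> snd"
  using y_bound by (intro ae_boundedI[of _ _ b]) (auto simp: case_prod_unfold)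

lemma ae_bounded_\<psi>:
  assumes "AE z in \<rho>. \<bar>\<psi> (fst z) \<omega>\<bar> \<le> \<kappa>" and "\<omega> \<in> space \<pi>"
  shows "ae_bounded \<rho> (\<lambda>z. \<psi> (fst z) \<omega>)"
  using assms(1) by (rule ae_boundedI[rotated]) (use assms(2) in measurable)

lemma space_\<pi>: "space \<pi> = UNIV"
  using sets_eq_imp_space_eq[OF sets_\<pi>] by simp

lemma kernel_measurable: "K x \<in> borel_measurable borel"
proof -
  have "(\<lambda>(x', \<omega>). \<psi> x \<omega> * \<psi> x' \<omega>) \<in> borel_measurable (borel \<Otimes>\<^sub>M \<pi>)"
    unfolding case_prod_unfold by (intro borel_measurable_times measurable_\<psi>) auto
  from pi.borel_measurable_lebesgue_integral[OF this] show ?thesis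
    by (simp only: kernel[abs_def])
qed

lemma mem_measurable: "f \<in> H \<Longrightarrow> f \<in> borel_measurable borel"
  by (rule measurable_mem[OF kernel_measurable])

lemma AE_kernel_diag_le: "AE z in \<rho>. K (fst z) (fst z) \<le> \<kappa>\<^sup>2"
  using AE_\<rho>_\<pi>
proof eventually_elim
  case (elim z)
  have bd: "AE \<omega> in \<pi>. \<psi> (fst z) \<omega> * \<psi> (fst z) \<omega> \<le> \<kappa>\<^sup>2"
    using elim
  proof eventually_elim
    case (elim \<omega>)
    then have "\<bar>\<psi> (fst z) \<omega>\<bar>\<^sup>2 \<le> \<kappa>\<^sup>2" by (intro power_mono) auto
    then show ?case by (simp add: power2_eq_square)
  qed
  have "(\<integral>\<omega>. \<psi> (fst z) \<omega> * \<psi> (fst z) \<omega> \<partial>\<pi>) \<le> (\<integral>\<omega>. \<kappa>\<^sup>2 \<partial>\<pi>)"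
    by (rule integral_mono_AE[OF integrable_\<psi> _ bd]) simp
  then show ?case by (simp add: kernel pi.prob_space)
qed

lemma AE_mem_square_le:
  assumes "f \<in> H"
  shows "AE z in \<rho>. (f (fst z))\<^sup>2 \<le> \<kappa>\<^sup>2 * ip f f"
  using AE_kernel_diag_le
proof eventually_elim
  case (elim z)
  have "(f (fst z))\<^sup>2 \<le> ip f f * K (fst z) (fst z)" by (rule eval_square_le[OF assms])
  also have "\<dots> \<le> ip f f * \<kappa>\<^sup>2" by (rule mult_left_mono[OF elim nonneg[OF assms]])
  finally show ?case by (simp add: mult.commute)
qed

lemma ae_bounded_mem:
  assumes "f \<in> H"
  shows "ae_bounded \<rho> (\<lambda>z. f (fst z))"
proof (rule ae_boundedI)
  show "(\<lambda>z. f (fst z)) \<in> borel_measurable \<rho>"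
    by (rule measurable_compose[OF measurable_fst_\<rho> mem_measurable[OF assms]])
  show "AE z in \<rho>. \<bar>f (fst z)\<bar> \<le> sqrt (\<kappa>\<^sup>2 * ip f f)"
    using AE_mem_square_le[OF assms] by eventually_elim (rule real_le_rsqrt, simp)
qed

lemma integral_mem_square_le:
  assumes "f \<in> H"
  shows "(\<integral>z. (f (fst z))\<^sup>2 \<partial>\<rho>) \<le> \<kappa>\<^sup>2 * ip f f"
  by (rule rho.integral_le_ae_bound[OF ae_bounded_power[OF ae_bounded_mem[OF assms]] AE_mem_square_le[OF assms]])

section \<open>The residual of the risk minimizer\<close>

lemma minimizer_mem: "f\<^sub>H \<in> H"
  using minimizer by (simp add: is_arg_min_def)

definition residual :: "'x \<times> real \<Rightarrow> real"
  where "residual z = f\<^sub>H (fst z) - snd z"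

lemma ae_bounded_residual: "ae_bounded \<rho> residual"
  unfolding residual_def by (intro ae_bounded_diff ae_bounded_mem minimizer_mem ae_bounded_snd)

lemma expected_risk_expand:
  assumes "ae_bounded \<rho> (\<lambda>z. f (fst z))"
  shows "expected_risk \<rho> f = (\<integral>z. (f (fst z) - f\<^sub>H (fst z))\<^sup>2 \<partial>\<rho>)
    + 2 * (\<integral>z. (f (fst z) - f\<^sub>H (fst z)) * residual z \<partial>\<rho>) + expected_risk \<rho> f\<^sub>H"
proof -
  let ?d = "\<lambda>z. f (fst z) - f\<^sub>H (fst z)"
  have d: "ae_bounded \<rho> ?d" by (intro ae_bounded_diff assms ae_bounded_mem minimizer_mem)
  have int: "integrable \<rho> (\<lambda>z. (?d z)\<^sup>2)" "integrable \<rho> (\<lambda>z. ?d z * residual z)" "integrable \<rho> (\<lambda>z. (residual z)\<^sup>2)"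
    by (intro rho.integrable_ae_bounded ae_bounded_power ae_bounded_mult d ae_bounded_residual)+
  have "expected_risk \<rho> f = (\<integral>z. (?d z)\<^sup>2 + 2 * (?d z * residual z) + (residual z)\<^sup>2 \<partial>\<rho>)"
    unfolding expected_risk_def residual_def
    by (intro Bochner_Integration.integral_cong refl) (simp add: case_prod_unfold power2_eq_square algebra_simps)
  also have "\<dots> = (\<integral>z. (?d z)\<^sup>2 \<partial>\<rho>) + 2 * (\<integral>z. ?d z * residual z \<partial>\<rho>) + (\<integral>z. (residual z)\<^sup>2 \<partial>\<rho>)"
    using int by simp
  finally show ?thesis by (simp add: expected_risk_def residual_def case_prod_unfold)
qed

text \<open>Along the line through \<open>f\<^sub>H\<close> in direction \<open>h\<close> the risk
  is a quadratic in \<open>t\<close> with its minimum at 0, so its linear coefficient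
  vanishes.\<close>

lemma residual_orthogonal_mem:
  assumes h: "h \<in> H"
  shows "(\<integral>z. h (fst z) * residual z \<partial>\<rho>) = 0"
proof -
  have "(\<integral>z. h (fst z) * residual z \<partial>\<rho>)\<^sup>2 \<le> 0 * (\<integral>z. (h (fst z))\<^sup>2 \<partial>\<rho>)"
  proof (rule quadratic_nonneg_imp_discrim)
    fix t :: real
    have m: "(\<lambda>x. f\<^sub>H x + t * h x) \<in> H" by (intro add scale minimizer_mem h)
    have "expected_risk \<rho> f\<^sub>H \<le> expected_risk \<rho> (\<lambda>x. f\<^sub>H x + t * h x)"
      using minimizer m by (auto simp: is_arg_min_def not_less)
    also have "\<dots> = (\<integral>z. (t * h (fst z))\<^sup>2 \<partial>\<rho>) + 2 * (\<integral>z. t * h (fst z) * residual z \<partial>\<rho>) + expected_risk \<rho> f\<^sub>H"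
      using expected_risk_expand[of "\<lambda>x. f\<^sub>H x + t * h x", OF ae_bounded_mem[OF m]] by simp
    finally show "0 \<le> 0 + 2 * t * (\<integral>z. h (fst z) * residual z \<partial>\<rho>) + t\<^sup>2 * (\<integral>z. (h (fst z))\<^sup>2 \<partial>\<rho>)"
      by (simp add: power_mult_distrib mult.assoc)
  qed simp
  then show ?thesis by simp
qed

text \<open>Pythagoras. Membership of \<open>f\<close> in \<open>H\<close> is replaced by
  orthogonality to the residual, because the estimator is a combination of features that may lie
  outside \<open>H\<close>.\<close>

lemma expected_risk_excess:
  assumes f: "ae_bounded \<rho> (\<lambda>z. f (fst z))" and orth: "(\<integral>z. f (fst z) * residual z \<partial>\<rho>) = 0"
  shows "expected_risk \<rho> f - expected_risk \<rho> f\<^sub>H = (\<integral>z. (f (fst z) - f\<^sub>H (fst z))\<^sup>2 \<partial>\<rho>)"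
proof -
  have "integrable \<rho> (\<lambda>z. f (fst z) * residual z)" "integrable \<rho> (\<lambda>z. f\<^sub>H (fst z) * residual z)"
    by (intro rho.integrable_ae_bounded ae_bounded_mult f ae_bounded_mem minimizer_mem ae_bounded_residual)+
  then have "(\<integral>z. (f (fst z) - f\<^sub>H (fst z)) * residual z \<partial>\<rho>) = 0"
    using orth residual_orthogonal_mem[OF minimizer_mem] by (simp add: left_diff_distrib)
  then show ?thesis using expected_risk_expand[OF f] by simp
qed

section \<open>The integral operators defined by the features\<close>

lemma integrable_features: "integrable \<pi> (\<psi> x)"
  \<comment> \<open>The bound \<kappa> holds only for almost every input, so for an arbitrary
    \<open>x\<close> integrability comes from finiteness of \<open>K x x\<close>.\<close>
  using pi.square_integrable_imp_integrable[of "\<psi> x"] integrable_\<psi>[of x x]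
  by (simp add: power2_eq_square)

text \<open>Adjointness of the two operators that integrate the features against a density on the
  parameters and against a function of the data. The density is merely integrable so that
  \<open>\<psi> x\<close> itself can be inserted, which makes kernel sections appear.\<close>

lemma feature_Fubini:
  assumes r: "ae_bounded \<rho> r" and g: "integrable \<pi> g"
  shows "(\<integral>z. r z * (\<integral>\<omega>. \<psi> (fst z) \<omega> * g \<omega> \<partial>\<pi>) \<partial>\<rho>) = (\<integral>\<omega>. (\<integral>z. r z * \<psi> (fst z) \<omega> \<partial>\<rho>) * g \<omega> \<partial>\<pi>)"
proof -
  have [measurable]: "r \<in> borel_measurable \<rho>" "g \<in> borel_measurable \<pi>"
    using r g by (auto simp: ae_bounded_measurable)
  obtain C where C: "0 \<le> C" "AE z in \<rho>. \<bar>r z\<bar> \<le> C" by (rule ae_boundedE[OF r])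
  define F where "F z \<omega> = r z * (\<psi> (fst z) \<omega> * g \<omega>)" for z \<omega>
  have F_meas: "case_prod F \<in> borel_measurable (\<rho> \<Otimes>\<^sub>M \<pi>)"
    unfolding F_def by measurable
  have F_bd: "AE z in \<rho>. AE \<omega> in \<pi>. \<bar>F z \<omega>\<bar> \<le> C * \<kappa> * \<bar>g \<omega>\<bar>"
    using C(2) AE_\<rho>_\<pi>
  proof eventually_elim
    case (elim z)
    note r = elim(1)
    show ?case using elim(2)
    proof eventually_elim
      case (elim \<omega>)
      have "\<bar>r z\<bar> * (\<bar>\<psi> (fst z) \<omega>\<bar> * \<bar>g \<omega>\<bar>) \<le> C * (\<kappa> * \<bar>g \<omega>\<bar>)"
        using C(1) \<kappa> by (intro mult_mono r elim) auto
      then show ?case by (simp add: F_def abs_mult mult.assoc)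
    qed
  qed
  have ig: "integrable \<pi> (\<lambda>\<omega>. C * \<kappa> * \<bar>g \<omega>\<bar>)" using g by simp
  have Fz: "integrable \<pi> (F z)" if z: "z \<in> space \<rho>" and bd: "AE \<omega> in \<pi>. \<bar>F z \<omega>\<bar> \<le> C * \<kappa> * \<bar>g \<omega>\<bar>" for z
  proof (rule Bochner_Integration.integrable_bound[OF ig])
    note [measurable] = z
    show "F z \<in> borel_measurable \<pi>" unfolding F_def by measurable
    show "AE \<omega> in \<pi>. norm (F z \<omega>) \<le> norm (C * \<kappa> * \<bar>g \<omega>\<bar>)"
      using bd by eventually_elim (unfold real_norm_def, erule order.trans, rule abs_ge_self)
  qed
  have F_int: "integrable (\<rho> \<Otimes>\<^sub>M \<pi>) (case_prod F)"
  proof (rule rp.Fubini_integrable[OF F_meas])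
    show "AE z in \<rho>. integrable \<pi> (\<lambda>\<omega>. case_prod F (z, \<omega>))"
      using F_bd AE_space by eventually_elim (simp only: case_prod_conv, rule Fz)
    have "AE z in \<rho>. \<bar>\<integral>\<omega>. norm (case_prod F (z, \<omega>)) \<partial>\<pi>\<bar> \<le> (\<integral>\<omega>. C * \<kappa> * \<bar>g \<omega>\<bar> \<partial>\<pi>)"
      using F_bd AE_space
    proof eventually_elim
      case (elim z)
      have "integrable \<pi> (\<lambda>\<omega>. \<bar>F z \<omega>\<bar>)"
        by (rule integrable_abs[OF Fz[OF elim(2,1)]])
      then have "(\<integral>\<omega>. \<bar>F z \<omega>\<bar> \<partial>\<pi>) \<le> (\<integral>\<omega>. C * \<kappa> * \<bar>g \<omega>\<bar> \<partial>\<pi>)"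
        by (rule integral_mono_AE[OF _ ig elim(1)])
      moreover have "0 \<le> (\<integral>\<omega>. \<bar>F z \<omega>\<bar> \<partial>\<pi>)" by (rule Bochner_Integration.integral_nonneg) simp
      ultimately show ?case by (simp only: case_prod_conv real_norm_def abs_of_nonneg)
    qed
    moreover have "(\<lambda>z. \<integral>\<omega>. norm (case_prod F (z, \<omega>)) \<partial>\<pi>) \<in> borel_measurable \<rho>"
      unfolding case_prod_conv F_def by measurable
    ultimately show "integrable \<rho> (\<lambda>z. \<integral>\<omega>. norm (case_prod F (z, \<omega>)) \<partial>\<pi>)"
      by (intro rho.integrable_ae_bounded ae_boundedI)
  qed
  have "(\<integral>z. r z * (\<integral>\<omega>. \<psi> (fst z) \<omega> * g \<omega> \<partial>\<pi>) \<partial>\<rho>) = (\<integral>z. (\<integral>\<omega>. F z \<omega> \<partial>\<pi>) \<partial>\<rho>)"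
    by (simp add: F_def)
  also have "\<dots> = (\<integral>\<omega>. (\<integral>z. F z \<omega> \<partial>\<rho>) \<partial>\<pi>)"
    by (rule rp.Fubini_integral[OF F_int, symmetric])
  also have "\<dots> = (\<integral>\<omega>. (\<integral>z. r z * \<psi> (fst z) \<omega> \<partial>\<rho>) * g \<omega> \<partial>\<pi>)"
    by (simp add: F_def mult.assoc[symmetric])
  finally show ?thesis .
qed

lemma ae_bounded_dual:
  assumes r: "ae_bounded \<rho> r"
  shows "ae_bounded \<pi> (\<lambda>\<omega>. \<integral>z. r z * \<psi> (fst z) \<omega> \<partial>\<rho>)"
proof -
  have [measurable]: "r \<in> borel_measurable \<rho>" by (rule ae_bounded_measurable[OF r])
  obtain C where C: "0 \<le> C" "AE z in \<rho>. \<bar>r z\<bar> \<le> C" by (rule ae_boundedE[OF r])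
  show ?thesis
  proof (rule ae_boundedI)
    show "(\<lambda>\<omega>. \<integral>z. r z * \<psi> (fst z) \<omega> \<partial>\<rho>) \<in> borel_measurable \<pi>" by measurable
    show "AE \<omega> in \<pi>. \<bar>\<integral>z. r z * \<psi> (fst z) \<omega> \<partial>\<rho>\<bar> \<le> C * \<kappa>"
      using AE_\<pi>_\<rho>
    proof eventually_elim
      case (elim \<omega>)
      have ae: "ae_bounded \<rho> (\<lambda>z. r z * \<psi> (fst z) \<omega>)"
        by (rule ae_bounded_mult[OF r ae_bounded_\<psi>[OF elim]]) (simp add: space_\<pi>)
      have bd: "AE z in \<rho>. \<bar>r z * \<psi> (fst z) \<omega>\<bar> \<le> C * \<kappa>"
        using C(2) elim
        by eventually_elim (unfold abs_mult, intro mult_mono, use C(1) in auto)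
      have "(\<integral>z. r z * \<psi> (fst z) \<omega> \<partial>\<rho>) \<le> C * \<kappa>"
        by (rule rho.integral_le_ae_bound[OF ae]) (use bd in eventually_elim, linarith)
      moreover have "(\<integral>z. - (r z * \<psi> (fst z) \<omega>) \<partial>\<rho>) \<le> C * \<kappa>"
      proof (rule rho.integral_le_ae_bound)
        show "ae_bounded \<rho> (\<lambda>z. - (r z * \<psi> (fst z) \<omega>))"
          using ae_bounded_diff[OF ae_bounded_const[of \<rho> 0] ae] by simp
      qed (use bd in eventually_elim, linarith)
      ultimately show ?case by simp
    qed
  qed
qed

text \<open>The residual is orthogonal to \<open>H\<close>, hence to all kernel sections; integrating them against the
  residual gives \<open>\<integral> (\<integral> r \<psi>(\<sqdot>, \<omega>) d\<rho>)\<^sup>2 d\<pi> = 0\<close>.\<close>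

lemma AE_residual_orthogonal_feature: "AE \<omega> in \<pi>. (\<integral>z. residual z * \<psi> (fst z) \<omega> \<partial>\<rho>) = 0"
proof -
  define G where "G \<omega> = (\<integral>z. residual z * \<psi> (fst z) \<omega> \<partial>\<rho>)" for \<omega>
  have G: "ae_bounded \<pi> G" unfolding G_def by (rule ae_bounded_dual[OF ae_bounded_residual])
  have 0: "(\<integral>\<omega>. \<psi> x \<omega> * G \<omega> \<partial>\<pi>) = 0" for x
  proof -
    have "(\<integral>\<omega>. G \<omega> * \<psi> x \<omega> \<partial>\<pi>) = (\<integral>z. residual z * (\<integral>\<omega>. \<psi> (fst z) \<omega> * \<psi> x \<omega> \<partial>\<pi>) \<partial>\<rho>)"
      unfolding G_def by (rule feature_Fubini[OF ae_bounded_residual integrable_features, symmetric])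
    also have "\<dots> = (\<integral>z. K x (fst z) * residual z \<partial>\<rho>)"
      by (simp add: kernel mult.commute)
    also have "\<dots> = 0" by (rule residual_orthogonal_mem[OF kernel_mem])
    finally show ?thesis by (simp add: mult.commute)
  qed
  \<comment> \<open>Adjointness once more, with \<open>G\<close> as the density: the inner integral
    is 0 at every input by the previous fact.\<close>
  have "(\<integral>\<omega>. G \<omega> * G \<omega> \<partial>\<pi>) = (\<integral>z. residual z * (\<integral>\<omega>. \<psi> (fst z) \<omega> * G \<omega> \<partial>\<pi>) \<partial>\<rho>)"
    unfolding G_def[of] by (rule feature_Fubini[OF ae_bounded_residual pi.integrable_ae_bounded[OF G[unfolded G_def]], symmetric])
  also have "\<dots> = 0" by (simp add: 0)
  finally have "(\<integral>\<omega>. (G \<omega>)\<^sup>2 \<partial>\<pi>) = 0" by (simp add: power2_eq_square)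
  then have "AE \<omega> in \<pi>. (G \<omega>)\<^sup>2 = 0"
    using integral_nonneg_eq_0_iff_AE[OF pi.integrable_ae_bounded[OF ae_bounded_power[OF G]]] by simp
  then show ?thesis by (simp add: G_def)
qed

lemma semi_inner_product_L2: "semi_inner_product H (\<lambda>f g. \<integral>z. f (fst z) * g (fst z) \<partial>\<rho>)"
proof (unfold_locales; (intro zero add scale; assumption)?)
  fix f g h :: "'x \<Rightarrow> real" and a :: real
  assume m: "f \<in> H" "g \<in> H" "h \<in> H"
  have "integrable \<rho> (\<lambda>z. f (fst z) * h (fst z))" "integrable \<rho> (\<lambda>z. g (fst z) * h (fst z))"
    by (intro rho.integrable_ae_bounded ae_bounded_mult ae_bounded_mem m)+
  then show "(\<integral>z. (f (fst z) + g (fst z)) * h (fst z) \<partial>\<rho>)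
      = (\<integral>z. f (fst z) * h (fst z) \<partial>\<rho>) + (\<integral>z. g (fst z) * h (fst z) \<partial>\<rho>)"
    by (simp add: distrib_right)
next
  fix f g :: "'x \<Rightarrow> real" and a :: real
  show "(\<integral>z. f (fst z) * g (fst z) \<partial>\<rho>) = (\<integral>z. g (fst z) * f (fst z) \<partial>\<rho>)"
    by (simp add: mult.commute)
  show "(\<integral>z. a * f (fst z) * g (fst z) \<partial>\<rho>) = a * (\<integral>z. f (fst z) * g (fst z) \<partial>\<rho>)"
    by (simp add: mult.assoc)
qed simp

text \<open>The regularized population solution \<open>f\<close> satisfies \<open>l f = \<integral> K(x, \<sqdot>) (f\<^sub>H - f)(x) d\<rho>\<close>, which
  makes it a mixture of features with a density \<open>g\<close> of size \<open>O(l\<^bsup>-1/2\<^esup>)\<close>; a representation of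
  \<open>f\<^sub>H\<close> itself would only have a square integrable density.\<close>

lemma feature_density:
  assumes l: "0 < l"
  defines "R \<equiv> ip f\<^sub>H f\<^sub>H"
  obtains f g where "f \<in> H" "ae_bounded \<pi> g" "AE \<omega> in \<pi>. (g \<omega>)\<^sup>2 \<le> \<kappa>\<^sup>2 * R / l"
    "(\<integral>\<omega>. (g \<omega>)\<^sup>2 \<partial>\<pi>) \<le> R" "\<And>x. f x = (\<integral>\<omega>. \<psi> x \<omega> * g \<omega> \<partial>\<pi>)"
    "(\<integral>z. (f (fst z) - f\<^sub>H (fst z))\<^sup>2 \<partial>\<rho>) \<le> l * R"
proof -
  define s where "s f g = (\<integral>z. f (fst z) * g (fst z) \<partial>\<rho>)" for f g :: "'x \<Rightarrow> real"
  interpret s: semi_inner_product H s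
    unfolding s_def by (rule semi_inner_product_L2)
  have "s f f \<le> \<kappa>\<^sup>2 * ip f f" if "f \<in> H" for f
    using integral_mem_square_le[OF that] by (simp add: s_def power2_eq_square)
  then obtain f where f: "f \<in> H" and eq: "\<And>h. h \<in> H \<Longrightarrow> l * ip f h + s f h = s f\<^sub>H h"
    using tikhonov_solution[OF s.semi_inner_product_axioms _ l minimizer_mem] by blast
  define r where "r z = f\<^sub>H (fst z) - f (fst z)" for z :: "'x \<times> real"
  have r: "ae_bounded \<rho> r"
    unfolding r_def by (intro ae_bounded_diff ae_bounded_mem minimizer_mem f)
  \<comment> \<open>The stationarity equation in residual form; it is tested below with
    \<open>f\<^sub>H\<close>, with \<open>f\<close> and with kernel sections.\<close>
  have rh: "(\<integral>z. r z * h (fst z) \<partial>\<rho>) = l * ip f h" if h: "h \<in> H" for h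
  proof -
    have "integrable \<rho> (\<lambda>z. f\<^sub>H (fst z) * h (fst z))" "integrable \<rho> (\<lambda>z. f (fst z) * h (fst z))"
      by (intro rho.integrable_ae_bounded ae_bounded_mult ae_bounded_mem minimizer_mem f h)+
    then have "(\<integral>z. r z * h (fst z) \<partial>\<rho>) = s f\<^sub>H h - s f h"
      by (simp add: r_def s_def left_diff_distrib)
    with eq[OF h] show ?thesis by simp
  qed
  define G where "G \<omega> = (\<integral>z. r z * \<psi> (fst z) \<omega> \<partial>\<rho>)" for \<omega>
  define g where "g \<omega> = 1 / l * G \<omega>" for \<omega>
  have G: "ae_bounded \<pi> G" unfolding G_def by (rule ae_bounded_dual[OF r])
  have g: "ae_bounded \<pi> g" unfolding g_def by (rule ae_bounded_mult[OF ae_bounded_const G])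
  have rr: "(\<integral>z. (r z)\<^sup>2 \<partial>\<rho>) = l * ip f f\<^sub>H - l * ip f f"
  proof -
    have "integrable \<rho> (\<lambda>z. r z * f\<^sub>H (fst z))" "integrable \<rho> (\<lambda>z. r z * f (fst z))"
      by (intro rho.integrable_ae_bounded ae_bounded_mult ae_bounded_mem minimizer_mem f r)+
    then have "(\<integral>z. r z * f\<^sub>H (fst z) - r z * f (fst z) \<partial>\<rho>) = l * ip f f\<^sub>H - l * ip f f"
      using rh[OF minimizer_mem] rh[OF f] by simp
    moreover have "(r z)\<^sup>2 = r z * f\<^sub>H (fst z) - r z * f (fst z)" for z
      by (simp add: r_def power2_eq_square right_diff_distrib)
    ultimately show ?thesis by simp
  qed
  have norms: "ip f f\<^sub>H - ip f f \<le> R" "ip f f \<le> R"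
  proof -
    have "0 \<le> l * (ip f f\<^sub>H - ip f f)"
      unfolding right_diff_distrib rr[symmetric] by simp
    \<comment> \<open>Nonnegativity of the squared \<L>2(\<rho>) error gives this; nonnegativity of
      the squared \<open>ip\<close>-distance from \<open>f\<close> to \<open>f\<^sub>H\<close> then
      gives both norm bounds.\<close>
    then have "ip f f \<le> ip f f\<^sub>H" using l by (simp add: zero_le_mult_iff)
    moreover have "0 \<le> ip f f - 2 * ip f f\<^sub>H + R"
      unfolding R_def diff_expand[OF f minimizer_mem, symmetric] by (intro nonneg diff f minimizer_mem)
    moreover have "0 \<le> ip f f" by (rule nonneg[OF f])
    ultimately show "ip f f\<^sub>H - ip f f \<le> R" "ip f f \<le> R" by linarith+
  qed
  have rr_le: "(\<integral>z. (r z)\<^sup>2 \<partial>\<rho>) \<le> l * R"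
    unfolding rr right_diff_distrib[symmetric] using norms(1) l by (intro mult_left_mono) auto
  have rep: "f x = (\<integral>\<omega>. \<psi> x \<omega> * g \<omega> \<partial>\<pi>)" for x
  proof -
    have "l * f x = l * ip f (K x)" by (rule arg_cong[OF reproducing[OF f]])
    also have "\<dots> = (\<integral>z. r z * K x (fst z) \<partial>\<rho>)" by (rule rh[OF kernel_mem, symmetric])
    also have "\<dots> = (\<integral>z. r z * (\<integral>\<omega>. \<psi> (fst z) \<omega> * \<psi> x \<omega> \<partial>\<pi>) \<partial>\<rho>)"
      by (simp add: kernel mult.commute)
    also have "\<dots> = (\<integral>\<omega>. G \<omega> * \<psi> x \<omega> \<partial>\<pi>)"
      unfolding G_def by (rule feature_Fubini[OF r integrable_features])
    finally have "f x = 1 / l * (\<integral>\<omega>. G \<omega> * \<psi> x \<omega> \<partial>\<pi>)" using l by (simp add: field_simps)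
    also have "\<dots> = (\<integral>\<omega>. \<psi> x \<omega> * g \<omega> \<partial>\<pi>)" by (simp add: g_def mult_ac)
    finally show ?thesis .
  qed
  show thesis
  proof (rule that[OF f g _ _ rep])
    show "(\<integral>z. (f (fst z) - f\<^sub>H (fst z))\<^sup>2 \<partial>\<rho>) \<le> l * R"
      using rr_le by (simp add: r_def power2_commute)
    \<comment> \<open>By adjointness the \<L>2(\<pi>) norm of \<open>g\<close> equals the norm of
      \<open>f\<close> in \<open>H\<close>.\<close>
    have "(\<integral>\<omega>. (g \<omega>)\<^sup>2 \<partial>\<pi>) = 1 / l * (\<integral>\<omega>. G \<omega> * g \<omega> \<partial>\<pi>)"
      by (simp add: g_def power2_eq_square mult_ac)
    also have "(\<integral>\<omega>. G \<omega> * g \<omega> \<partial>\<pi>) = (\<integral>z. r z * (\<integral>\<omega>. \<psi> (fst z) \<omega> * g \<omega> \<partial>\<pi>) \<partial>\<rho>)"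
      unfolding G_def by (rule feature_Fubini[OF r pi.integrable_ae_bounded[OF g], symmetric])
    also have "\<dots> = l * ip f f" unfolding rep[symmetric] by (rule rh[OF f])
    finally show "(\<integral>\<omega>. (g \<omega>)\<^sup>2 \<partial>\<pi>) \<le> R" using norms(2) l by simp
    show "AE \<omega> in \<pi>. (g \<omega>)\<^sup>2 \<le> \<kappa>\<^sup>2 * R / l"
      using AE_\<pi>_\<rho>
    proof eventually_elim
      case (elim \<omega>)
      have \<psi>: "ae_bounded \<rho> (\<lambda>z. \<psi> (fst z) \<omega>)" by (rule ae_bounded_\<psi>[OF elim]) (simp add: space_\<pi>)
      have "(\<integral>z. (\<psi> (fst z) \<omega>)\<^sup>2 \<partial>\<rho>) \<le> \<kappa>\<^sup>2"
      proof (rule rho.integral_le_ae_bound[OF ae_bounded_power[OF \<psi>]])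
        show "AE z in \<rho>. (\<psi> (fst z) \<omega>)\<^sup>2 \<le> \<kappa>\<^sup>2"
          using elim by eventually_elim (use \<kappa> in \<open>simp add: abs_le_square_iff[symmetric]\<close>)
      qed
      then have "(\<integral>z. (r z)\<^sup>2 \<partial>\<rho>) * (\<integral>z. (\<psi> (fst z) \<omega>)\<^sup>2 \<partial>\<rho>) \<le> (l * R) * \<kappa>\<^sup>2"
        using l by (intro mult_mono rr_le) (auto simp: R_def intro!: mult_nonneg_nonneg nonneg minimizer_mem)
      with rho.integral_Cauchy_Schwarz[OF r \<psi>] have "(G \<omega>)\<^sup>2 \<le> (l * R) * \<kappa>\<^sup>2"
        by (simp add: G_def)
      \<comment> \<open>One of the two powers of \<open>l\<close> is compensated by the smallness of
        the error \<open>r\<close> in \<L>2(\<rho>).\<close>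
      then have "(G \<omega>)\<^sup>2 / l\<^sup>2 \<le> (l * R) * \<kappa>\<^sup>2 / l\<^sup>2" by (rule divide_right_mono) simp
      then show ?case using l by (simp add: g_def power_divide power2_eq_square mult_ac)
    qed
  qed
qed

end

section \<open>Chebyshev bounds for sampled features\<close>

lemma emeasure_ge_le:
  assumes f: "f \<in> borel_measurable M" and int: "(\<integral>\<^sup>+x. f x \<partial>M) \<le> ennreal A" and "0 < t" "0 \<le> A"
  shows "emeasure M {x \<in> space M. ennreal t \<le> f x} \<le> ennreal (A / t)"
proof -
  have "{x \<in> space M. ennreal t \<le> f x} = {x \<in> space M. 1 \<le> ennreal (1 / t) * f x}"
  proof (intro Collect_cong conj_cong refl)
    fix x
    show "ennreal t \<le> f x \<longleftrightarrow> 1 \<le> ennreal (1 / t) * f x"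
    proof
      assume "ennreal t \<le> f x"
      then have "ennreal (1 / t) * ennreal t \<le> ennreal (1 / t) * f x" by (rule mult_left_mono) simp
      then show "1 \<le> ennreal (1 / t) * f x"
        using \<open>0 < t\<close> by (simp add: ennreal_mult[symmetric])
    next
      assume "1 \<le> ennreal (1 / t) * f x"
      then have "ennreal t * 1 \<le> ennreal t * (ennreal (1 / t) * f x)" by (rule mult_left_mono) simp
      then show "ennreal t \<le> f x"
        using \<open>0 < t\<close> by (simp add: ennreal_mult[symmetric] mult.assoc[symmetric])
    qed
  qed
  also have "emeasure M \<dots> \<le> ennreal (1 / t) * (\<integral>\<^sup>+x. f x * indicator (space M) x \<partial>M)"
    by (rule nn_integral_Markov_inequality) (use f in auto)
  also have "(\<integral>\<^sup>+x. f x * indicator (space M) x \<partial>M) = (\<integral>\<^sup>+x. f x \<partial>M)"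
    by (intro nn_integral_cong) (simp add: indicator_def)
  also have "ennreal (1 / t) * (\<integral>\<^sup>+x. f x \<partial>M) \<le> ennreal (1 / t) * ennreal A"
    by (intro mult_left_mono int) simp
  also have "\<dots> = ennreal (A / t)" using assms(3,4) by (simp add: ennreal_mult[symmetric])
  finally show ?thesis .
qed

context random_features
begin

text \<open>For a fixed input the terms are centred with second moment at most \<kappa>^2 R;
  Tonelli's theorem carries the variance bound over to the \<L>2(\<rho>) error. The sum is not
  divided by M, and \<open>f\<close> is subtracted in every summand.\<close>

lemma sampling_deviation:
  fixes M :: nat and R :: real
  assumes f: "f \<in> H" and g: "ae_bounded \<pi> g" and g2: "(\<integral>\<omega>. (g \<omega>)\<^sup>2 \<partial>\<pi>) \<le> R"
    and rep: "\<And>x. f x = (\<integral>\<omega>. \<psi> x \<omega> * g \<omega> \<partial>\<pi>)"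
  defines "P \<equiv> PiM {..<M} (\<lambda>_. \<pi>)"
  shows "(\<lambda>\<omega>. \<integral>\<^sup>+z. ennreal ((\<Sum>j<M. \<psi> (fst z) (\<omega> j) * g (\<omega> j) - f (fst z))\<^sup>2) \<partial>\<rho>) \<in> borel_measurable P"
    and "(\<integral>\<^sup>+\<omega>. \<integral>\<^sup>+z. ennreal ((\<Sum>j<M. \<psi> (fst z) (\<omega> j) * g (\<omega> j) - f (fst z))\<^sup>2) \<partial>\<rho> \<partial>P)
      \<le> ennreal (M * (\<kappa>\<^sup>2 * R))"
proof -
  define F where "F \<omega> z = ennreal ((\<Sum>j<M. \<psi> (fst z) (\<omega> j) * g (\<omega> j) - f (fst z))\<^sup>2)" for \<omega> and z :: "'x \<times> real"
  interpret P: prob_space P unfolding P_def by (intro prob_space_PiM prob_\<pi>)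
  interpret PR: pair_sigma_finite P \<rho> ..
  have [measurable]: "g \<in> borel_measurable \<pi>" by (rule ae_bounded_measurable[OF g])
  have [measurable]: "(\<lambda>z. f (fst z)) \<in> borel_measurable \<rho>" by (rule ae_bounded_measurable[OF ae_bounded_mem[OF f]])
  have F_meas [measurable]: "case_prod F \<in> borel_measurable (P \<Otimes>\<^sub>M \<rho>)"
    unfolding F_def P_def by measurable
  have "(\<lambda>\<omega>. \<integral>\<^sup>+z. F \<omega> z \<partial>\<rho>) \<in> borel_measurable P" by measurable
  then show "(\<lambda>\<omega>. \<integral>\<^sup>+z. ennreal ((\<Sum>j<M. \<psi> (fst z) (\<omega> j) * g (\<omega> j) - f (fst z))\<^sup>2) \<partial>\<rho>) \<in> borel_measurable P"
    by (simp only: F_def)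
  have "(\<integral>\<^sup>+\<omega>. \<integral>\<^sup>+z. F \<omega> z \<partial>\<rho> \<partial>P) = (\<integral>\<^sup>+z. \<integral>\<^sup>+\<omega>. F \<omega> z \<partial>P \<partial>\<rho>)"
    by (rule PR.Fubini'[OF F_meas, symmetric])
  also have "\<dots> \<le> (\<integral>\<^sup>+z. ennreal (M * (\<kappa>\<^sup>2 * R)) \<partial>\<rho>)"
  proof (rule nn_integral_mono_AE)
    show "AE z in \<rho>. (\<integral>\<^sup>+\<omega>. F \<omega> z \<partial>P) \<le> ennreal (M * (\<kappa>\<^sup>2 * R))"
      using AE_\<rho>_\<pi>
    proof eventually_elim
      case (elim z)
      have \<psi>: "ae_bounded \<pi> (\<psi> (fst z))" by (rule ae_boundedI[OF _ elim]) measurable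
      have u: "ae_bounded \<pi> (\<lambda>\<omega>. \<psi> (fst z) \<omega> * g \<omega>)" by (rule ae_bounded_mult[OF \<psi> g])
      have "(\<integral>\<omega>. (\<psi> (fst z) \<omega> * g \<omega>)\<^sup>2 \<partial>\<pi>) \<le> (\<integral>\<omega>. \<kappa>\<^sup>2 * (g \<omega>)\<^sup>2 \<partial>\<pi>)"
      proof (rule integral_mono_AE)
        show "AE \<omega> in \<pi>. (\<psi> (fst z) \<omega> * g \<omega>)\<^sup>2 \<le> \<kappa>\<^sup>2 * (g \<omega>)\<^sup>2"
          using elim
        proof eventually_elim
          case (elim \<omega>)
          then have "(\<psi> (fst z) \<omega>)\<^sup>2 \<le> \<kappa>\<^sup>2" using \<kappa> by (simp add: abs_le_square_iff[symmetric])
          then show ?case unfolding power_mult_distrib by (rule mult_right_mono) simp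
        qed
      qed (intro pi.integrable_ae_bounded ae_bounded_power ae_bounded_mult ae_bounded_const \<psi> g)+
      also have "\<dots> \<le> \<kappa>\<^sup>2 * R" using g2 by (simp add: mult_left_mono)
      finally have le: "(\<integral>\<omega>. (\<psi> (fst z) \<omega> * g \<omega>)\<^sup>2 \<partial>\<pi>) \<le> \<kappa>\<^sup>2 * R" .
      have "(\<integral>\<^sup>+\<omega>. F \<omega> z \<partial>P) \<le> ennreal (M * (\<integral>\<omega>. (\<psi> (fst z) \<omega> * g \<omega>)\<^sup>2 \<partial>\<pi>))"
        unfolding F_def P_def
        by (rule nn_integral_PiM_square_sum_le[OF prob_\<pi> pi.integrable_ae_bounded[OF u]
              pi.integrable_ae_bounded[OF ae_bounded_power[OF u]] rep[symmetric]])
      also have "\<dots> \<le> ennreal (M * (\<kappa>\<^sup>2 * R))"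
        by (intro ennreal_leI mult_left_mono le) simp
      finally show ?case .
    qed
  qed
  also have "\<dots> = ennreal (M * (\<kappa>\<^sup>2 * R))" by (simp add: rho.emeasure_space_1)
  finally show "(\<integral>\<^sup>+\<omega>. \<integral>\<^sup>+z. ennreal ((\<Sum>j<M. \<psi> (fst z) (\<omega> j) * g (\<omega> j) - f (fst z))\<^sup>2) \<partial>\<rho> \<partial>P)
      \<le> ennreal (M * (\<kappa>\<^sup>2 * R))"
    by (simp only: F_def)
qed

text \<open>Variance of the sum of squared weights. The pointwise bound \<open>B\<close> enters
  here, reducing the fourth moment of \<open>g\<close> to its second moment.\<close>

lemma weight_deviation:
  fixes M :: nat and B R :: real
  assumes g: "ae_bounded \<pi> g" and gb: "AE \<omega> in \<pi>. (g \<omega>)\<^sup>2 \<le> B" and g2: "(\<integral>\<omega>. (g \<omega>)\<^sup>2 \<partial>\<pi>) \<le> R" and "0 \<le> B"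
  defines "P \<equiv> PiM {..<M} (\<lambda>_. \<pi>)"
  shows "(\<lambda>\<omega>. ennreal ((\<Sum>j<M. (g (\<omega> j))\<^sup>2 - (\<integral>\<omega>. (g \<omega>)\<^sup>2 \<partial>\<pi>))\<^sup>2)) \<in> borel_measurable P"
    and "(\<integral>\<^sup>+\<omega>. ennreal ((\<Sum>j<M. (g (\<omega> j))\<^sup>2 - (\<integral>\<omega>. (g \<omega>)\<^sup>2 \<partial>\<pi>))\<^sup>2) \<partial>P) \<le> ennreal (M * (B * R))"
proof -
  have [measurable]: "g \<in> borel_measurable \<pi>" by (rule ae_bounded_measurable[OF g])
  show "(\<lambda>\<omega>. ennreal ((\<Sum>j<M. (g (\<omega> j))\<^sup>2 - (\<integral>\<omega>. (g \<omega>)\<^sup>2 \<partial>\<pi>))\<^sup>2)) \<in> borel_measurable P"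
    unfolding P_def by measurable
  have u: "ae_bounded \<pi> (\<lambda>\<omega>. (g \<omega>)\<^sup>2)" by (rule ae_bounded_power[OF g])
  have "(\<integral>\<omega>. ((g \<omega>)\<^sup>2)\<^sup>2 \<partial>\<pi>) \<le> (\<integral>\<omega>. B * (g \<omega>)\<^sup>2 \<partial>\<pi>)"
  proof (rule integral_mono_AE)
    show "AE \<omega> in \<pi>. ((g \<omega>)\<^sup>2)\<^sup>2 \<le> B * (g \<omega>)\<^sup>2"
      using gb by eventually_elim (unfold power2_eq_square[of "(g _)\<^sup>2"], rule mult_right_mono, simp_all)
  qed (intro pi.integrable_ae_bounded ae_bounded_power ae_bounded_mult ae_bounded_const g)+
  also have "\<dots> \<le> B * R" using g2 \<open>0 \<le> B\<close> by (simp add: mult_left_mono)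
  finally have le: "(\<integral>\<omega>. ((g \<omega>)\<^sup>2)\<^sup>2 \<partial>\<pi>) \<le> B * R" .
  have "(\<integral>\<^sup>+\<omega>. ennreal ((\<Sum>j<M. (g (\<omega> j))\<^sup>2 - (\<integral>\<omega>. (g \<omega>)\<^sup>2 \<partial>\<pi>))\<^sup>2) \<partial>P) \<le> ennreal (M * (\<integral>\<omega>. ((g \<omega>)\<^sup>2)\<^sup>2 \<partial>\<pi>))"
    unfolding P_def
    by (rule nn_integral_PiM_square_sum_le[OF prob_\<pi> pi.integrable_ae_bounded[OF u]
          pi.integrable_ae_bounded[OF ae_bounded_power[OF u]] refl])
  also have "\<dots> \<le> ennreal (M * (B * R))"
    by (intro ennreal_leI mult_left_mono le) simp
  finally show "(\<integral>\<^sup>+\<omega>. ennreal ((\<Sum>j<M. (g (\<omega> j))\<^sup>2 - (\<integral>\<omega>. (g \<omega>)\<^sup>2 \<partial>\<pi>))\<^sup>2) \<partial>P) \<le> ennreal (M * (B * R))" .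
qed

definition feature :: "nat \<Rightarrow> (nat \<Rightarrow> 'w) \<Rightarrow> nat \<Rightarrow> 'x \<times> real \<Rightarrow> real"
  where "feature M \<omega> j z = \<psi> (fst z) (\<omega> j) / sqrt M"

text \<open>The constant 6 is 4 + 2: the errors of sampling and of regularization, each at most l R,
  double when they are combined, and the penalty contributes 2 l R.\<close>

lemma sampled_weights:
  fixes M :: nat and l R :: real
  assumes "0 < M" and l: "0 < l" and f: "f \<in> H"
    and fR: "(\<integral>z. (f (fst z) - f\<^sub>H (fst z))\<^sup>2 \<partial>\<rho>) \<le> l * R"
    and \<omega>: "\<And>j. j < M \<Longrightarrow> AE z in \<rho>. \<bar>\<psi> (fst z) (\<omega> j)\<bar> \<le> \<kappa>"
    and dev: "(\<integral>\<^sup>+z. ennreal ((\<Sum>j<M. \<psi> (fst z) (\<omega> j) * g (\<omega> j) - f (fst z))\<^sup>2) \<partial>\<rho>) \<le> ennreal (M\<^sup>2 * (l * R))"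
    and wts: "(\<Sum>j<M. (g (\<omega> j))\<^sup>2) \<le> 2 * M * R" and "0 \<le> R"
  defines "w \<equiv> \<lambda>j. g (\<omega> j) / sqrt M"
  shows "(\<integral>z. (lin_comb M (feature M \<omega>) w z - f\<^sub>H (fst z))\<^sup>2 \<partial>\<rho>) + l * (\<Sum>j<M. (w j)\<^sup>2) \<le> l * (6 * R)"
proof -
  have M: "0 < real M" using \<open>0 < M\<close> by simp
  have \<psi>: "ae_bounded \<rho> (\<lambda>z. \<psi> (fst z) (\<omega> j))" if "j < M" for j
    by (rule ae_bounded_\<psi>[OF \<omega>[OF that]]) (simp add: space_\<pi>)
  let ?h = "lin_comb M (feature M \<omega>) w"
  have h: "ae_bounded \<rho> ?h"
    unfolding feature_def divide_inverse
    by (intro ae_bounded_lin_comb ae_bounded_mult ae_bounded_const \<psi>)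
  have D: "ae_bounded \<rho> (\<lambda>z. ?h z - f (fst z))" by (intro ae_bounded_diff h ae_bounded_mem f)
  have eq: "(\<Sum>j<M. \<psi> (fst z) (\<omega> j) * g (\<omega> j) - f (fst z)) = M * (?h z - f (fst z))" for z
  proof -
    have "M * ?h z = (\<Sum>j<M. \<psi> (fst z) (\<omega> j) * g (\<omega> j))"
      unfolding lin_comb_def feature_def w_def sum_distrib_left
      by (intro sum.cong refl) (use M in simp)
    then show ?thesis by (simp add: sum_subtractf right_diff_distrib)
  qed
  have "ennreal (\<integral>z. (M * (?h z - f (fst z)))\<^sup>2 \<partial>\<rho>) \<le> ennreal (M\<^sup>2 * (l * R))"
    using dev unfolding eq
    by (subst (asm) nn_integral_eq_integral)
      (auto intro!: rho.integrable_ae_bounded ae_bounded_power ae_bounded_mult ae_bounded_const D)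
  then have "M\<^sup>2 * (\<integral>z. (?h z - f (fst z))\<^sup>2 \<partial>\<rho>) \<le> M\<^sup>2 * (l * R)"
    using l \<open>0 \<le> R\<close> by (subst (asm) ennreal_le_iff) (simp_all add: power_mult_distrib)
  then have 1: "(\<integral>z. (?h z - f (fst z))\<^sup>2 \<partial>\<rho>) \<le> l * R" using M by simp
  have "(\<integral>z. (?h z - f\<^sub>H (fst z))\<^sup>2 \<partial>\<rho>)
      \<le> (\<integral>z. 2 * (?h z - f (fst z))\<^sup>2 + 2 * (f (fst z) - f\<^sub>H (fst z))\<^sup>2 \<partial>\<rho>)"
  proof (intro integral_mono rho.integrable_ae_bounded ae_bounded_add ae_bounded_mult ae_bounded_const
      ae_bounded_power ae_bounded_diff h ae_bounded_mem f minimizer_mem)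
    fix z
    show "(?h z - f\<^sub>H (fst z))\<^sup>2 \<le> 2 * (?h z - f (fst z))\<^sup>2 + 2 * (f (fst z) - f\<^sub>H (fst z))\<^sup>2"
      using zero_le_power2[of "(?h z - f (fst z)) - (f (fst z) - f\<^sub>H (fst z))"]
      by (simp add: power2_eq_square algebra_simps)
  qed
  also have "\<dots> = 2 * (\<integral>z. (?h z - f (fst z))\<^sup>2 \<partial>\<rho>) + 2 * (\<integral>z. (f (fst z) - f\<^sub>H (fst z))\<^sup>2 \<partial>\<rho>)"
  proof -
    have "integrable \<rho> (\<lambda>z. (?h z - f (fst z))\<^sup>2)" "integrable \<rho> (\<lambda>z. (f (fst z) - f\<^sub>H (fst z))\<^sup>2)"
      by (intro rho.integrable_ae_bounded ae_bounded_power ae_bounded_diff h ae_bounded_mem f minimizer_mem)+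
    then show ?thesis by simp
  qed
  finally have 2: "(\<integral>z. (?h z - f\<^sub>H (fst z))\<^sup>2 \<partial>\<rho>) \<le> 4 * (l * R)" using 1 fR by linarith
  have "(\<Sum>j<M. (w j)\<^sup>2) = (\<Sum>j<M. (g (\<omega> j))\<^sup>2) / M"
    by (simp add: w_def power_divide sum_divide_distrib)
  also have "\<dots> \<le> 2 * R" using wts M by (simp add: pos_divide_le_eq mult_ac)
  finally have "l * (\<Sum>j<M. (w j)\<^sup>2) \<le> l * (2 * R)" using l by (intro mult_left_mono) auto
  with 2 show ?thesis by simp
qed

text \<open>Each of the two Markov bounds has ratio \<kappa>^2 / (l M): for \<open>N1\<close> the
  mean M \<kappa>^2 R is divided by M^2 l R, for \<open>N2\<close> the mean M \<kappa>^2 R^2 / l by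
  (M R)^2.\<close>

lemma good_features:
  fixes M :: nat and l :: real
  assumes "0 < M" and l: "0 < l"
  defines "P \<equiv> PiM {..<M} (\<lambda>_. \<pi>)" and "R \<equiv> ip f\<^sub>H f\<^sub>H + 1"
  obtains N where "N \<in> sets P" "emeasure P N \<le> ennreal (2 * \<kappa>\<^sup>2 / (l * M))"
    "\<And>\<omega> j. \<omega> \<in> space P - N \<Longrightarrow> j < M \<Longrightarrow> AE z in \<rho>. \<bar>\<psi> (fst z) (\<omega> j)\<bar> \<le> \<kappa>"
    "\<And>\<omega> j. \<omega> \<in> space P - N \<Longrightarrow> j < M \<Longrightarrow> (\<integral>z. residual z * \<psi> (fst z) (\<omega> j) \<partial>\<rho>) = 0"
    "\<And>\<omega>. \<omega> \<in> space P - N \<Longrightarrow>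
      \<exists>w. (\<integral>z. (lin_comb M (feature M \<omega>) w z - f\<^sub>H (fst z))\<^sup>2 \<partial>\<rho>) + l * (\<Sum>j<M. (w j)\<^sup>2) \<le> l * (6 * R)"
proof -
  have M: "0 < real M" using \<open>0 < M\<close> by simp
  have R: "0 < R" "ip f\<^sub>H f\<^sub>H \<le> R" using nonneg[OF minimizer_mem] by (simp_all add: R_def)
  obtain f g where f: "f \<in> H" and g: "ae_bounded \<pi> g"
    and gb': "AE \<omega> in \<pi>. (g \<omega>)\<^sup>2 \<le> \<kappa>\<^sup>2 * ip f\<^sub>H f\<^sub>H / l"
    and g2': "(\<integral>\<omega>. (g \<omega>)\<^sup>2 \<partial>\<pi>) \<le> ip f\<^sub>H f\<^sub>H" and rep: "\<And>x. f x = (\<integral>\<omega>. \<psi> x \<omega> * g \<omega> \<partial>\<pi>)"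
    and fR': "(\<integral>z. (f (fst z) - f\<^sub>H (fst z))\<^sup>2 \<partial>\<rho>) \<le> l * ip f\<^sub>H f\<^sub>H"
    by (rule feature_density[OF l]) (rule that)
  have g2: "(\<integral>\<omega>. (g \<omega>)\<^sup>2 \<partial>\<pi>) \<le> R" using g2' R(2) by linarith
  have fR: "(\<integral>z. (f (fst z) - f\<^sub>H (fst z))\<^sup>2 \<partial>\<rho>) \<le> l * R"
    by (rule order.trans[OF fR' mult_left_mono[OF R(2)]]) (use l in simp)
  have "\<kappa>\<^sup>2 * ip f\<^sub>H f\<^sub>H / l \<le> \<kappa>\<^sup>2 * R / l"
    using R(2) l by (intro divide_right_mono mult_left_mono) auto
  then have gb: "AE \<omega> in \<pi>. (g \<omega>)\<^sup>2 \<le> \<kappa>\<^sup>2 * R / l"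
    using gb' by (auto intro: order.trans elim!: AE_mp)
  have B: "0 \<le> \<kappa>\<^sup>2 * R / l" using R l by simp
  define m where "m = (\<integral>\<omega>. (g \<omega>)\<^sup>2 \<partial>\<pi>)"
  define F1 where "F1 \<omega> = (\<integral>\<^sup>+z. ennreal ((\<Sum>j<M. \<psi> (fst z) (\<omega> j) * g (\<omega> j) - f (fst z))\<^sup>2) \<partial>\<rho>)" for \<omega>
  define F2 where "F2 \<omega> = ennreal ((\<Sum>j<M. (g (\<omega> j))\<^sup>2 - m)\<^sup>2)" for \<omega>
  note dev1 = sampling_deviation[OF f g g2 rep, of M, folded P_def F1_def]
  note dev2 = weight_deviation[OF g gb g2 B, of M, folded P_def m_def, folded F2_def]
  define N1 where "N1 = {\<omega> \<in> space P. ennreal (M\<^sup>2 * (l * R)) \<le> F1 \<omega>}"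
  define N2 where "N2 = {\<omega> \<in> space P. ennreal ((M * R)\<^sup>2) \<le> F2 \<omega>}"
  have N12: "N1 \<in> sets P" "N2 \<in> sets P"
  proof -
    note [measurable] = dev1(1) dev2(1)
    show "N1 \<in> sets P" "N2 \<in> sets P" unfolding N1_def N2_def by measurable
  qed
  have "emeasure P N1 \<le> ennreal (M * (\<kappa>\<^sup>2 * R) / (M\<^sup>2 * (l * R)))"
    unfolding N1_def by (rule emeasure_ge_le[OF dev1]) (use M R l in auto)
  also have "M * (\<kappa>\<^sup>2 * R) / (M\<^sup>2 * (l * R)) = \<kappa>\<^sup>2 / (l * M)"
    using M R l by (simp add: power2_eq_square field_simps)
  finally have e1: "emeasure P N1 \<le> ennreal (\<kappa>\<^sup>2 / (l * M))" .
  have "emeasure P N2 \<le> ennreal (M * (\<kappa>\<^sup>2 * R / l * R) / (M * R)\<^sup>2)"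
    unfolding N2_def by (rule emeasure_ge_le[OF dev2]) (use M R l in auto)
  also have "M * (\<kappa>\<^sup>2 * R / l * R) / (M * R)\<^sup>2 = \<kappa>\<^sup>2 / (l * M)"
    using M R l by (simp add: power2_eq_square field_simps)
  finally have e2: "emeasure P N2 \<le> ennreal (\<kappa>\<^sup>2 / (l * M))" .
  have "AE \<omega> in P. (\<forall>j\<in>{..<M}. (AE z in \<rho>. \<bar>\<psi> (fst z) (\<omega> j)\<bar> \<le> \<kappa>) \<and> (\<integral>z. residual z * \<psi> (fst z) (\<omega> j) \<partial>\<rho>) = 0)"
  proof (rule AE_finite_allI)
    fix j assume j: "j \<in> {..<M}"
    have "AE \<omega> in \<pi>. (AE z in \<rho>. \<bar>\<psi> (fst z) \<omega>\<bar> \<le> \<kappa>) \<and> (\<integral>z. residual z * \<psi> (fst z) \<omega> \<partial>\<rho>) = 0"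
      using AE_\<pi>_\<rho> AE_residual_orthogonal_feature by eventually_elim simp
    then show "AE \<omega> in P. (AE z in \<rho>. \<bar>\<psi> (fst z) (\<omega> j)\<bar> \<le> \<kappa>) \<and> (\<integral>z. residual z * \<psi> (fst z) (\<omega> j) \<partial>\<rho>) = 0"
      unfolding P_def by (rule AE_PiM_component[OF prob_\<pi> j])
  qed simp
  \<comment> \<open>The exceptional parameters are enclosed in a measurable null set, so that the
    final bad event is measurable.\<close>
  then obtain N0 where N0: "{\<omega> \<in> space P. \<not> (\<forall>j\<in>{..<M}. (AE z in \<rho>. \<bar>\<psi> (fst z) (\<omega> j)\<bar> \<le> \<kappa>)
      \<and> (\<integral>z. residual z * \<psi> (fst z) (\<omega> j) \<partial>\<rho>) = 0)} \<subseteq> N0" "emeasure P N0 = 0" "N0 \<in> sets P"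
    by (rule AE_E)
  have good: "(AE z in \<rho>. \<bar>\<psi> (fst z) (\<omega> j)\<bar> \<le> \<kappa>) \<and> (\<integral>z. residual z * \<psi> (fst z) (\<omega> j) \<partial>\<rho>) = 0"
    if "\<omega> \<in> space P - (N0 \<union> (N1 \<union> N2))" "j < M" for \<omega> j
    using N0(1) that by blast
  show thesis
  proof (rule that[of "N0 \<union> (N1 \<union> N2)"])
    show "N0 \<union> (N1 \<union> N2) \<in> sets P" using N0(3) N12 by blast
    have "emeasure P (N0 \<union> (N1 \<union> N2)) \<le> emeasure P N0 + emeasure P (N1 \<union> N2)"
      by (rule emeasure_subadditive[OF N0(3) sets.Un[OF N12]])
    also have "\<dots> \<le> 0 + (emeasure P N1 + emeasure P N2)"
      unfolding N0(2) by (intro add_mono order.refl emeasure_subadditive N12)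
    also have "\<dots> \<le> 0 + (ennreal (\<kappa>\<^sup>2 / (l * M)) + ennreal (\<kappa>\<^sup>2 / (l * M)))"
      by (intro add_mono order.refl e1 e2)
    also have "\<dots> = ennreal (2 * \<kappa>\<^sup>2 / (l * M))"
      using l M by (simp add: ennreal_plus[symmetric] add_divide_distrib[symmetric] del: ennreal_plus)
    finally show "emeasure P (N0 \<union> (N1 \<union> N2)) \<le> ennreal (2 * \<kappa>\<^sup>2 / (l * M))" .
  next
    fix \<omega> j assume "\<omega> \<in> space P - (N0 \<union> (N1 \<union> N2))" "j < M"
    from good[OF this] show "AE z in \<rho>. \<bar>\<psi> (fst z) (\<omega> j)\<bar> \<le> \<kappa>"
      "(\<integral>z. residual z * \<psi> (fst z) (\<omega> j) \<partial>\<rho>) = 0" by blast+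
  next
    fix \<omega> assume \<omega>: "\<omega> \<in> space P - (N0 \<union> (N1 \<union> N2))"
    have dev: "F1 \<omega> \<le> ennreal (M\<^sup>2 * (l * R))"
      using \<omega> by (auto simp: N1_def)
    have wts: "(\<Sum>j<M. (g (\<omega> j))\<^sup>2) \<le> 2 * M * R"
    proof -
      have "\<not> ennreal ((M * R)\<^sup>2) \<le> F2 \<omega>" using \<omega> by (auto simp: N2_def)
      then have "\<not> (M * R)\<^sup>2 \<le> (\<Sum>j<M. (g (\<omega> j))\<^sup>2 - m)\<^sup>2" by (auto simp: F2_def ennreal_leI)
      then have "\<bar>\<Sum>j<M. (g (\<omega> j))\<^sup>2 - m\<bar> \<le> \<bar>M * R\<bar>" by (simp add: abs_le_square_iff)
      then have "(\<Sum>j<M. (g (\<omega> j))\<^sup>2) - M * m \<le> M * R" using M R by (simp add: sum_subtractf)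
      moreover have "M * m \<le> M * R" using g2 by (intro mult_left_mono) (simp_all add: m_def)
      ultimately show ?thesis by linarith
    qed
    show "\<exists>w. (\<integral>z. (lin_comb M (feature M \<omega>) w z - f\<^sub>H (fst z))\<^sup>2 \<partial>\<rho>) + l * (\<Sum>j<M. (w j)\<^sup>2) \<le> l * (6 * R)"
      using sampled_weights[OF \<open>0 < M\<close> l f fR _ dev[unfolded F1_def] wts] good[OF \<omega>] R(1) by fastforce
  qed
qed

section \<open>Excess risk with high probability\<close>

text \<open>The constant of \<open>ridge_excess_risk\<close> with the budget of
  \<open>good_features\<close> as its R. It depends on \<kappa>, \<open>b\<close> and the norm of
  \<open>f\<^sub>H\<close> only.\<close>

definition rate_const :: real
  where "rate_const = (let R = 6 * (ip f\<^sub>H f\<^sub>H + 1); L = \<kappa> * (b + \<kappa> * sqrt R) + sqrt R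
    in 4 * L\<^sup>2 + 8 * sqrt 2 * \<kappa>\<^sup>2 * L\<^sup>2 + 2 * R)"

lemma rate_const_pos: "0 < rate_const"
proof -
  have "0 < ip f\<^sub>H f\<^sub>H + 1" using nonneg[OF minimizer_mem] by linarith
  then show ?thesis
    unfolding rate_const_def Let_def by (intro add_nonneg_pos add_nonneg_nonneg mult_nonneg_nonneg) auto
qed

text \<open>Orthogonality is used twice: it lets \<open>f\<^sub>H\<close> stand in for the outputs
  in the population problem, and it identifies the excess risk of the estimator with a squared
  distance.\<close>

lemma excess_risk_fixed_features:
  fixes n M :: nat and p l :: real
  assumes "0 < M" "0 < n" and l: "l = 1 / sqrt n" and "1 \<le> p"
    and bd: "\<And>j. j < M \<Longrightarrow> AE z in \<rho>. \<bar>\<psi> (fst z) (\<omega> j)\<bar> \<le> \<kappa>"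
    and orth: "\<And>j. j < M \<Longrightarrow> (\<integral>z. residual z * \<psi> (fst z) (\<omega> j) \<partial>\<rho>) = 0"
    and w: "(\<integral>z. (lin_comb M (feature M \<omega>) w z - f\<^sub>H (fst z))\<^sup>2 \<partial>\<rho>) + l * (\<Sum>j<M. (w j)\<^sup>2) \<le> l * (6 * (ip f\<^sub>H f\<^sub>H + 1))"
  defines "Q \<equiv> PiM {..<n} (\<lambda>_. \<rho>)"
  obtains N where "N \<in> sets Q" "emeasure Q N \<le> ennreal (4 * exp (- p))"
    "\<And>z. z \<in> space Q - N \<Longrightarrow>
      expected_risk \<rho> (f_hat \<psi> n M l z \<omega>) - expected_risk \<rho> f\<^sub>H \<le> rate_const * p\<^sup>2 / sqrt n"
proof -
  have M: "0 < real M" using \<open>0 < M\<close> by simp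
  have l0: "0 < l" using \<open>0 < n\<close> by (simp add: l)
  have \<psi>: "ae_bounded \<rho> (\<lambda>z. \<psi> (fst z) (\<omega> j))" if "j < M" for j
    by (rule ae_bounded_\<psi>[OF bd[OF that]]) (simp add: space_\<pi>)
  have feat: "ae_bounded \<rho> (feature M \<omega> j)" if "j < M" for j
    unfolding feature_def[abs_def] divide_inverse by (intro ae_bounded_mult ae_bounded_const \<psi> that)
  have q: "ae_bounded \<rho> (\<lambda>z. f\<^sub>H (fst z))" by (rule ae_bounded_mem[OF minimizer_mem])
  have "AE z in \<rho>. \<forall>j\<in>{..<M}. \<bar>\<psi> (fst z) (\<omega> j)\<bar> \<le> \<kappa>"
    by (rule AE_finite_allI) (use bd in auto)
  then have feat_bd: "AE z in \<rho>. (\<Sum>j<M. (feature M \<omega> j z)\<^sup>2) \<le> \<kappa>\<^sup>2"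
  proof eventually_elim
    case (elim z)
    have "(\<Sum>j<M. (feature M \<omega> j z)\<^sup>2) \<le> (\<Sum>j<M. \<kappa>\<^sup>2 / M)"
    proof (rule sum_mono)
      fix j assume "j \<in> {..<M}"
      then have "(\<psi> (fst z) (\<omega> j))\<^sup>2 \<le> \<kappa>\<^sup>2" using elim \<kappa> by (simp add: abs_le_square_iff[symmetric])
      then show "(feature M \<omega> j z)\<^sup>2 \<le> \<kappa>\<^sup>2 / M" using M by (simp add: feature_def power_divide divide_right_mono)
    qed
    also have "\<dots> = \<kappa>\<^sup>2" using M by simp
    finally show ?case .
  qed
  have feat_res: "(\<integral>z. feature M \<omega> j z * residual z \<partial>\<rho>) = 0" if "j < M" for j
    using orth[OF that] by (simp add: feature_def mult.commute)
  have feat_y: "(\<integral>z. feature M \<omega> j z * f\<^sub>H (fst z) \<partial>\<rho>) = (\<integral>z. feature M \<omega> j z * snd z \<partial>\<rho>)" if "j < M" for j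
  proof -
    have "integrable \<rho> (\<lambda>z. feature M \<omega> j z * f\<^sub>H (fst z))" "integrable \<rho> (\<lambda>z. feature M \<omega> j z * snd z)"
      by (intro rho.integrable_ae_bounded ae_bounded_mult feat that q ae_bounded_snd)+
    then show ?thesis using feat_res[OF that] by (simp add: residual_def right_diff_distrib)
  qed
  have yb: "AE z in \<rho>. \<bar>snd z\<bar> \<le> b" using y_bound by (simp add: case_prod_unfold)
  have R: "0 \<le> 6 * (ip f\<^sub>H f\<^sub>H + 1)" using nonneg[OF minimizer_mem] by simp
  obtain N where N: "N \<in> sets Q" "emeasure Q N \<le> ennreal (4 * exp (- p))"
    and bound: "\<And>z w. z \<in> space Q - N \<Longrightarrow>
      \<forall>j<M. (\<Sum>k<M. (\<Sum>i<n. feature M \<omega> j (z i) * feature M \<omega> k (z i)) / n * w k) + l * w j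
        = (\<Sum>i<n. feature M \<omega> j (z i) * snd (z i)) / n \<Longrightarrow>
      (\<integral>z. (lin_comb M (feature M \<omega>) w z - f\<^sub>H (fst z))\<^sup>2 \<partial>\<rho>) \<le> rate_const * p\<^sup>2 / sqrt n"
    by (rule rho.ridge_excess_risk[OF ae_bounded_measurable[OF feat] feat_bd \<kappa> measurable_snd_\<rho> yb b q feat_y
          \<open>0 < n\<close> l R \<open>1 \<le> p\<close> w, folded Q_def rate_const_def[unfolded Let_def]])
      (assumption+, rule that)
  show thesis
  proof (rule that[OF N])
    fix z assume z: "z \<in> space Q - N"
    let ?w = "vec_index (w_hat \<psi> n M l z \<omega>)"
    have f_hat: "f_hat \<psi> n M l z \<omega> (fst u) = lin_comb M (feature M \<omega>) ?w u" for u :: "'x \<times> real"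
      unfolding f_hat_eq_sum[OF l0] lin_comb_def feature_def ..
    have ae: "ae_bounded \<rho> (\<lambda>u. f_hat \<psi> n M l z \<omega> (fst u))"
      unfolding f_hat by (rule ae_bounded_lin_comb[OF feat])
    have "(\<integral>u. f_hat \<psi> n M l z \<omega> (fst u) * residual u \<partial>\<rho>) = (\<Sum>j<M. ?w j * (\<integral>u. feature M \<omega> j u * residual u \<partial>\<rho>))"
      unfolding f_hat by (rule rho.integral_lin_comb_mult[OF feat ae_bounded_residual])
    also have "\<dots> = 0" using feat_res by simp
    finally have "expected_risk \<rho> (f_hat \<psi> n M l z \<omega>) - expected_risk \<rho> f\<^sub>H
        = (\<integral>u. (lin_comb M (feature M \<omega>) ?w u - f\<^sub>H (fst u))\<^sup>2 \<partial>\<rho>)"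
      using expected_risk_excess[OF ae] by (simp add: f_hat)
    also have "\<dots> \<le> rate_const * p\<^sup>2 / sqrt n"
    proof (rule bound[OF z], intro allI impI)
      fix j assume "j < M"
      from w_hat_normal_equations[OF l0 this, where n = n and \<psi> = \<psi> and z = z and \<omega> = \<omega>]
      show "(\<Sum>k<M. (\<Sum>i<n. feature M \<omega> j (z i) * feature M \<omega> k (z i)) / n * ?w k) + l * ?w j
        = (\<Sum>i<n. feature M \<omega> j (z i) * snd (z i)) / n"
        unfolding feature_def .
    qed
    finally show "expected_risk \<rho> (f_hat \<psi> n M l z \<omega>) - expected_risk \<rho> f\<^sub>H \<le> rate_const * p\<^sup>2 / sqrt n" .
  qed
qed

text \<open>\<open>measure\<close> is 0 on sets that are not measurable, so the success event has to
  be shown measurable; this also allows the bad event to be sliced.\<close>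

lemma measurable_excess_risk:
  assumes "0 < l"
  shows "(\<lambda>p. expected_risk \<rho> (f_hat \<psi> n M l (fst p) (snd p))) \<in> borel_measurable (sample_space \<rho> \<pi> n M)"
proof -
  let ?S = "sample_space \<rho> \<pi> n M"
  have zi: "(\<lambda>p. fst p i) \<in> ?S \<rightarrow>\<^sub>M \<rho>" if "i < n" for i
    unfolding sample_space_def
    by (rule measurable_compose[OF measurable_fst measurable_component_singleton]) (use that in simp)
  have wj: "(\<lambda>p. snd p j) \<in> ?S \<rightarrow>\<^sub>M \<pi>" if "j < M" for j
    unfolding sample_space_def
    by (rule measurable_compose[OF measurable_snd measurable_component_singleton]) (use that in simp)
  have w: "(\<lambda>p. vec_index (w_hat \<psi> n M l (fst p) (snd p)) j) \<in> borel_measurable ?S" if "j < M" for j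
  proof (rule borel_measurable_w_hat[OF assms _ _ that])
    show "(\<lambda>p. \<psi> (fst (fst p i)) (snd p j)) \<in> borel_measurable ?S" if "i < n" "j < M" for i j
      by (rule measurable_\<psi>_fst[OF zi[OF that(1)] wj[OF that(2)]])
    show "(\<lambda>p. snd (fst p i)) \<in> borel_measurable ?S" if "i < n" for i
      by (rule measurable_compose[OF zi[OF that] measurable_snd_\<rho>])
  qed
  have "(\<lambda>(p, u). (f_hat \<psi> n M l (fst p) (snd p) (fst u) - snd u)\<^sup>2) \<in> borel_measurable (?S \<Otimes>\<^sub>M \<rho>)"
    unfolding f_hat_eq_sum[OF assms] case_prod_unfold
  proof (intro borel_measurable_power borel_measurable_diff borel_measurable_sum borel_measurable_times
      borel_measurable_divide borel_measurable_const)
    fix j assume "j \<in> {..<M}"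
    then have j: "j < M" by simp
    show "(\<lambda>x. \<psi> (fst (snd x)) (snd (fst x) j)) \<in> borel_measurable (?S \<Otimes>\<^sub>M \<rho>)"
      by (rule measurable_\<psi>_fst[OF measurable_snd measurable_compose[OF measurable_fst wj[OF j]]])
    show "(\<lambda>x. vec_index (w_hat \<psi> n M l (fst (fst x)) (snd (fst x))) j) \<in> borel_measurable (?S \<Otimes>\<^sub>M \<rho>)"
      by (rule measurable_compose[OF measurable_fst w[OF j]])
  next
    show "(\<lambda>x. snd (snd x)) \<in> borel_measurable (?S \<Otimes>\<^sub>M \<rho>)"
      by (rule measurable_compose[OF measurable_snd measurable_snd_\<rho>])
  qed
  from rho.borel_measurable_lebesgue_integral[OF this] show ?thesis
    unfolding expected_risk_def by (simp add: case_prod_unfold)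
qed

text \<open>The bad event is sliced at fixed features. The set \<open>D\<close> of bad data may vary
  with \<omega> in any way, since only the slice of the measurable set \<open>Bad\<close> is
  integrated.\<close>

lemma excess_risk_probability:
  fixes n M :: nat and p l :: real
  assumes "0 < M" "0 < n" and l: "l = 1 / sqrt n" and p: "1 \<le> p"
  defines "S \<equiv> sample_space \<rho> \<pi> n M"
  shows "measure S {(z, \<omega>) \<in> space S. expected_risk \<rho> (f_hat \<psi> n M l z \<omega>) - expected_risk \<rho> f\<^sub>H
      \<le> rate_const * p\<^sup>2 / sqrt n} \<ge> 1 - (2 * \<kappa>\<^sup>2 / (l * M) + 4 * exp (- p))"
proof -
  define A where "A = PiM {..<n} (\<lambda>_. \<rho>)"
  define P where "P = PiM {..<M} (\<lambda>_. \<pi>)"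
  interpret A: prob_space A unfolding A_def by (intro prob_space_PiM prob_\<rho>)
  interpret P: prob_space P unfolding P_def by (intro prob_space_PiM prob_\<pi>)
  interpret AP: pair_prob_space A P ..
  have S: "S = A \<Otimes>\<^sub>M P" by (simp add: S_def sample_space_def A_def P_def)
  have l0: "0 < l" using \<open>0 < n\<close> by (simp add: l)
  define G where "G = {q \<in> space S. expected_risk \<rho> (f_hat \<psi> n M l (fst q) (snd q)) - expected_risk \<rho> f\<^sub>H
      \<le> rate_const * p\<^sup>2 / sqrt n}"
  have G: "G \<in> sets S"
    unfolding G_def S_def using measurable_excess_risk[OF l0, of n M] by measurable
  define Bad where "Bad = space S - G"
  have Bad: "Bad \<in> sets (A \<Otimes>\<^sub>M P)" unfolding Bad_def S[symmetric] using G by (rule sets.compl_sets)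
  obtain N where N: "N \<in> sets P" "emeasure P N \<le> ennreal (2 * \<kappa>\<^sup>2 / (l * M))"
    and 1: "\<And>\<omega> j. \<omega> \<in> space P - N \<Longrightarrow> j < M \<Longrightarrow> AE z in \<rho>. \<bar>\<psi> (fst z) (\<omega> j)\<bar> \<le> \<kappa>"
    and 2: "\<And>\<omega> j. \<omega> \<in> space P - N \<Longrightarrow> j < M \<Longrightarrow> (\<integral>z. residual z * \<psi> (fst z) (\<omega> j) \<partial>\<rho>) = 0"
    and 3: "\<And>\<omega>. \<omega> \<in> space P - N \<Longrightarrow>
      \<exists>w. (\<integral>z. (lin_comb M (feature M \<omega>) w z - f\<^sub>H (fst z))\<^sup>2 \<partial>\<rho>) + l * (\<Sum>j<M. (w j)\<^sup>2)
        \<le> l * (6 * (ip f\<^sub>H f\<^sub>H + 1))"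
    by (rule good_features[OF \<open>0 < M\<close> l0, folded P_def]) (rule that)
  \<comment> \<open>Bad features are charged the trivial bound 1, all others the conditional bound
    for the data.\<close>
  have slice: "emeasure A ((\<lambda>z. (z, \<omega>)) -` Bad) \<le> indicator N \<omega> + ennreal (4 * exp (- p))"
    if \<omega>: "\<omega> \<in> space P" for \<omega>
  proof (cases "\<omega> \<in> N")
    case True
    have "emeasure A ((\<lambda>z. (z, \<omega>)) -` Bad) \<le> 1" by (rule A.emeasure_le_1)
    with True show ?thesis by (simp add: add_increasing2)
  next
    case False
    with \<omega> have \<omega>N: "\<omega> \<in> space P - N" by simp
    obtain w where w: "(\<integral>z. (lin_comb M (feature M \<omega>) w z - f\<^sub>H (fst z))\<^sup>2 \<partial>\<rho>) + l * (\<Sum>j<M. (w j)\<^sup>2)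
        \<le> l * (6 * (ip f\<^sub>H f\<^sub>H + 1))" using 3[OF \<omega>N] by blast
    obtain D where D: "D \<in> sets A" "emeasure A D \<le> ennreal (4 * exp (- p))"
      "\<And>z. z \<in> space A - D \<Longrightarrow>
        expected_risk \<rho> (f_hat \<psi> n M l z \<omega>) - expected_risk \<rho> f\<^sub>H \<le> rate_const * p\<^sup>2 / sqrt n"
      by (rule excess_risk_fixed_features[OF \<open>0 < M\<close> \<open>0 < n\<close> l p 1[OF \<omega>N] 2[OF \<omega>N] w, folded A_def])
        (assumption+, rule that)
    have "(\<lambda>z. (z, \<omega>)) -` Bad \<subseteq> D"
      using D(3) \<omega> by (auto simp: Bad_def G_def S space_pair_measure)
    then have "emeasure A ((\<lambda>z. (z, \<omega>)) -` Bad) \<le> emeasure A D" by (rule emeasure_mono[OF _ D(1)])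
    with D(2) False show ?thesis by simp
  qed
  have "emeasure S Bad = (\<integral>\<^sup>+\<omega>. emeasure A ((\<lambda>z. (z, \<omega>)) -` Bad) \<partial>P)"
    unfolding S by (rule AP.emeasure_pair_measure_alt2[OF Bad])
  also have "\<dots> \<le> (\<integral>\<^sup>+\<omega>. indicator N \<omega> + ennreal (4 * exp (- p)) \<partial>P)"
    by (rule nn_integral_mono[OF slice])
  also have "\<dots> = emeasure P N + ennreal (4 * exp (- p))"
    using N(1) by (subst nn_integral_add) (auto simp: P.emeasure_space_1)
  also have "\<dots> \<le> ennreal (2 * \<kappa>\<^sup>2 / (l * M)) + ennreal (4 * exp (- p))"
    by (intro add_mono N(2) order.refl)
  also have "\<dots> = ennreal (2 * \<kappa>\<^sup>2 / (l * M) + 4 * exp (- p))"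
    using l0 by (intro ennreal_plus[symmetric]) auto
  finally have "emeasure S Bad \<le> ennreal (2 * \<kappa>\<^sup>2 / (l * M) + 4 * exp (- p))" .
  then have "measure S Bad \<le> 2 * \<kappa>\<^sup>2 / (l * M) + 4 * exp (- p)"
    unfolding S AP.emeasure_eq_measure using l0 by (subst (asm) ennreal_le_iff) auto
  moreover have "measure S Bad = 1 - measure S G"
    using AP.prob_compl[of G] G unfolding Bad_def S by simp
  moreover have "{(z, \<omega>) \<in> space S. expected_risk \<rho> (f_hat \<psi> n M l z \<omega>) - expected_risk \<rho> f\<^sub>H
      \<le> rate_const * p\<^sup>2 / sqrt n} = G"
    by (auto simp: G_def)
  ultimately show ?thesis by simp
qed

text \<open>The logarithmic factor in the number of features beats the constant \<open>1/\<delta>\<close> from Chebyshev's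
  inequality once \<open>n \<ge> exp (12/\<delta>)\<close>.\<close>

lemma number_of_features:
  fixes n :: nat and \<delta> :: real
  assumes \<delta>: "0 < \<delta>" "\<delta> \<le> 1" and n: "nat \<lceil>exp (12 / \<delta>)\<rceil> \<le> n"
  defines "M \<equiv> nat \<lceil>\<kappa>\<^sup>2 * sqrt n * ln (108 * \<kappa>\<^sup>2 * sqrt n / \<delta>)\<rceil>"
  shows "0 < n" and "0 < M" and "2 * \<kappa>\<^sup>2 / (1 / sqrt n * M) \<le> \<delta> / 3"
proof -
  have "exp (12 / \<delta>) \<le> n" using n by linarith
  then have n0: "0 < real n" by (rule less_le_trans[OF exp_gt_zero])
  then show "0 < n" by simp
  have \<kappa>2: "1 \<le> \<kappa>\<^sup>2" using \<kappa> by (rule one_le_power)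
  \<comment> \<open>The square root halves 12, and 6 is what makes 2 \<kappa>^2 sqrt n / M at most
    \<delta> / 3.\<close>
  have "6 / \<delta> \<le> ln (sqrt n)"
  proof -
    have "12 / \<delta> \<le> ln n" using \<open>exp (12 / \<delta>) \<le> n\<close> n0 by (simp add: ln_ge_iff)
    then show ?thesis using n0 by (simp add: ln_sqrt)
  qed
  also have "ln (sqrt n) \<le> ln (108 * \<kappa>\<^sup>2 * sqrt n / \<delta>)"
  proof (rule ln_mono)
    have "1 * sqrt n \<le> (108 * \<kappa>\<^sup>2 / \<delta>) * sqrt n"
      using \<delta> \<kappa>2 by (intro mult_right_mono) (simp_all add: pos_le_divide_eq)
    then show "sqrt n \<le> 108 * \<kappa>\<^sup>2 * sqrt n / \<delta>" by simp
  qed (use n0 in auto)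
  finally have ln: "6 / \<delta> \<le> ln (108 * \<kappa>\<^sup>2 * sqrt n / \<delta>)" .
  have "\<kappa>\<^sup>2 * sqrt n * (6 / \<delta>) \<le> \<kappa>\<^sup>2 * sqrt n * ln (108 * \<kappa>\<^sup>2 * sqrt n / \<delta>)"
    by (rule mult_left_mono[OF ln]) simp
  also have "\<dots> \<le> M" unfolding M_def by (rule real_nat_ceiling_ge)
  finally have M: "\<kappa>\<^sup>2 * sqrt n * (6 / \<delta>) \<le> M" .
  moreover have "0 < \<kappa>\<^sup>2 * sqrt n * (6 / \<delta>)"
    using \<kappa> n0 \<delta> by simp
  ultimately have M0: "0 < real M" by linarith
  then show "0 < M" by simp
  have "2 * \<kappa>\<^sup>2 / (1 / sqrt n * M) = 2 * \<kappa>\<^sup>2 * sqrt n / M" by simp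
  also have "\<dots> \<le> \<delta> / 3"
    using M M0 \<delta> by (simp add: field_simps)
  finally show "2 * \<kappa>\<^sup>2 / (1 / sqrt n * M) \<le> \<delta> / 3" .
qed

lemma excess_risk_rate:
  fixes n :: nat and \<delta> :: real
  assumes \<delta>: "0 < \<delta>" "\<delta> \<le> 1" and n: "nat \<lceil>exp (12 / \<delta>)\<rceil> \<le> n"
  defines "M \<equiv> nat \<lceil>\<kappa>\<^sup>2 * sqrt n * ln (108 * \<kappa>\<^sup>2 * sqrt n / \<delta>)\<rceil>"
    and "l \<equiv> real n powr (- 1 / 2)"
  shows "measure (sample_space \<rho> \<pi> n M) {(z, \<omega>) \<in> space (sample_space \<rho> \<pi> n M).
      expected_risk \<rho> (f_hat \<psi> n M l z \<omega>) - expected_risk \<rho> f\<^sub>H \<le> rate_const * (ln (18 / \<delta>))\<^sup>2 / sqrt n}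
    \<ge> 1 - \<delta>"
proof -
  note M = number_of_features[OF \<delta> n, folded M_def]
  have l: "l = 1 / sqrt n"
    by (simp add: l_def powr_minus powr_half_sqrt inverse_eq_divide)
  \<comment> \<open>Ensures that the exponent p = ln (18/\<delta>) is at least 1.\<close>
  have "exp 1 \<le> 18 / \<delta>"
  proof -
    have "exp 1 \<le> (3::real)" by (rule exp_le)
    also have "\<dots> \<le> 18 / \<delta>" using \<delta> by (simp add: pos_le_divide_eq)
    finally show ?thesis .
  qed
  then have p: "1 \<le> ln (18 / \<delta>)" using \<delta> by (simp add: ln_ge_iff)
  \<comment> \<open>The data fail with probability at most 2\<delta>/9, which together with
    \<delta>/3 for the features is below \<delta>.\<close>
  have "4 * exp (- ln (18 / \<delta>)) = 4 * \<delta> / 18" using \<delta> by (simp add: exp_minus)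
  then have "1 - \<delta> \<le> 1 - (2 * \<kappa>\<^sup>2 / (l * M) + 4 * exp (- ln (18 / \<delta>)))"
    using M(3) \<delta> unfolding l by linarith
  also note excess_risk_probability[OF M(2,1) l p]
  finally show ?thesis .
qed

end

theorem theorem1:
  fixes \<psi> :: "'x::{metric_space, second_countable_topology} \<Rightarrow> 'w::topological_space \<Rightarrow> real"
    and \<pi> :: "'w measure"
    and K :: "'x \<Rightarrow> 'x \<Rightarrow> real"
    and H :: "('x \<Rightarrow> real) set"
    and ip :: "('x \<Rightarrow> real) \<Rightarrow> ('x \<Rightarrow> real) \<Rightarrow> real"
    and \<kappa> b :: real
  assumes "prob_space \<pi>" and "sets \<pi> = sets borel"
    and "continuous_on UNIV (\<lambda>(x, \<omega>). \<psi> x \<omega>)"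
    and "\<And>x x'. integrable \<pi> (\<lambda>\<omega>. \<psi> x \<omega> * \<psi> x' \<omega>)"
    and "\<And>x x'. K x x' = (\<integral>\<omega>. \<psi> x \<omega> * \<psi> x' \<omega> \<partial>\<pi>)"
    and "rkhs K H ip"
    and "1 \<le> \<kappa>" and "0 < b"
  shows "\<exists>n0 :: real \<Rightarrow> nat. \<forall>(\<rho> :: ('x \<times> real) measure) f\<^sub>H.
    prob_space \<rho> \<and> sets \<rho> = sets borel \<and>
    (AE (x, \<omega>) in distr \<rho> borel fst \<Otimes>\<^sub>M \<pi>. \<bar>\<psi> x \<omega>\<bar> \<le> \<kappa>) \<and>
    (AE (x, y) in \<rho>. \<bar>y\<bar> \<le> b) \<and>
    is_arg_min (expected_risk \<rho>) (\<lambda>f. f \<in> H) f\<^sub>H \<longrightarrow>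
    (\<exists>c0 > 0. \<exists>c1 > 0. \<forall>\<delta> \<in> {0<..1}. \<forall>n \<ge> n0 \<delta>.
      let l = real n powr (- 1 / 2);
          M = nat \<lceil>c0 * sqrt (real n) * ln (108 * \<kappa>\<^sup>2 * sqrt (real n) / \<delta>)\<rceil>
      in measure (sample_space \<rho> \<pi> n M)
           {(z, \<omega>) \<in> space (sample_space \<rho> \<pi> n M).
              expected_risk \<rho> (f_hat \<psi> n M l z \<omega>) - expected_risk \<rho> f\<^sub>H
                \<le> c1 * (ln (18 / \<delta>))\<^sup>2 / sqrt (real n)}
         \<ge> 1 - \<delta>)"
proof (intro exI[of _ "\<lambda>\<delta>. nat \<lceil>exp (12 / \<delta>)\<rceil>"] allI impI)
  fix \<rho> :: "('x \<times> real) measure" and f\<^sub>H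
  assume \<rho>: "prob_space \<rho> \<and> sets \<rho> = sets borel \<and>
    (AE (x, \<omega>) in distr \<rho> borel fst \<Otimes>\<^sub>M \<pi>. \<bar>\<psi> x \<omega>\<bar> \<le> \<kappa>) \<and>
    (AE (x, y) in \<rho>. \<bar>y\<bar> \<le> b) \<and>
    is_arg_min (expected_risk \<rho>) (\<lambda>f. f \<in> H) f\<^sub>H"
  interpret random_features \<psi> \<pi> K H ip \<kappa> b \<rho> f\<^sub>H
    by (intro random_features.intro) (use assms \<rho> in simp_all)
  \<comment> \<open>The witness for \<open>c0\<close> is \<kappa>^2, independent of \<rho>; only
    \<open>c1\<close> feels the norm of \<open>f\<^sub>H\<close>.\<close>
  have "0 < \<kappa>\<^sup>2" using \<open>1 \<le> \<kappa>\<close> by simp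
  then show "\<exists>c0 > 0. \<exists>c1 > 0. \<forall>\<delta> \<in> {0<..1}. \<forall>n \<ge> nat \<lceil>exp (12 / \<delta>)\<rceil>.
      let l = real n powr (- 1 / 2);
          M = nat \<lceil>c0 * sqrt (real n) * ln (108 * \<kappa>\<^sup>2 * sqrt (real n) / \<delta>)\<rceil>
      in measure (sample_space \<rho> \<pi> n M)
           {(z, \<omega>) \<in> space (sample_space \<rho> \<pi> n M).
              expected_risk \<rho> (f_hat \<psi> n M l z \<omega>) - expected_risk \<rho> f\<^sub>H
                \<le> c1 * (ln (18 / \<delta>))\<^sup>2 / sqrt (real n)}
         \<ge> 1 - \<delta>"
    unfolding Let_def using rate_const_pos excess_risk_rate
    by (intro exI[of _ "\<kappa>\<^sup>2"] exI[of _ rate_const] conjI ballI allI impI) auto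
qed

end
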